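(* Suppose Assumption G stated in the context holds, and the penalty level and loadings are set as in the Algorithm stated in the context. Then there is a constant $\bar C$ such that for all $n$ large enough, uniformly for all $P\in\mathcal P_n$, with $\Pr_P$-probability $1-o(1)$, $$\sup_{u\in\mathcal U}\|f(X)'(\hat\theta_u-\theta_u)\|_{\mathbb P_n,2}\le\bar C\sqrt{\frac{s\log(p\vee n)}n},\qquad\sup_{u\in\mathcal U}\|\hat\theta_u-\theta_u\|_1\le\bar C\sqrt{\frac{s^2\log(p\vee n)}n},$$ and the estimator is uniformly sparse: $\sup_{u\in\mathcal U}\|\hat\theta_u\|_0\le\bar Cs$. For all $n$ large enough, uniformly for all $P\in\mathcal P_n$, with $\Pr_P$-probability $1-o(1)$, the Post-Lasso estimator $\tilde\theta_u$ corresponding to $\hat\theta_u$ obeys $$\sup_{u\in\mathcal U}\|f(X)'(\tilde\theta_u-\theta_u)\|_{\mathbb P_n,2}\le\bar C\sqrt{\frac{s\log(p\vee n)}n},\qquad\sup_{u\in\mathcal U}\|\tilde\theta_u-\theta_u\|_1\le\bar C\sqrt{\frac{s^2\log(p\vee n)}n}.$$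
   Context: **Notation.** $\mathbb E_n[g]=n^{-1}\sum_{i=1}^ng_i$ is the empirical expectation, $\mathbb P_n$ the empirical measure, $\|g\|_{\mathbb P_n,2}=(\mathbb E_n[g^2])^{1/2}$; $\|\cdot\|_0$ counts nonzero entries; $\|\cdot\|_1,\|\cdot\|,\|\cdot\|_\infty$ are the $\ell_1$, Euclidean and max norms. $N(\epsilon,\mathcal U,d_{\mathcal U})$ is the covering number. $\Phi$ is the standard normal cdf. "Suitably measurable" means image admissible Suslin (Dudley 1999, p. 186). $\delta_n\searrow0$, $\Delta_n\searrow0$ are fixed sequences going to zero at a speed at most polynomial in $n$; $\ell_n:=\log n$; $c,C,\kappa',\kappa''$ and $\underline c\le1/2$ are positive finite constants; $K_n$ a sequence of constants; $n_0$ fixed; $\mathcal P_n$ a set of probability measures. $s,p$ may depend on $n$. **Model.** For each $u\in\mathcal U$, $\mathrm E_P[Y_u\mid X]=\Lambda(f(X)'\theta_u)+r_u(X)$ with logistic link $\Lambda(t)=\exp(t)/\{1+\exp(t)\}$, where $f=(f_j)_{j=1}^p:\mathcal X\to\mathbb R^p$ are measurable transformations, $\theta_u\in\mathbb R^p$, $r_u$ is an approximation error. $\zeta_u:=Y_u-\mathrm E_P[Y_u\mid X]$. **Estimators.** Let $M(y,t)=-\{1(y=1)\log\Lambda(t)+1(y=0)\log(1-\Lambda(t))\}$. Given penalty level $\lambda$ and a diagonal loading matrix $\hat\Psi_u$, the Lasso estimator is $\hat\theta_u\in\arg\min_{\theta\in\mathbb R^p}\mathbb E_n[M(Y_u,f(X)'\theta)]+\frac\lambda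 n\|\hat\Psi_u\theta\|_1$, and the Post-Lasso estimator is $\tilde\theta_u\in\arg\min_{\theta\in\mathbb R^p}\{\mathbb E_n[M(Y_u,f(X)'\theta)]:\mathrm{supp}(\theta)\subseteq\mathrm{supp}(\hat\theta_u)\}$. **Algorithm (penalty level and loadings).** Choose $\gamma\in[1/n,\min\{1/\log n,pn^{d_u-1}\}]$ and a slack constant $c_\lambda>1$, and set $\lambda=c_\lambda\sqrt n\,\Phi^{-1}(1-\gamma/\{2pn^{d_u}\})$; choose a constant $K\ge1$ (upper bound on number of iterations). (0) Set $k=0$ and $\hat l_{uj,0}=\frac12\{\mathbb E_n[f_j^2(X)]\}^{1/2}$, $j=1,\dots,p$. (1) Compute the Lasso and Post-Lasso estimators $\hat\theta_u,\tilde\theta_u$ based on $\hat\Psi_u=\mathrm{diag}(\hat l_{uj,k},j=1,\dots,p)$. (2) Set $\hat l_{uj,k+1}:=\{\mathbb E_n[f_j^2(X)(Y_u-\Lambda(f(X)'\tilde\theta_u))^2]\}^{1/2}$. (3) If $k>K$ stop; otherwise set $k\leftarrow k+1$ and go to (1). **Assumption G.** $W$ is a random element of a measure space $(\mathcal W,\mathcal A_{\mathcal W})$ with law determined by $P\in\mathcal P_n$. The data $((Y_{ui})_{u\in\mathcal U},X_i)_{i=1}^n$ are $n$ i.i.d. copies of $((Y_u)_{u\in\mathcal U},X)$, generated as a suitably measurable transformation of $W$ and $u$. The model above holds with $Y_{ui}\in\{0,1\}$ and the logistic link for each $u\in\mathcal U\subset[0,1]^{d_u}$, where $d_u$ is fixed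 and $\mathcal U$ is equipped with the semi-metric $d_{\mathcal U}$. Uniformly for all $n\ge n_0$ and $P\in\mathcal P_n$: (i) $\sup_{u\in\mathcal U}\|\theta_u\|_0\le s$ and $\log(p\vee n)\le\delta_nn^{1/3}$. (ii) $\log N(\epsilon,\mathcal U,d_{\mathcal U})\le d_u\log(1/\epsilon)\vee0$, and $(\zeta_u,r_u)_{u\in\mathcal U}$ is a suitably measurable transformation of $W$ and $u$. (iii) Uniformly over $u\in\mathcal U$, $\max_{j\le p}\mathrm E_P[|f_j(X)|^3]\le C$ and $\underline c\le\mathrm E_P[Y_u\mid X]\le1-\underline c$ a.s. (iv) (a) $\sup_{u\in\mathcal U}|r_u(X)|\le\delta_n$ a.s.; $c\le\mathrm E_P[f_j^2(X)]\le C$, $j=1,\dots,p$; $\max_{j\le p}|f_j(X)|\le K_n$ a.s.; $K_n^2s^2\log^2(p\vee n)\le\delta_nn$. (b) With probability $1-\Delta_n$: $\sup_u\mathbb E_n[r_u^2(X)]\le Cs\log(p\vee n)/n$; $\sup_u\max_{j\le p}|(\mathbb E_n-\mathrm E_P)[f_j^2(X)\zeta_u^2]|\le\delta_n$; $\sup_{u,u'\in\mathcal U,d_{\mathcal U}(u,u')\le1/n}\max_{j\le p}\{\mathbb E_n[f_j(X)^2(\zeta_u-\zeta_{u'})^2]\}^{1/2}\le\delta_n$; and $\sup_{u,u'\in\mathcal U,d_{\mathcal U}(u,u')\le1/n}\|\mathbb E_n[f(X)(\zeta_u-\zeta_{u'})]\|_\infty\le\delta_nn^{-1/2}$. (c)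 With probability $1-\Delta_n$, $\kappa'\le\inf_{\|\delta\|_0\le s\ell_n,\|\delta\|=1}\|f(X)'\delta\|_{\mathbb P_n,2}\le\sup_{\|\delta\|_0\le s\ell_n,\|\delta\|=1}\|f(X)'\delta\|_{\mathbb P_n,2}\le\kappa''$. *)

theory Defs
  imports "HOL-Probability.Probability" "HOL-Library.Extended_Nat"
begin

section \<open>Vectors\<close>

text \<open>
  The dimension \<open>p\<close> varies with the sample size, so a vector of \<open>\<real>\<^sup>p\<close> is a function
  \<open>nat \<Rightarrow> real\<close> of which only the entries \<open>j < p\<close> are ever looked at.
\<close>

definition dotp :: "nat \<Rightarrow> (nat \<Rightarrow> real) \<Rightarrow> (nat \<Rightarrow> real) \<Rightarrow> real" where
  "dotp p a b = (\<Sum>j<p. a j * b j)"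

definition supp :: "nat \<Rightarrow> (nat \<Rightarrow> real) \<Rightarrow> nat set" where
  "supp p v = {j. j < p \<and> v j \<noteq> 0}"

definition norm_l0 :: "nat \<Rightarrow> (nat \<Rightarrow> real) \<Rightarrow> nat" where
  "norm_l0 p v = card (supp p v)"

definition norm_l1 :: "nat \<Rightarrow> (nat \<Rightarrow> real) \<Rightarrow> real" where
  "norm_l1 p v = (\<Sum>j<p. \<bar>v j\<bar>)"

definition norm_l2 :: "nat \<Rightarrow> (nat \<Rightarrow> real) \<Rightarrow> real" where
  "norm_l2 p v = sqrt (\<Sum>j<p. (v j)\<^sup>2)"


section \<open>Empirical expectations and probabilities\<close>

text \<open>Observations are numbered \<open>0, \<dots>, n - 1\<close>; \<open>g i\<close> is the value of \<open>g\<close> at observation \<open>i\<close>.\<close>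

definition emp_mean :: "nat \<Rightarrow> (nat \<Rightarrow> real) \<Rightarrow> real" where
  "emp_mean n g = (\<Sum>i<n. g i) / real n"

definition emp_norm2 :: "nat \<Rightarrow> (nat \<Rightarrow> real) \<Rightarrow> real" where
  "emp_norm2 n g = sqrt (emp_mean n (\<lambda>i. (g i)\<^sup>2))"

text \<open>The canonical space of \<open>n\<close> independent copies of \<open>W\<close>, each with law \<open>P\<close>.\<close>

definition iid_sample :: "nat \<Rightarrow> 'w measure \<Rightarrow> (nat \<Rightarrow> 'w) measure" where
  "iid_sample n P = (\<Pi>\<^sub>M i\<in>{..<n}. P)"

text \<open>
  Suprema over an uncountable index set and arbitrary selections of minimisers need not be
  measurable, so probabilities are inner probabilities.
\<close>

definition with_prob_ge :: "'a measure \<Rightarrow> real \<Rightarrow> ('a \<Rightarrow> bool) \<Rightarrow> bool" where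
  "with_prob_ge M q Q \<longleftrightarrow> (\<exists>A\<in>sets M. q \<le> measure M A \<and> (\<forall>\<omega>\<in>A. Q \<omega>))"

text \<open>
  For all large \<open>n\<close>, uniformly over \<open>P \<in> \<P> n\<close>, the event \<open>Q n P\<close> has probability \<open>1 - o(1)\<close>.
\<close>

definition uniformly_whp ::
    "(nat \<Rightarrow> 'w measure set) \<Rightarrow> (nat \<Rightarrow> 'w measure \<Rightarrow> (nat \<Rightarrow> 'w) \<Rightarrow> bool) \<Rightarrow> bool" where
  "uniformly_whp \<P> Q \<longleftrightarrow>
    (\<exists>\<eta> :: nat \<Rightarrow> real. \<eta> \<longlonglongrightarrow> 0 \<and>
      (\<forall>\<^sub>F n in sequentially. \<forall>P\<in>\<P> n. with_prob_ge (iid_sample n P) (1 - \<eta> n) (Q n P)))"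

text \<open>Decreases to zero at a speed that is at most polynomial.\<close>

definition poly_slow_null :: "(nat \<Rightarrow> real) \<Rightarrow> bool" where
  "poly_slow_null d \<longleftrightarrow> decseq d \<and> d \<longlonglongrightarrow> 0 \<and>
    (\<exists>a b. 0 < b \<and> (\<forall>n\<ge>1. b * real n powr (- a) \<le> d n))"


section \<open>Semi-metrics and covering numbers\<close>

definition semimetric_on :: "'u set \<Rightarrow> ('u \<Rightarrow> 'u \<Rightarrow> real) \<Rightarrow> bool" where
  "semimetric_on U d \<longleftrightarrow>
    (\<forall>u\<in>U. d u u = 0) \<and> (\<forall>u\<in>U. \<forall>v\<in>U. 0 \<le> d u v \<and> d u v = d v u) \<and>
    (\<forall>u\<in>U. \<forall>v\<in>U. \<forall>w\<in>U. d u w \<le> d u v + d v w)"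

text \<open>Smallest number of closed balls of radius \<open>\<epsilon>\<close> with centres in \<open>U\<close> that cover \<open>U\<close>
  (infinite if there is no finite cover).\<close>

definition covering_number :: "real \<Rightarrow> 'u set \<Rightarrow> ('u \<Rightarrow> 'u \<Rightarrow> real) \<Rightarrow> enat" where
  "covering_number \<epsilon> U d =
    (INF F\<in>{F. finite F \<and> F \<subseteq> U \<and> (\<forall>u\<in>U. \<exists>v\<in>F. d u v \<le> \<epsilon>)}. enat (card F))"


section \<open>Image admissible Suslin families\<close>

text \<open>
  A measurable space is Suslin if it is countably generated, contains the singletons, and is the
  image of a Polish space under a Borel map. Since every Polish space is homeomorphic to a closed
  subspace of \<open>\<real>\<^sup>\<nat>\<close>, Polish spaces are taken on subsets of the type \<open>nat \<Rightarrow> real\<close>.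
\<close>

definition suslin_space :: "'y measure \<Rightarrow> bool" where
  "suslin_space S \<longleftrightarrow>
    (\<exists>E. countable E \<and> E \<subseteq> Pow (space S) \<and> sets S = sigma_sets (space S) E) \<and>
    (\<forall>y\<in>space S. {y} \<in> sets S) \<and>
    (\<exists>(Z :: (nat \<Rightarrow> real) topology) g.
       completely_metrizable_space Z \<and> second_countable Z \<and>
       g \<in> measurable (sigma (topspace Z) {A. openin Z A}) S \<and> g ` topspace Z = space S)"

text \<open>
  The family \<open>V u w\<close>, \<open>u \<in> U\<close>, is image admissible Suslin if it is parametrised, jointly
  measurably, by a Suslin space \<open>S\<close> mapped onto \<open>U\<close> by \<open>T\<close>. A Suslin space is
  isomorphic to a subset of the real line with the trace of the Borel sets, so \<open>S\<close> may be
  taken on the type \<open>real\<close>.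
\<close>

definition image_admissible_suslin ::
    "'u set \<Rightarrow> 'w measure \<Rightarrow> 'v measure \<Rightarrow> ('u \<Rightarrow> 'w \<Rightarrow> 'v) \<Rightarrow> bool" where
  "image_admissible_suslin U M N V \<longleftrightarrow>
    (\<exists>(S :: real measure) T. suslin_space S \<and> T ` space S = U \<and>
       (\<lambda>(y, w). V (T y) w) \<in> measurable (S \<Otimes>\<^sub>M M) N)"


section \<open>Logistic Lasso and Post-Lasso\<close>

definition logistic :: "real \<Rightarrow> real" where
  "logistic t = exp t / (1 + exp t)"

definition logit_loss :: "real \<Rightarrow> real \<Rightarrow> real" where
  "logit_loss y t =
    - (of_bool (y = 1) * ln (logistic t) + of_bool (y = 0) * ln (1 - logistic t))"

text \<open>
  Below, \<open>y i\<close> is the outcome and \<open>z i j\<close> the \<open>j\<close>-th regressor of observation \<open>i\<close>.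
\<close>

definition emp_loss ::
    "nat \<Rightarrow> nat \<Rightarrow> (nat \<Rightarrow> real) \<Rightarrow> (nat \<Rightarrow> nat \<Rightarrow> real) \<Rightarrow> (nat \<Rightarrow> real) \<Rightarrow> real" where
  "emp_loss n p y z \<theta> = emp_mean n (\<lambda>i. logit_loss (y i) (dotp p (z i) \<theta>))"

definition lasso_set ::
    "nat \<Rightarrow> nat \<Rightarrow> real \<Rightarrow> (nat \<Rightarrow> real) \<Rightarrow> (nat \<Rightarrow> real) \<Rightarrow> (nat \<Rightarrow> nat \<Rightarrow> real) \<Rightarrow> (nat \<Rightarrow> real) set" where
  "lasso_set n p lam l y z =
    {\<theta>. is_arg_min (\<lambda>\<theta>. emp_loss n p y z \<theta> + lam / real n * norm_l1 p (\<lambda>j. l j * \<theta> j))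
          (\<lambda>_. True) \<theta>}"

definition post_lasso_set ::
    "nat \<Rightarrow> nat \<Rightarrow> (nat \<Rightarrow> real) \<Rightarrow> (nat \<Rightarrow> nat \<Rightarrow> real) \<Rightarrow> (nat \<Rightarrow> real) \<Rightarrow> (nat \<Rightarrow> real) set" where
  "post_lasso_set n p y z \<theta>h =
    {\<theta>. is_arg_min (emp_loss n p y z) (\<lambda>\<theta>. supp p \<theta> \<subseteq> supp p \<theta>h) \<theta>}"

text \<open>
  A minimiser is selected whenever there is one. The unpenalised Post-Lasso criterion does not
  attain its infimum when the data are separated; requiring membership unconditionally would
  then be unsatisfiable. Where the criterion has no minimiser the selected value is arbitrary.
\<close>

definition selects :: "'a set \<Rightarrow> 'a \<Rightarrow> bool" where
  "selects A x \<longleftrightarrow> (A \<noteq> {} \<longrightarrow> x \<in> A)"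

definition std_normal_cdf :: "real \<Rightarrow> real" where
  "std_normal_cdf = cdf (density lborel (\<lambda>x. ennreal (std_normal_density x)))"

definition penalty_level :: "real \<Rightarrow> real \<Rightarrow> nat \<Rightarrow> nat \<Rightarrow> nat \<Rightarrow> real" where
  "penalty_level c_pen \<gamma> du n p =
    c_pen * sqrt (real n) * inv std_normal_cdf (1 - \<gamma> / (2 * real p * real n ^ du))"

definition initial_loading :: "nat \<Rightarrow> (nat \<Rightarrow> nat \<Rightarrow> real) \<Rightarrow> nat \<Rightarrow> real" where
  "initial_loading n z j = 1 / 2 * sqrt (emp_mean n (\<lambda>i. (z i j)\<^sup>2))"

definition updated_loading ::
    "nat \<Rightarrow> nat \<Rightarrow> (nat \<Rightarrow> real) \<Rightarrow> (nat \<Rightarrow> nat \<Rightarrow> real) \<Rightarrow> (nat \<Rightarrow> real) \<Rightarrow> nat \<Rightarrow> real" where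
  "updated_loading n p y z \<theta> j =
    sqrt (emp_mean n (\<lambda>i. (z i j)\<^sup>2 * (y i - logistic (dotp p (z i) \<theta>))\<^sup>2))"

text \<open>
  \<open>\<theta>h\<close> and \<open>\<theta>t\<close> are the Lasso and Post-Lasso estimates with which the algorithm ends. The
  estimates are computed before the stopping test \<open>k > K\<close>, which first succeeds at \<open>k = K + 1\<close>.
\<close>

definition algorithm_output ::
    "nat \<Rightarrow> nat \<Rightarrow> real \<Rightarrow> nat \<Rightarrow> (nat \<Rightarrow> real) \<Rightarrow> (nat \<Rightarrow> nat \<Rightarrow> real)
      \<Rightarrow> (nat \<Rightarrow> real) \<Rightarrow> (nat \<Rightarrow> real) \<Rightarrow> bool" where
  "algorithm_output n p lam K y z \<theta>h \<theta>t \<longleftrightarrow>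
    (\<exists>(l :: nat \<Rightarrow> nat \<Rightarrow> real) h t.
       (\<forall>j<p. l 0 j = initial_loading n z j) \<and>
       (\<forall>k\<le>K + 1. selects (lasso_set n p lam (l k) y z) (h k) \<and>
                  selects (post_lasso_set n p y z (h k)) (t k) \<and>
                  (\<forall>j<p. l (k + 1) j = updated_loading n p y z (t k) j)) \<and>
       \<theta>h = h (K + 1) \<and> \<theta>t = t (K + 1))"


section \<open>Model and assumptions\<close>

text \<open>
  \<open>W\<close> is used only as the measurable space of the random element \<open>W\<close>, and \<open>XS\<close> as the
  measurable space of \<open>X\<close>. The outcomes \<open>Y u\<close> and the covariates \<open>X\<close> are functions of \<open>W\<close>;
  \<open>f n x j\<close> is the \<open>j\<close>-th transformation at sample size \<open>n\<close>; the parameter \<open>\<theta>\<close> and the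
  approximation error \<open>r\<close> depend on \<open>n\<close>, \<open>P\<close> and \<open>u\<close>. Points of \<open>[0,1]\<^sup>d\<close> with \<open>d = du\<close> are
  extensional functions on \<open>{..<du}\<close>, which includes \<open>du = 0\<close>.
\<close>

locale functional_logit =
  fixes W :: "'w measure" and XS :: "'x measure"
    and U :: "(nat \<Rightarrow> real) set" and du :: nat
    and dU :: "(nat \<Rightarrow> real) \<Rightarrow> (nat \<Rightarrow> real) \<Rightarrow> real"
    and X :: "'w \<Rightarrow> 'x" and Y :: "(nat \<Rightarrow> real) \<Rightarrow> 'w \<Rightarrow> real"
    and \<P> :: "nat \<Rightarrow> 'w measure set"
    and p :: "nat \<Rightarrow> nat" and f :: "nat \<Rightarrow> 'x \<Rightarrow> nat \<Rightarrow> real"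
    and \<theta> :: "nat \<Rightarrow> 'w measure \<Rightarrow> (nat \<Rightarrow> real) \<Rightarrow> nat \<Rightarrow> real"
    and r :: "nat \<Rightarrow> 'w measure \<Rightarrow> (nat \<Rightarrow> real) \<Rightarrow> 'x \<Rightarrow> real"
begin

text \<open>
  The right-hand side of the model equation. Conditional expectations are determined only up to
  \<open>u\<close>-dependent null sets; wherever a statement involves all \<open>u\<close> at once, this is the version of
  \<open>E[Y u | X]\<close> that is meant.
\<close>

definition reg :: "nat \<Rightarrow> 'w measure \<Rightarrow> (nat \<Rightarrow> real) \<Rightarrow> 'x \<Rightarrow> real" where
  "reg n P u x = logistic (dotp (p n) (f n x) (\<theta> n P u)) + r n P u x"

definition \<zeta> :: "nat \<Rightarrow> 'w measure \<Rightarrow> (nat \<Rightarrow> real) \<Rightarrow> 'w \<Rightarrow> real" where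
  "\<zeta> n P u w = Y u w - reg n P u (X w)"

end

locale assumption_G = functional_logit W XS U du dU X Y \<P> p f \<theta> r
  for W :: "'w measure" and XS :: "'x measure"
    and U du dU X Y \<P> p f \<theta> r +
  fixes s :: "nat \<Rightarrow> nat" and K \<delta> \<Delta> :: "nat \<Rightarrow> real" and n\<^sub>0 :: nat
    and c C cl \<kappa>1 \<kappa>2 :: real
  assumes constants: "0 < c" "0 < C" "0 < cl" "cl \<le> 1 / 2" "0 < \<kappa>1" "0 < \<kappa>2"
    and n0: "2 \<le> n\<^sub>0"   \<comment> \<open>so that \<open>ln n > 0\<close>; immaterial, since only large \<open>n\<close> matter\<close>
    and null_sequences: "poly_slow_null \<delta>" "poly_slow_null \<Delta>"
    and index_set: "U \<subseteq> {..<du} \<rightarrow>\<^sub>E {0..1}" "semimetric_on U dU"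
    and law: "\<And>n P. n \<ge> n\<^sub>0 \<Longrightarrow> P \<in> \<P> n \<Longrightarrow> prob_space P \<and> sets P = sets W"
    and X_measurable: "X \<in> measurable W XS"
    and f_measurable: "\<And>n j. n \<ge> n\<^sub>0 \<Longrightarrow> j < p n \<Longrightarrow> (\<lambda>x. f n x j) \<in> borel_measurable XS"
    and data_suslin: "image_admissible_suslin U W (borel \<Otimes>\<^sub>M XS) (\<lambda>u w. (Y u w, X w))"
    and binary: "\<And>u w. u \<in> U \<Longrightarrow> w \<in> space W \<Longrightarrow> Y u w \<in> {0, 1}"
    and model: "\<And>n P u. n \<ge> n\<^sub>0 \<Longrightarrow> P \<in> \<P> n \<Longrightarrow> u \<in> U \<Longrightarrow>
      AE w in P. real_cond_exp P (vimage_algebra (space P) X XS) (Y u) w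
        = logistic (dotp (p n) (f n (X w)) (\<theta> n P u)) + r n P u (X w)"
    \<comment> \<open>(i)\<close>
    and s_pos: "\<And>n. n \<ge> n\<^sub>0 \<Longrightarrow> 1 \<le> s n"
    and sparsity: "\<And>n P u. n \<ge> n\<^sub>0 \<Longrightarrow> P \<in> \<P> n \<Longrightarrow> u \<in> U \<Longrightarrow> norm_l0 (p n) (\<theta> n P u) \<le> s n"
    and dimension: "\<And>n. n \<ge> n\<^sub>0 \<Longrightarrow> ln (max (real (p n)) (real n)) \<le> \<delta> n * real n powr (1 / 3)"
    \<comment> \<open>(ii)\<close>
    and entropy: "\<And>\<epsilon>. \<epsilon> > 0 \<Longrightarrow> covering_number \<epsilon> U dU \<noteq> \<infinity> \<and>
      ln (real (the_enat (covering_number \<epsilon> U dU))) \<le> max (real du * ln (1 / \<epsilon>)) 0"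
    and noise_suslin: "\<And>n P. n \<ge> n\<^sub>0 \<Longrightarrow> P \<in> \<P> n \<Longrightarrow>
      image_admissible_suslin U W (borel \<Otimes>\<^sub>M borel) (\<lambda>u w. (\<zeta> n P u w, r n P u (X w)))"
    \<comment> \<open>(iii)\<close>
    and third_moments: "\<And>n P j. n \<ge> n\<^sub>0 \<Longrightarrow> P \<in> \<P> n \<Longrightarrow> j < p n \<Longrightarrow>
      (\<integral>w. \<bar>f n (X w) j\<bar> ^ 3 \<partial>P) \<le> C"
    and non_degenerate: "\<And>n P. n \<ge> n\<^sub>0 \<Longrightarrow> P \<in> \<P> n \<Longrightarrow>
      AE w in P. \<forall>u\<in>U. cl \<le> reg n P u (X w) \<and> reg n P u (X w) \<le> 1 - cl"
    \<comment> \<open>(iv)(a)\<close>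
    and approx_error: "\<And>n P. n \<ge> n\<^sub>0 \<Longrightarrow> P \<in> \<P> n \<Longrightarrow>
      AE w in P. \<forall>u\<in>U. \<bar>r n P u (X w)\<bar> \<le> \<delta> n"
    and second_moments: "\<And>n P j. n \<ge> n\<^sub>0 \<Longrightarrow> P \<in> \<P> n \<Longrightarrow> j < p n \<Longrightarrow>
      c \<le> (\<integral>w. (f n (X w) j)\<^sup>2 \<partial>P) \<and> (\<integral>w. (f n (X w) j)\<^sup>2 \<partial>P) \<le> C"
    and bounded: "\<And>n P. n \<ge> n\<^sub>0 \<Longrightarrow> P \<in> \<P> n \<Longrightarrow>
      AE w in P. \<forall>j<p n. \<bar>f n (X w) j\<bar> \<le> K n"
    and growth: "\<And>n. n \<ge> n\<^sub>0 \<Longrightarrow>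
      (K n)\<^sup>2 * (real (s n))\<^sup>2 * (ln (max (real (p n)) (real n)))\<^sup>2 \<le> \<delta> n * real n"
    \<comment> \<open>(iv)(b)\<close>
    and empirical: "\<And>n P. n \<ge> n\<^sub>0 \<Longrightarrow> P \<in> \<P> n \<Longrightarrow>
      with_prob_ge (iid_sample n P) (1 - \<Delta> n) (\<lambda>\<omega>.
        (\<forall>u\<in>U. emp_mean n (\<lambda>i. (r n P u (X (\<omega> i)))\<^sup>2)
           \<le> C * real (s n) * ln (max (real (p n)) (real n)) / real n) \<and>
        (\<forall>u\<in>U. \<forall>j<p n.
           \<bar>emp_mean n (\<lambda>i. (f n (X (\<omega> i)) j)\<^sup>2 * (\<zeta> n P u (\<omega> i))\<^sup>2)
             - (\<integral>w. (f n (X w) j)\<^sup>2 * (\<zeta> n P u w)\<^sup>2 \<partial>P)\<bar> \<le> \<delta> n) \<and>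
        (\<forall>u\<in>U. \<forall>v\<in>U. dU u v \<le> 1 / real n \<longrightarrow> (\<forall>j<p n.
           sqrt (emp_mean n (\<lambda>i. (f n (X (\<omega> i)) j)\<^sup>2 * (\<zeta> n P u (\<omega> i) - \<zeta> n P v (\<omega> i))\<^sup>2))
             \<le> \<delta> n)) \<and>
        (\<forall>u\<in>U. \<forall>v\<in>U. dU u v \<le> 1 / real n \<longrightarrow> (\<forall>j<p n.
           \<bar>emp_mean n (\<lambda>i. f n (X (\<omega> i)) j * (\<zeta> n P u (\<omega> i) - \<zeta> n P v (\<omega> i)))\<bar>
             \<le> \<delta> n * real n powr (- 1 / 2))))"
    \<comment> \<open>(iv)(c)\<close>
    and sparse_eigenvalues: "\<And>n P. n \<ge> n\<^sub>0 \<Longrightarrow> P \<in> \<P> n \<Longrightarrow>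
      with_prob_ge (iid_sample n P) (1 - \<Delta> n) (\<lambda>\<omega>.
        \<forall>v. real (norm_l0 (p n) v) \<le> real (s n) * ln (real n) \<and> norm_l2 (p n) v = 1 \<longrightarrow>
          \<kappa>1 \<le> emp_norm2 n (\<lambda>i. dotp (p n) (f n (X (\<omega> i))) v) \<and>
          emp_norm2 n (\<lambda>i. dotp (p n) (f n (X (\<omega> i))) v) \<le> \<kappa>2)"

end

theory Submission
  imports Defs
begin

text \<open>
  Fix \<open>u\<close> and the sample. Once the penalty dominates the score at the truth, the estimation error
  lies in a cone on which the sparse eigenvalues, of order \<open>s log n\<close>, bound the Euclidean norm by
  the prediction norm. The loss is uniformly convex along errors with small predictions, and by
  convexity an error can be shrunk until its predictions are small; this gives the rates. The
  first order conditions bound the size of the support, and Post-Lasso is treated by the same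
  shrinking argument with the cone replaced by sparsity. The same bounds applied to sublevel sets
  show that both criteria have minimisers. The updated loadings are then close to the
  ideal ones, the square roots of \<open>E[f\<^sub>j\<^sup>2 \<zeta>\<^sub>u\<^sup>2]\<close>, and the argument repeats in each round.

  Since \<open>c_pen > 1\<close>, domination of the score needs no sharp moderate deviation bound for
  self-normalised sums: by \<open>K\<^sub>n\<^sup>2 log\<^sup>2 (p \<or> n) = o(n)\<close> a Chernoff bound has exponent
  \<open>(1 + \<eta>) x\<^sup>2 / 2\<close> at the normal quantile \<open>x\<close>, and the factor \<open>exp (- \<eta> x\<^sup>2 / 2)\<close> absorbs the
  polynomial corrections to the normal tail. A union bound over \<open>j\<close> and over a \<open>1/n\<close>-net of \<open>U\<close>
  then costs \<open>O(\<gamma>)\<close>.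
\<close>

section \<open>The logistic loss\<close>

text \<open>The deterministic part treats one sample and one \<open>u\<close> with constants that
  depend on neither; the probabilistic part produces a single event, \<open>regular\<close>, defined
  without reference to the estimators. Uniformity over \<open>u\<close> and \<open>P\<close> is then
  automatic, whatever minimisers are selected. The loadings are random and change from round to
  round. The score is therefore compared with a deterministic \<open>lb\<close> below all of them,
  so one score bound serves every round and the constants do not grow with the number of rounds. The
  initial loading qualifies because a binary outcome has conditional variance at most 1/4. The
  approximation error is kept out of the score. Cauchy-Schwarz turns it into a multiple of
  \<open>sqrt s * \<mu>\<close> times the prediction norm, with \<open>\<mu>\<close> the penalty
  level over \<open>n\<close>; this matches the rate because the normal quantile is at least of
  order \<open>sqrt (log (p \<or> n))\<close>. Post-Lasso is delicate in two ways: its loss may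
  exceed that of the truth, whose support can be missed, and its infimum may not be attained. Both
  are settled through the Lasso bounds.\<close>

lemma logistic_bounds: "0 < logistic t" "logistic t < 1"
  by (auto simp: logistic_def add_pos_pos)

lemma logistic_variance_eq: "logistic t * (1 - logistic t) = 1 / (exp t + exp (- t) + 2)"
proof -
  have "1 + exp t \<noteq> (0::real)" using exp_gt_zero[of t] by linarith
  then have "logistic t * (1 - logistic t) = exp t / (1 + exp t)\<^sup>2"
    by (simp add: logistic_def field_simps power2_eq_square)
  also have "\<dots> = 1 / ((1 + exp t)\<^sup>2 / exp t)" by simp
  also have "(1 + exp t)\<^sup>2 / exp t = exp t + exp (- t) + 2"
    by (simp add: field_simps power2_eq_square exp_minus)
  finally show ?thesis .
qed

lemma logistic_variance_nonneg: "0 \<le> logistic t * (1 - logistic t)"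
  using logistic_bounds[of t] by simp

lemma mult_one_minus_le: "a * (1 - a) \<le> 1 / 4" for a :: real
proof -
  have "0 \<le> (a - 1 / 2)\<^sup>2" by simp
  then show ?thesis by (simp add: power2_eq_square algebra_simps)
qed

text \<open>Self-concordance of the logistic link: the denominator
  \<open>exp t + exp (- t) + 2\<close> grows by a factor of at most
  \<open>exp \<bar>h\<bar>\<close>, term by term. Curvature at the truth thus survives along bounded
  predictions.\<close>

lemma logistic_variance_shift:
  "exp (- \<bar>h\<bar>) * (logistic t * (1 - logistic t)) \<le> logistic (t + h) * (1 - logistic (t + h))"
proof -
  have "exp (t + h) \<le> exp \<bar>h\<bar> * exp t" "exp (- (t + h)) \<le> exp \<bar>h\<bar> * exp (- t)" "2 \<le> exp \<bar>h\<bar> * (2::real)"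
    by (auto simp flip: exp_add)
  then have "exp (t + h) + exp (- (t + h)) + 2 \<le> exp \<bar>h\<bar> * (exp t + exp (- t) + 2)"
    unfolding distrib_left by linarith
  then have "1 / (exp \<bar>h\<bar> * (exp t + exp (- t) + 2)) \<le> 1 / (exp (t + h) + exp (- (t + h)) + 2)"
    by (intro divide_left_mono mult_pos_pos add_pos_pos) simp_all
  then show ?thesis
    unfolding logistic_variance_eq by (simp add: exp_minus field_simps)
qed

lemma DERIV_logistic: "(logistic has_real_derivative logistic t * (1 - logistic t)) (at t)"
proof -
  have nz: "1 + exp t \<noteq> (0::real)" using exp_gt_zero[of t] by linarith
  have "((\<lambda>t. exp t / (1 + exp t)) has_real_derivative logistic t * (1 - logistic t)) (at t)"
    using nz by (auto intro!: derivative_eq_intros simp: logistic_def field_simps power2_eq_square)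
  then show ?thesis by (simp add: logistic_def[abs_def])
qed

definition softplus :: "real \<Rightarrow> real" where
  "softplus t = ln (1 + exp t)"

lemma DERIV_softplus: "(softplus has_real_derivative logistic t) (at t)"
proof -
  have "1 + exp t > (0::real)" by (simp add: add_pos_pos)
  then have "((\<lambda>t. ln (1 + exp t)) has_real_derivative logistic t) (at t)"
    by (auto intro!: derivative_eq_intros simp: logistic_def field_simps)
  then show ?thesis by (simp add: softplus_def[abs_def])
qed

text \<open>Exponential family form: the outcome enters only linearly, so curvature and convexity of
  the loss are those of \<open>softplus\<close>.\<close>

lemma logit_loss_eq:
  assumes "y \<in> {0, 1}"
  shows "logit_loss y t = softplus t - y * t"
proof -
  have p: "1 + exp t > (0::real)" by (simp add: add_pos_pos)
  have "1 - logistic t = 1 / (1 + exp t)"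
    using p by (simp add: logistic_def field_simps)
  then have "ln (1 - logistic t) = - softplus t"
    using p by (simp add: softplus_def ln_div)
  moreover have "ln (logistic t) = t - softplus t"
    using p by (simp add: softplus_def ln_div logistic_def)
  ultimately show ?thesis using assms by (auto simp: logit_loss_def)
qed

lemma logistic_lipschitz: "\<bar>logistic s - logistic t\<bar> \<le> \<bar>s - t\<bar>"
proof -
  have "norm (logistic s - logistic t) \<le> 1 * norm (s - t)"
    by (rule field_differentiable_bound[of UNIV logistic "\<lambda>t. logistic t * (1 - logistic t)"])
      (use logistic_variance_nonneg mult_one_minus_le in
        \<open>auto intro: DERIV_logistic simp: norm_mult abs_mult[symmetric] intro: order_trans[OF mult_one_minus_le]\<close>)
  then show ?thesis by simp
qed

definition softplus_bregman :: "real \<Rightarrow> real \<Rightarrow> real" where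
  "softplus_bregman t h = softplus (t + h) - softplus t - logistic t * h"

lemma softplus_taylor:
  obtains \<xi> where "\<bar>\<xi>\<bar> \<le> \<bar>h\<bar>"
    "softplus_bregman t h = logistic (t + \<xi>) * (1 - logistic (t + \<xi>)) / 2 * h\<^sup>2"
proof -
  define diff where "diff = (\<lambda>m::nat. \<lambda>h. if m = 0 then softplus (t + h)
    else if m = 1 then logistic (t + h) else logistic (t + h) * (1 - logistic (t + h)))"
  have "\<exists>\<xi>. \<bar>\<xi>\<bar> \<le> \<bar>h\<bar> \<and> softplus (t + h) =
      (\<Sum>m<2. diff m 0 / fact m * h ^ m) + diff 2 \<xi> / fact 2 * h ^ 2"
  proof (rule Maclaurin_bi_le[where f = "\<lambda>h. softplus (t + h)"])
    show "diff 0 = (\<lambda>h. softplus (t + h))" by (simp add: diff_def)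
    show "\<forall>m x. m < 2 \<and> \<bar>x\<bar> \<le> \<bar>h\<bar> \<longrightarrow> DERIV (diff m) x :> diff (Suc m) x"
    proof (intro allI impI)
      fix m x assume "m < (2::nat) \<and> \<bar>x\<bar> \<le> \<bar>h\<bar>"
      then consider "m = 0" | "m = 1" by linarith
      then show "DERIV (diff m) x :> diff (Suc m) x"
      proof cases
        case 1
        have "((\<lambda>x. softplus (t + x)) has_real_derivative logistic (t + x) * 1) (at x)"
          by (rule DERIV_chain2[OF DERIV_softplus]) (auto intro!: derivative_eq_intros)
        then show ?thesis using 1 by (simp add: diff_def)
      next
        case 2
        have "((\<lambda>x. logistic (t + x)) has_real_derivative
            (logistic (t + x) * (1 - logistic (t + x))) * 1) (at x)"
          by (rule DERIV_chain2[OF DERIV_logistic]) (auto intro!: derivative_eq_intros)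
        then show ?thesis using 2 by (simp add: diff_def)
      qed
    qed
  qed
  then obtain \<xi> where "\<bar>\<xi>\<bar> \<le> \<bar>h\<bar>" "softplus (t + h) =
      (\<Sum>m<2. diff m 0 / fact m * h ^ m) + diff 2 \<xi> / fact 2 * h ^ 2" by blast
  moreover have "(\<Sum>m<2. diff m 0 / fact m * h ^ m) = softplus t + logistic t * h"
    by (simp add: diff_def numeral_2_eq_2)
  ultimately show thesis
    by (intro that[of \<xi>]) (auto simp: diff_def softplus_bregman_def fact_numeral)
qed

lemma softplus_bregman_nonneg: "0 \<le> softplus_bregman t h"
proof -
  obtain \<xi> where \<xi>: "softplus_bregman t h = logistic (t + \<xi>) * (1 - logistic (t + \<xi>)) / 2 * h\<^sup>2"
    by (rule softplus_taylor)
  show ?thesis unfolding \<xi>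
    by (intro mult_nonneg_nonneg divide_nonneg_pos logistic_variance_nonneg) auto
qed

text \<open>The 2 is the Taylor denominator and \<open>exp 1\<close> the loss of curvature over a
  shift by at most 1.\<close>

lemma softplus_bregman_ge:
  assumes "\<bar>h\<bar> \<le> 1" "w \<le> logistic t * (1 - logistic t)"
  shows "w / (2 * exp 1) * h\<^sup>2 \<le> softplus_bregman t h"
proof -
  obtain \<xi> where \<xi>: "\<bar>\<xi>\<bar> \<le> \<bar>h\<bar>"
    "softplus_bregman t h = logistic (t + \<xi>) * (1 - logistic (t + \<xi>)) / 2 * h\<^sup>2"
    by (rule softplus_taylor)
  have "w * exp (- 1) \<le> (logistic t * (1 - logistic t)) * exp (- 1)"
    using assms by (intro mult_right_mono) auto
  also have "\<dots> \<le> (logistic t * (1 - logistic t)) * exp (- \<bar>\<xi>\<bar>)"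
    using assms \<xi> by (intro mult_left_mono logistic_variance_nonneg) auto
  also have "\<dots> \<le> logistic (t + \<xi>) * (1 - logistic (t + \<xi>))"
    using logistic_variance_shift[of \<xi> t] by (simp add: mult.commute)
  finally have "w * exp (- 1) / 2 * h\<^sup>2 \<le> softplus_bregman t h"
    unfolding \<xi> by (intro mult_right_mono divide_right_mono) auto
  then show ?thesis by (simp add: exp_minus field_simps)
qed

lemma convex_on_softplus: "convex_on UNIV softplus"
  by (rule f''_ge0_imp_convex[OF convex_UNIV DERIV_softplus DERIV_logistic logistic_variance_nonneg])

section \<open>Empirical norms and restricted eigenvalues\<close>

text \<open>Access to Minkowski and Cauchy-Schwarz for \<open>L2_set\<close>.\<close>

lemma emp_norm2_L2: "emp_norm2 n g = L2_set g {..<n} / sqrt (real n)"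
  by (simp add: emp_norm2_def emp_mean_def L2_set_def real_sqrt_divide)

lemma emp_norm2_nonneg [simp]: "0 \<le> emp_norm2 n g"
  by (simp add: emp_norm2_L2 L2_set_nonneg)

lemma emp_norm2_triangle: "emp_norm2 n (\<lambda>i. g i + h i) \<le> emp_norm2 n g + emp_norm2 n h"
  by (simp add: emp_norm2_L2 L2_set_triangle_ineq divide_right_mono flip: add_divide_distrib)

lemma emp_norm2_scale: "emp_norm2 n (\<lambda>i. c * g i) = \<bar>c\<bar> * emp_norm2 n g"
proof -
  have "sqrt (\<Sum>i<n. (c * g i)\<^sup>2) = \<bar>c\<bar> * sqrt (\<Sum>i<n. (g i)\<^sup>2)"
    by (simp add: power_mult_distrib sum_distrib_left[symmetric] real_sqrt_mult)
  then show ?thesis by (simp add: emp_norm2_L2 L2_set_def)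
qed

lemma emp_norm2_mono:
  assumes "\<And>i. i < n \<Longrightarrow> \<bar>g i\<bar> \<le> \<bar>h i\<bar>"
  shows "emp_norm2 n g \<le> emp_norm2 n h"
proof -
  have "emp_norm2 n (\<lambda>i. \<bar>g i\<bar>) \<le> emp_norm2 n (\<lambda>i. \<bar>h i\<bar>)"
    using assms unfolding emp_norm2_L2 by (intro divide_right_mono L2_set_mono) auto
  then show ?thesis by (simp add: emp_norm2_def)
qed

lemma emp_norm2_diff_le: "\<bar>emp_norm2 n g - emp_norm2 n h\<bar> \<le> emp_norm2 n (\<lambda>i. g i - h i)"
proof -
  have "emp_norm2 n g \<le> emp_norm2 n (\<lambda>i. g i - h i) + emp_norm2 n h"
    using emp_norm2_triangle[of n "\<lambda>i. g i - h i" h] by simp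
  moreover have "emp_norm2 n h \<le> emp_norm2 n (\<lambda>i. g i - h i) + emp_norm2 n g"
    using emp_norm2_triangle[of n "\<lambda>i. - 1 * (g i - h i)" g]
    unfolding emp_norm2_scale by simp
  ultimately show ?thesis by linarith
qed

lemma emp_norm2_power2: "(emp_norm2 n g)\<^sup>2 = emp_mean n (\<lambda>i. (g i)\<^sup>2)"
  unfolding emp_norm2_def emp_mean_def by (intro real_sqrt_pow2 divide_nonneg_nonneg sum_nonneg) auto

lemma emp_mean_add: "emp_mean n (\<lambda>i. g i + h i) = emp_mean n g + emp_mean n h"
  by (simp add: emp_mean_def sum.distrib add_divide_distrib)

lemma emp_mean_diff: "emp_mean n (\<lambda>i. g i - h i) = emp_mean n g - emp_mean n h"
  by (simp add: emp_mean_def sum_subtractf diff_divide_distrib)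

lemma emp_mean_scale: "emp_mean n (\<lambda>i. c * g i) = c * emp_mean n g"
  by (simp add: emp_mean_def sum_distrib_left)

lemma emp_mean_mono: "(\<And>i. i < n \<Longrightarrow> g i \<le> h i) \<Longrightarrow> emp_mean n g \<le> emp_mean n h"
  unfolding emp_mean_def by (intro divide_right_mono sum_mono) auto

lemma emp_mean_cong: "(\<And>i. i < n \<Longrightarrow> g i = h i) \<Longrightarrow> emp_mean n g = emp_mean n h"
  by (simp add: emp_mean_def)

lemma emp_mean_sum: "emp_mean n (\<lambda>i. \<Sum>j\<in>J. g j i) = (\<Sum>j\<in>J. emp_mean n (g j))"
  unfolding emp_mean_def by (subst sum.swap) (simp add: sum_divide_distrib)

lemma emp_mean_Cauchy_Schwarz: "\<bar>emp_mean n (\<lambda>i. g i * h i)\<bar> \<le> emp_norm2 n g * emp_norm2 n h"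
proof -
  have "\<bar>\<Sum>i<n. g i * h i\<bar> \<le> (\<Sum>i<n. \<bar>g i\<bar> * \<bar>h i\<bar>)"
    by (rule order_trans[OF sum_abs]) (simp add: abs_mult)
  also have "\<dots> \<le> L2_set g {..<n} * L2_set h {..<n}" by (rule L2_set_mult_ineq)
  finally show ?thesis
    by (simp add: emp_mean_def emp_norm2_L2 divide_right_mono)
qed

lemma dotp_add: "dotp p x (\<lambda>j. v j + w j) = dotp p x v + dotp p x w"
  by (simp add: dotp_def sum.distrib distrib_left)

lemma dotp_diff: "dotp p x (\<lambda>j. v j - w j) = dotp p x v - dotp p x w"
  by (simp add: dotp_def sum_subtractf right_diff_distrib)

lemma dotp_scale: "dotp p x (\<lambda>j. c * v j) = c * dotp p x v"
  by (simp add: dotp_def sum_distrib_left mult.left_commute)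

lemma dotp_le_norm_l1:
  assumes "\<And>j. j < p \<Longrightarrow> \<bar>x j\<bar> \<le> B"
  shows "\<bar>dotp p x v\<bar> \<le> B * norm_l1 p v"
proof -
  have "\<bar>dotp p x v\<bar> \<le> (\<Sum>j<p. \<bar>x j * v j\<bar>)" unfolding dotp_def by (rule sum_abs)
  also have "\<dots> \<le> (\<Sum>j<p. B * \<bar>v j\<bar>)"
    using assms by (intro sum_mono) (auto simp: abs_mult intro: mult_right_mono)
  finally show ?thesis by (simp add: norm_l1_def sum_distrib_left)
qed


definition restr :: "nat set \<Rightarrow> (nat \<Rightarrow> real) \<Rightarrow> nat \<Rightarrow> real" where
  "restr S v = (\<lambda>j. if j \<in> S then v j else 0)"

lemma supp_restr: "supp p (restr S v) \<subseteq> S"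
  by (auto simp: supp_def restr_def)

lemma finite_supp [simp]: "finite (supp p v)"
  by (simp add: supp_def)

lemma supp_subset: "supp p v \<subseteq> {..<p}"
  by (auto simp: supp_def)

lemma norm_l0_restr: "finite S \<Longrightarrow> norm_l0 p (restr S v) \<le> card S"
  unfolding norm_l0_def by (rule card_mono[OF _ supp_restr])

lemma norm_l2_restr:
  assumes "S \<subseteq> {..<p}"
  shows "norm_l2 p (restr S v) = sqrt (\<Sum>j\<in>S. (v j)\<^sup>2)"
proof -
  have "(\<Sum>j<p. (restr S v j)\<^sup>2) = (\<Sum>j\<in>S. (v j)\<^sup>2)"
    using assms by (intro sum.mono_neutral_cong_right) (auto simp: restr_def)
  then show ?thesis by (simp add: norm_l2_def)
qed

lemma norm_l2_nonneg [simp]: "0 \<le> norm_l2 p v"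
  by (simp add: norm_l2_def sum_nonneg)

lemma norm_l2_scale: "norm_l2 p (\<lambda>j. c * v j) = \<bar>c\<bar> * norm_l2 p v"
  by (simp add: norm_l2_def power_mult_distrib sum_distrib_left[symmetric] real_sqrt_mult)

lemma sum_abs_le_sqrt_card:
  fixes v :: "nat \<Rightarrow> real"
  shows "(\<Sum>j\<in>S. \<bar>v j\<bar>) \<le> sqrt (real (card S)) * sqrt (\<Sum>j\<in>S. (v j)\<^sup>2)"
  using L2_set_mult_ineq[of "\<lambda>_. 1" v S] by (simp add: L2_set_def)

text \<open>Greedy choice: the largest entry left over joins the block, so the block still dominates
  its complement.\<close>

lemma exists_largest_subset:
  fixes g :: "nat \<Rightarrow> real"
  assumes "finite S" "k \<le> card S"
  shows "\<exists>B\<subseteq>S. card B = k \<and> (\<forall>i\<in>B. \<forall>j\<in>S - B. g j \<le> g i)"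
  using assms(2)
proof (induction k)
  case 0
  then show ?case by (intro exI[of _ "{}"]) auto
next
  case (Suc k)
  then obtain B where B: "B \<subseteq> S" "card B = k" "\<forall>i\<in>B. \<forall>j\<in>S - B. g j \<le> g i" by auto
  have fin: "finite (S - B)" "finite B" using assms(1) B(1) finite_subset by auto
  have ne: "S - B \<noteq> {}"
    using Suc.prems B fin by (metis card_mono Diff_eq_empty_iff not_less_eq_eq)
  have "Max (g ` (S - B)) \<in> g ` (S - B)" using fin(1) ne by (intro Max_in) auto
  then obtain i where i: "i \<in> S - B" "g i = Max (g ` (S - B))" by (metis imageE)
  have "g j \<le> g i" if "j \<in> S - B" for j
    using that fin unfolding i(2) by (intro Max_ge) auto
  show ?case
    using B \<open>\<And>j. j \<in> S - B \<Longrightarrow> g j \<le> g i\<close> i(1) fin by (intro exI[of _ "insert i B"]) auto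
qed

locale logit_sample =
  fixes n p :: nat and y :: "nat \<Rightarrow> real" and z :: "nat \<Rightarrow> nat \<Rightarrow> real"
  assumes n_pos: "0 < n" and y01: "\<And>i. i < n \<Longrightarrow> y i \<in> {0, 1}"
begin

definition pred_norm :: "(nat \<Rightarrow> real) \<Rightarrow> real" where
  "pred_norm v = emp_norm2 n (\<lambda>i. dotp p (z i) v)"

lemma pred_norm_nonneg [simp]: "0 \<le> pred_norm v"
  by (simp add: pred_norm_def)

lemma pred_norm_triangle: "pred_norm (\<lambda>j. v j + w j) \<le> pred_norm v + pred_norm w"
  by (simp add: pred_norm_def dotp_add emp_norm2_triangle)

lemma pred_norm_scale: "pred_norm (\<lambda>j. c * v j) = \<bar>c\<bar> * pred_norm v"
  by (simp add: pred_norm_def dotp_scale emp_norm2_scale)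

lemma pred_norm_cong: "(\<And>j. j < p \<Longrightarrow> v j = w j) \<Longrightarrow> pred_norm v = pred_norm w"
  by (simp add: pred_norm_def dotp_def)

text \<open>Shelling: after removal of a block of the \<open>k\<close> largest entries, an entry is at most the
  average entry of the block.\<close>

lemma pred_norm_tail_le:
  assumes "S \<subseteq> {..<p}" "1 \<le> k" "0 \<le> \<kappa>"
    and upper: "\<And>v. norm_l0 p v \<le> k \<Longrightarrow> pred_norm v \<le> \<kappa> * norm_l2 p v"
  shows "\<exists>B\<subseteq>S. card B \<le> k \<and> pred_norm (restr (S - B) v) \<le> \<kappa> * ((\<Sum>j\<in>S. \<bar>v j\<bar>) / sqrt (real k))"
  using assms(1)
proof (induction "card S" arbitrary: S rule: less_induct)
  case less
  have finS: "finite S" using less.prems finite_subset by blast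
  show ?case
  proof (cases "card S \<le> k")
    case True
    have "pred_norm (restr (S - S) v) = 0"
      by (simp add: pred_norm_def restr_def dotp_def emp_norm2_def emp_mean_def)
    moreover have "0 \<le> \<kappa> * ((\<Sum>j\<in>S. \<bar>v j\<bar>) / sqrt (real k))"
      using assms(3) by (intro mult_nonneg_nonneg divide_nonneg_nonneg sum_nonneg) auto
    ultimately show ?thesis using True by (intro exI[of _ S]) auto
  next
    case False
    then obtain B where B: "B \<subseteq> S" "card B = k" "\<forall>i\<in>B. \<forall>j\<in>S - B. \<bar>v j\<bar> \<le> \<bar>v i\<bar>"
      using exists_largest_subset[OF finS, of k "\<lambda>j. \<bar>v j\<bar>"] by auto
    have finB: "finite B" using B finS finite_subset by blast
    have "card (S - B) < card S" using B finB assms(2) False by (simp add: card_Diff_subset)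
    then obtain B' where B': "B' \<subseteq> S - B" "card B' \<le> k"
      "pred_norm (restr (S - B - B') v) \<le> \<kappa> * ((\<Sum>j\<in>S - B. \<bar>v j\<bar>) / sqrt (real k))"
      using less.hyps[of "S - B"] less.prems by blast
    have B'p: "finite B'" "B' \<subseteq> {..<p}"
      using finite_subset[OF B'(1)] finS B'(1) less.prems by auto
    define b where "b = (\<Sum>j\<in>B. \<bar>v j\<bar>) / real k"
    have small: "\<bar>v j\<bar> \<le> b" if "j \<in> S - B" for j
    proof -
      have "real (card B) * \<bar>v j\<bar> \<le> (\<Sum>i\<in>B. \<bar>v i\<bar>)"
        using B that by (intro sum_bounded_below) auto
      then show ?thesis using B assms(2) by (simp add: b_def field_simps)
    qed
    have b0: "0 \<le> b" by (simp add: b_def sum_nonneg)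
    \<comment> \<open>The next block \<open>B'\<close> has at most \<open>k\<close> entries, each at
      most the average \<open>b\<close> of the block before, so its Euclidean norm is at most
      \<open>sqrt k * b\<close>, the l1 norm of \<open>B\<close> over \<open>sqrt k\<close>. Every
      block is charged to its predecessor in this way, and the charges add up to at most the l1 norm
      over \<open>S\<close>.\<close>
    have "(\<Sum>j\<in>B'. (v j)\<^sup>2) \<le> (\<Sum>j\<in>B'. b\<^sup>2)"
    proof (rule sum_mono)
      fix j assume "j \<in> B'"
      then have "\<bar>v j\<bar>\<^sup>2 \<le> b\<^sup>2" using small B'(1) by (intro power_mono) auto
      then show "(v j)\<^sup>2 \<le> b\<^sup>2" by simp
    qed
    also have "\<dots> \<le> real k * b\<^sup>2" using B'(2) by (simp add: mult_right_mono)
    finally have "norm_l2 p (restr B' v) \<le> sqrt (real k * b\<^sup>2)"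
      using B'p(2) by (subst norm_l2_restr) auto
    also have "\<dots> = sqrt (real k) * b" using b0 by (simp add: real_sqrt_mult)
    also have "\<dots> = (\<Sum>j\<in>B. \<bar>v j\<bar>) / sqrt (real k)"
      using assms(2) by (simp add: b_def field_simps)
    finally have "\<kappa> * norm_l2 p (restr B' v) \<le> \<kappa> * ((\<Sum>j\<in>B. \<bar>v j\<bar>) / sqrt (real k))"
      using assms(3) by (rule mult_left_mono)
    moreover have "pred_norm (restr B' v) \<le> \<kappa> * norm_l2 p (restr B' v)"
      using norm_l0_restr[OF B'p(1), of p v] B'(2) by (intro upper) simp
    ultimately have "pred_norm (restr B' v) + pred_norm (restr (S - B - B') v)
        \<le> \<kappa> * ((\<Sum>j\<in>B. \<bar>v j\<bar>) / sqrt (real k)) + \<kappa> * ((\<Sum>j\<in>S - B. \<bar>v j\<bar>) / sqrt (real k))"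
      using B'(3) by linarith
    also have "\<dots> = \<kappa> * ((\<Sum>j\<in>S. \<bar>v j\<bar>) / sqrt (real k))"
      using sum.subset_diff[OF B(1) finS, of "\<lambda>j. \<bar>v j\<bar>"] by (simp add: add_divide_distrib distrib_left)
    finally have "pred_norm (restr B' v) + pred_norm (restr (S - B - B') v)
        \<le> \<kappa> * ((\<Sum>j\<in>S. \<bar>v j\<bar>) / sqrt (real k))" .
    moreover have "restr (S - B) v = (\<lambda>j. restr B' v j + restr (S - B - B') v j)"
      using B'(1) by (auto simp: restr_def fun_eq_iff)
    ultimately have "pred_norm (restr (S - B) v) \<le> \<kappa> * ((\<Sum>j\<in>S. \<bar>v j\<bar>) / sqrt (real k))"
      using pred_norm_triangle[of "restr B' v" "restr (S - B - B') v"] by simp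
    then show ?thesis using B by blast
  qed
qed

text \<open>\<open>T\<close> is enlarged by a block of at most \<open>M * s\<close> entries, so that
  the lower eigenvalue bound applies; shelling bounds the remaining tail by \<open>\<kappa>2\<close>
  times the l1 norm outside \<open>T\<close> over \<open>sqrt (M * s)\<close>. For large
  \<open>M\<close> the cone condition turns this into half of the left-hand side plus a multiple of
  the prediction norm. The term with \<open>b\<close> in the cone makes room for the approximation
  error.\<close>

lemma restricted_eigenvalue:
  assumes T: "T \<subseteq> {..<p}" "card T \<le> s" and s: "1 \<le> s" and M: "1 \<le> M"
    and \<kappa>: "0 < \<kappa>1" "0 < \<kappa>2"
    and lower: "\<And>v. norm_l0 p v \<le> s + M * s \<Longrightarrow> \<kappa>1 * norm_l2 p v \<le> pred_norm v"
    and upper: "\<And>v. norm_l0 p v \<le> s + M * s \<Longrightarrow> pred_norm v \<le> \<kappa>2 * norm_l2 p v"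
    and cone: "(\<Sum>j\<in>{..<p} - T. \<bar>v j\<bar>) \<le> a * (\<Sum>j\<in>T. \<bar>v j\<bar>) + b * sqrt (real s) * pred_norm v"
    and a: "0 \<le> a" "\<kappa>2 * a \<le> \<kappa>1 / 2 * sqrt (real M)" and b: "0 \<le> b"
  shows "(\<Sum>j\<in>T. \<bar>v j\<bar>) \<le> sqrt (real s) * (2 / \<kappa>1 * (1 + \<kappa>2 * b) * pred_norm v)"
    and "norm_l1 p v \<le> ((1 + a) * (2 / \<kappa>1 * (1 + \<kappa>2 * b)) + b) * sqrt (real s) * pred_norm v"
proof -
  have k: "1 \<le> M * s" using s M by (simp add: Suc_le_eq)
  have upk: "pred_norm w \<le> \<kappa>2 * norm_l2 p w" if "norm_l0 p w \<le> M * s" for w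
    using upper[of w] that by simp
  have finT: "finite T" using T finite_subset by blast
  obtain B where B: "B \<subseteq> {..<p} - T" "card B \<le> M * s"
    "pred_norm (restr ({..<p} - T - B) v) \<le> \<kappa>2 * ((\<Sum>j\<in>{..<p} - T. \<bar>v j\<bar>) / sqrt (real (M * s)))"
    using pred_norm_tail_le[OF Diff_subset[of "{..<p}" T] k less_imp_le[OF \<kappa>(2)] upk] by blast
  have finB: "finite B" using B(1) finite_subset by blast
  define q where "q = norm_l2 p (restr T v)"
  have sum_T: "(\<Sum>j\<in>T. \<bar>v j\<bar>) \<le> sqrt (real s) * q"
  proof -
    have "sqrt (real (card T)) \<le> sqrt (real s)" using T by simp
    then have "sqrt (real (card T)) * q \<le> sqrt (real s) * q"
      by (rule mult_right_mono) (simp add: q_def)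
    then show ?thesis
      using sum_abs_le_sqrt_card[of v T] norm_l2_restr[OF T(1), of v] by (simp add: q_def)
  qed
  have sM: "sqrt (real M) \<ge> 1" "sqrt (real s) > 0" using M s by auto
  have "q \<le> norm_l2 p (restr (T \<union> B) v)"
  proof -
    have TB: "T \<union> B \<subseteq> {..<p}" using T(1) B(1) by auto
    have "(\<Sum>j\<in>T. (v j)\<^sup>2) \<le> (\<Sum>j\<in>T \<union> B. (v j)\<^sup>2)"
      using finT finB by (intro sum_mono2) auto
    then show ?thesis
      using norm_l2_restr[of T p v] norm_l2_restr[of "T \<union> B" p v] T(1) TB by (simp add: q_def)
  qed
  then have "\<kappa>1 * q \<le> \<kappa>1 * norm_l2 p (restr (T \<union> B) v)"
    using \<kappa> by simp
  also have "\<dots> \<le> pred_norm (restr (T \<union> B) v)"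
  proof (rule lower)
    have "card (T \<union> B) \<le> s + M * s" using card_Un_le[of T B] T(2) B(2) by simp
    then show "norm_l0 p (restr (T \<union> B) v) \<le> s + M * s"
      using norm_l0_restr[of "T \<union> B" p v] finT finB by simp
  qed
  also have "\<dots> \<le> pred_norm v + pred_norm (restr ({..<p} - T - B) v)"
  proof -
    have "pred_norm (restr (T \<union> B) v) = pred_norm (\<lambda>j. v j + - 1 * restr ({..<p} - T - B) v j)"
      by (rule pred_norm_cong) (auto simp: restr_def)
    also have "\<dots> \<le> pred_norm v + pred_norm (\<lambda>j. - 1 * restr ({..<p} - T - B) v j)"
      by (rule pred_norm_triangle)
    also have "\<dots> = pred_norm v + pred_norm (restr ({..<p} - T - B) v)"
      unfolding pred_norm_scale by simp
    finally show ?thesis .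
  qed
  also have "\<dots> \<le> pred_norm v + \<kappa>2 * ((a * (sqrt (real s) * q) + b * sqrt (real s) * pred_norm v) / sqrt (real (M * s)))"
  proof -
    have "a * (\<Sum>j\<in>T. \<bar>v j\<bar>) \<le> a * (sqrt (real s) * q)" using sum_T a by (intro mult_left_mono)
    then have "(\<Sum>j\<in>{..<p} - T. \<bar>v j\<bar>) \<le> a * (sqrt (real s) * q) + b * sqrt (real s) * pred_norm v"
      using cone by linarith
    then have "\<kappa>2 * ((\<Sum>j\<in>{..<p} - T. \<bar>v j\<bar>) / sqrt (real (M * s))) \<le>
       \<kappa>2 * ((a * (sqrt (real s) * q) + b * sqrt (real s) * pred_norm v) / sqrt (real (M * s)))"
      using \<kappa> by (intro mult_left_mono divide_right_mono) auto
    then show ?thesis using B(3) by linarith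
  qed
  also have "\<dots> = pred_norm v + (\<kappa>2 * a * q + \<kappa>2 * b * pred_norm v) / sqrt (real M)"
    using sM by (simp add: real_sqrt_mult field_simps)
  \<comment> \<open>By the condition on \<open>a\<close> the tail takes at most half of
    \<open>\<kappa>1 * q\<close>, which moves to the left.\<close>
  also have "\<dots> \<le> pred_norm v + (\<kappa>1 / 2 * q + \<kappa>2 * b * pred_norm v)"
  proof -
    have "\<kappa>2 * a * q \<le> \<kappa>1 / 2 * sqrt (real M) * q"
      using a(2) by (intro mult_right_mono) (auto simp: q_def)
    then have "\<kappa>2 * a * q / sqrt (real M) \<le> \<kappa>1 / 2 * q"
      using sM by (simp add: field_simps)
    moreover have "\<kappa>2 * b * pred_norm v / sqrt (real M) \<le> \<kappa>2 * b * pred_norm v / 1"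
      using sM \<kappa> b by (intro divide_left_mono) auto
    ultimately show ?thesis unfolding add_divide_distrib div_by_1 by linarith
  qed
  finally have "\<kappa>1 * q \<le> 2 * (1 + \<kappa>2 * b) * pred_norm v"
    by (simp add: algebra_simps)
  then have q: "q \<le> 2 / \<kappa>1 * (1 + \<kappa>2 * b) * pred_norm v"
    using \<kappa> by (simp add: field_simps)
  then have "sqrt (real s) * q \<le> sqrt (real s) * (2 / \<kappa>1 * (1 + \<kappa>2 * b) * pred_norm v)"
    by (intro mult_left_mono) auto
  then show 1: "(\<Sum>j\<in>T. \<bar>v j\<bar>) \<le> sqrt (real s) * (2 / \<kappa>1 * (1 + \<kappa>2 * b) * pred_norm v)"
    using sum_T by linarith
  have "norm_l1 p v = (\<Sum>j\<in>{..<p} - T. \<bar>v j\<bar>) + (\<Sum>j\<in>T. \<bar>v j\<bar>)"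
    unfolding norm_l1_def using T(1) by (intro sum.subset_diff) auto
  also have "\<dots> \<le> (1 + a) * (\<Sum>j\<in>T. \<bar>v j\<bar>) + b * sqrt (real s) * pred_norm v"
    using cone by (simp add: algebra_simps)
  also have "\<dots> \<le> (1 + a) * (sqrt (real s) * (2 / \<kappa>1 * (1 + \<kappa>2 * b) * pred_norm v)) + b * sqrt (real s) * pred_norm v"
    using 1 a by (intro add_right_mono mult_left_mono) auto
  also have "\<dots> = ((1 + a) * (2 / \<kappa>1 * (1 + \<kappa>2 * b)) + b) * sqrt (real s) * pred_norm v"
    by (simp add: algebra_simps)
  finally show "norm_l1 p v \<le> ((1 + a) * (2 / \<kappa>1 * (1 + \<kappa>2 * b)) + b) * sqrt (real s) * pred_norm v" .
qed

end


section \<open>The empirical logistic loss and the penalised criterion\<close>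

context logit_sample
begin

definition loss :: "(nat \<Rightarrow> real) \<Rightarrow> real" where
  "loss v = emp_loss n p y z v"

definition crit :: "(nat \<Rightarrow> real) \<Rightarrow> real \<Rightarrow> (nat \<Rightarrow> real) \<Rightarrow> real" where
  "crit l \<mu> v = loss v + \<mu> * norm_l1 p (\<lambda>j. l j * v j)"

definition breg :: "(nat \<Rightarrow> real) \<Rightarrow> (nat \<Rightarrow> real) \<Rightarrow> real" where
  "breg v d = emp_mean n (\<lambda>i. softplus_bregman (dotp p (z i) v) (dotp p (z i) d))"

lemma loss_eq: "loss v = emp_mean n (\<lambda>i. softplus (dotp p (z i) v) - y i * dotp p (z i) v)"
  unfolding loss_def emp_loss_def by (intro emp_mean_cong) (use y01 logit_loss_eq in blast)

text \<open>An identity rather than an expansion: the gradient term carries the noise, and all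
  curvature sits in \<open>breg\<close>.\<close>

lemma loss_expand:
  "loss (\<lambda>j. v j + d j) =
    loss v + emp_mean n (\<lambda>i. (logistic (dotp p (z i) v) - y i) * dotp p (z i) d) + breg v d"
  unfolding loss_eq breg_def emp_mean_add[symmetric]
  by (intro emp_mean_cong) (simp add: dotp_add softplus_bregman_def algebra_simps)

lemma loss_cong: "(\<And>j. j < p \<Longrightarrow> v j = w j) \<Longrightarrow> loss v = loss w"
  by (simp add: loss_eq dotp_def)

lemma loss_convex:
  assumes "0 \<le> t" "t \<le> 1"
  shows "loss (\<lambda>j. v j + t * d j) \<le> (1 - t) * loss v + t * loss (\<lambda>j. v j + d j)"
proof -
  have "softplus (a + t * b) - c * (a + t * b) \<le>
      (1 - t) * (softplus a - c * a) + t * (softplus (a + b) - c * (a + b))" for a b c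
  proof -
    have "softplus ((1 - t) *\<^sub>R a + t *\<^sub>R (a + b)) \<le> (1 - t) * softplus a + t * softplus (a + b)"
      using assms by (intro convex_onD[OF convex_on_softplus]) auto
    moreover have "(1 - t) *\<^sub>R a + t *\<^sub>R (a + b) = a + t * b" by (simp add: algebra_simps)
    ultimately show ?thesis by (simp add: algebra_simps)
  qed
  then show ?thesis
    unfolding loss_eq emp_mean_scale[symmetric] emp_mean_add[symmetric]
    by (intro emp_mean_mono) (simp add: dotp_add dotp_scale)
qed

lemma crit_convex:
  assumes "0 \<le> t" "t \<le> 1" "0 \<le> \<mu>"
  shows "crit l \<mu> (\<lambda>j. v j + t * d j) \<le> (1 - t) * crit l \<mu> v + t * crit l \<mu> (\<lambda>j. v j + d j)"
proof -
  have "norm_l1 p (\<lambda>j. l j * (v j + t * d j)) \<le>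
      (\<Sum>j<p. (1 - t) * \<bar>l j * v j\<bar> + t * \<bar>l j * (v j + d j)\<bar>)"
    unfolding norm_l1_def
  proof (rule sum_mono)
    fix j
    have "l j * (v j + t * d j) = (1 - t) * (l j * v j) + t * (l j * (v j + d j))"
      by (simp add: algebra_simps)
    then show "\<bar>l j * (v j + t * d j)\<bar> \<le> (1 - t) * \<bar>l j * v j\<bar> + t * \<bar>l j * (v j + d j)\<bar>"
      using assms abs_triangle_ineq[of "(1 - t) * (l j * v j)" "t * (l j * (v j + d j))"]
      by (simp add: abs_mult)
  qed
  also have "\<dots> = (1 - t) * norm_l1 p (\<lambda>j. l j * v j) + t * norm_l1 p (\<lambda>j. l j * (v j + d j))"
    by (simp add: norm_l1_def sum.distrib sum_distrib_left)
  finally have "\<mu> * norm_l1 p (\<lambda>j. l j * (v j + t * d j)) \<le>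
      \<mu> * ((1 - t) * norm_l1 p (\<lambda>j. l j * v j) + t * norm_l1 p (\<lambda>j. l j * (v j + d j)))"
    using assms(3) by (rule mult_left_mono)
  then show ?thesis
    using loss_convex[OF assms(1,2), of v d] unfolding crit_def by (simp add: algebra_simps)
qed

lemma breg_nonneg: "0 \<le> breg v d"
  unfolding breg_def emp_mean_def by (intro divide_nonneg_nonneg sum_nonneg softplus_bregman_nonneg) auto

lemma breg_ge:
  assumes "\<And>i. i < n \<Longrightarrow> w \<le> logistic (dotp p (z i) v) * (1 - logistic (dotp p (z i) v))"
    and "\<And>i. i < n \<Longrightarrow> \<bar>dotp p (z i) d\<bar> \<le> 1"
  shows "w / (2 * exp 1) * (pred_norm d)\<^sup>2 \<le> breg v d"
  unfolding pred_norm_def emp_norm2_power2 breg_def emp_mean_scale[symmetric]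
  using assms by (intro emp_mean_mono softplus_bregman_ge)

lemma continuous_on_dotp: "continuous_on A (dotp p x)"
  unfolding dotp_def
  by (intro continuous_intros continuous_on_subset[OF continuous_on_product_coordinates]) auto

lemma continuous_on_softplus: "continuous_on A softplus"
  by (meson DERIV_softplus DERIV_isCont continuous_at_imp_continuous_on)

lemma continuous_on_loss: "continuous_on A loss"
  unfolding loss_eq[abs_def] emp_mean_def
  by (intro continuous_intros continuous_on_compose2[OF continuous_on_softplus[of UNIV]]
      continuous_on_dotp) (use n_pos in auto)

lemma continuous_on_crit: "continuous_on A (crit l \<mu>)"
  unfolding crit_def[abs_def] norm_l1_def
  by (intro continuous_intros continuous_on_loss continuous_on_subset[OF continuous_on_product_coordinates]) auto

end

section \<open>Lasso and Post-Lasso for a fixed sample\<close>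

text \<open>A bounded sublevel set gives a minimiser by compactness. With \<open>S = UNIV\<close>
  this serves the Lasso, with \<open>S\<close> the selected support Post-Lasso.\<close>

lemma exists_arg_min_bounded_level:
  fixes g :: "(nat \<Rightarrow> real) \<Rightarrow> real"
  assumes cont: "continuous_on UNIV g"
    and cong: "\<And>v w. (\<And>j. j < p \<Longrightarrow> v j = w j) \<Longrightarrow> g v = g w"
    and start: "supp p v0 \<subseteq> S"
    and level: "\<And>v j. supp p v \<subseteq> S \<Longrightarrow> g v \<le> g v0 \<Longrightarrow> j < p \<Longrightarrow> \<bar>v j\<bar> \<le> b"
  shows "\<exists>v. is_arg_min g (\<lambda>v. supp p v \<subseteq> S) v"
proof -
  \<comment> \<open>Vectors are functions on all of \<open>nat\<close>, so the box is compact by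
    Tychonoff. Coordinates beyond \<open>p\<close> or outside \<open>S\<close> are pinned to 0,
    which does not change the criterion by \<open>cong\<close>.\<close>
  define A where "A = PiE UNIV (\<lambda>j. if j < p \<and> j \<in> S then {- b..b} else {0::real})"
  have "compactin (product_topology (\<lambda>j::nat. euclidean) UNIV) A"
    unfolding A_def compactin_PiE by auto
  then have "compact A" by (simp add: euclidean_product_topology)
  have proj: "restr ({..<p} \<inter> S) v \<in> A" "g (restr ({..<p} \<inter> S) v) = g v"
    if "supp p v \<subseteq> S" "g v \<le> g v0" for v
  proof -
    show "restr ({..<p} \<inter> S) v \<in> A"
    proof -
      have "- b \<le> v j \<and> v j \<le> b" if "j < p" for j
        using level[OF \<open>supp p v \<subseteq> S\<close> \<open>g v \<le> g v0\<close> that] by linarith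
      then show ?thesis by (auto simp: A_def restr_def)
    qed
    show "g (restr ({..<p} \<inter> S) v) = g v"
      by (rule cong) (use that(1) in \<open>auto simp: restr_def supp_def\<close>)
  qed
  have "A \<noteq> {}" using proj(1)[OF start] by auto
  then obtain v where v: "v \<in> A" "\<forall>w\<in>A. g v \<le> g w"
    using continuous_attains_inf[OF \<open>compact A\<close>] continuous_on_subset[OF cont] by blast
  have "supp p v \<subseteq> S"
  proof
    fix j assume j: "j \<in> supp p v"
    have "v j \<in> (if j < p \<and> j \<in> S then {- b..b} else {0})"
      using v(1) unfolding A_def by (rule PiE_mem) simp
    then show "j \<in> S" using j by (auto simp: supp_def split: if_splits)
  qed
  moreover have "g v \<le> g w" if "supp p w \<subseteq> S" for w
  proof (cases "g w \<le> g v0")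
    case True
    then show ?thesis using proj[OF that True] v(2) by metis
  next
    case False
    then show ?thesis using proj[OF start] v(2) by (metis linear order_trans order_refl)
  qed
  ultimately show ?thesis by (auto simp: is_arg_min_def not_less)
qed

text \<open>\<open>\<mu>\<close> is the penalty level over \<open>n\<close>, \<open>w\<close> a
  lower bound on the logistic variances at the truth, \<open>B\<close> a bound on the regressors and
  \<open>m\<close> the sparsity up to which the eigenvalue bounds hold. The approximation error is
  measured in units of \<open>sqrt s * \<mu>\<close>, the target rate.\<close>

locale logit_truth = logit_sample n p y z
  for n p y z +
  fixes \<theta>0 reg :: "nat \<Rightarrow> real" and \<mu> w R B \<kappa>1 \<kappa>2 :: real and s m :: nat
  assumes \<mu>: "0 < \<mu>" and R: "0 \<le> R" and \<kappa>: "0 < \<kappa>1" "0 < \<kappa>2" and w: "0 < w"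
    and s: "1 \<le> s" and sparse: "norm_l0 p \<theta>0 \<le> s"
    and curvature: "\<And>i. i < n \<Longrightarrow> w \<le> logistic (dotp p (z i) \<theta>0) * (1 - logistic (dotp p (z i) \<theta>0))"
    and approx: "emp_norm2 n (\<lambda>i. reg i - logistic (dotp p (z i) \<theta>0)) \<le> R * sqrt (real s) * \<mu>"
    and bound: "\<And>i j. i < n \<Longrightarrow> j < p \<Longrightarrow> \<bar>z i j\<bar> \<le> B"
    and lower: "\<And>v. norm_l0 p v \<le> m \<Longrightarrow> \<kappa>1 * norm_l2 p v \<le> pred_norm v"
    and upper: "\<And>v. norm_l0 p v \<le> m \<Longrightarrow> pred_norm v \<le> \<kappa>2 * norm_l2 p v"
begin

text \<open>Makes the radius \<open>\<rho>\<close> of \<open>localisation\<close> at least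
  1.\<close>

lemma w_le: "w / (2 * exp 1) \<le> 1"
proof -
  have "w \<le> 1 / 4" using curvature[OF n_pos] mult_one_minus_le order_trans by blast
  moreover have "1 \<le> exp (1::real)" by simp
  ultimately have "w \<le> 2 * exp 1" by linarith
  then show ?thesis by simp
qed

lemma sum_abs_weighted:
  assumes "\<And>j. j < p \<Longrightarrow> 0 \<le> l j"
  shows "norm_l1 p (\<lambda>j. l j * v j) = (\<Sum>j<p. l j * \<bar>v j\<bar>)"
  unfolding norm_l1_def using assms by (intro sum.cong) (auto simp: abs_mult)

text \<open>The residual at \<open>\<theta>0\<close> splits into noise \<open>y - reg\<close>,
  paired with \<open>d\<close> coordinatewise against the score bound, and approximation error, for
  which Cauchy-Schwarz charges the prediction norm of \<open>d\<close> instead of its l1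
  norm.\<close>

lemma linear_term_ge:
  assumes score: "\<And>j. j < p \<Longrightarrow> \<bar>emp_mean n (\<lambda>i. z i j * (y i - reg i))\<bar> \<le> q * \<mu> * l j"
  shows "- (q * \<mu> * (\<Sum>j<p. l j * \<bar>d j\<bar>)) - R * sqrt (real s) * \<mu> * pred_norm d
    \<le> emp_mean n (\<lambda>i. (logistic (dotp p (z i) \<theta>0) - y i) * dotp p (z i) d)"
proof -
  let ?r = "\<lambda>i. (reg i - logistic (dotp p (z i) \<theta>0)) * dotp p (z i) d" and ?n = "\<lambda>i. (y i - reg i) * dotp p (z i) d"
    and ?s = "\<lambda>j. emp_mean n (\<lambda>i. z i j * (y i - reg i))"
  have "emp_mean n ?n
      = (\<Sum>j<p. d j * ?s j)"
    unfolding emp_mean_scale[symmetric] emp_mean_sum[symmetric]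
    by (rule emp_mean_cong) (simp add: dotp_def sum_distrib_left algebra_simps)
  also have "\<dots> \<le> (\<Sum>j<p. \<bar>d j\<bar> * (q * \<mu> * l j))"
  proof (rule sum_mono)
    fix j assume "j \<in> {..<p}"
    then have "\<bar>d j\<bar> * \<bar>?s j\<bar> \<le> \<bar>d j\<bar> * (q * \<mu> * l j)"
      using score by (intro mult_left_mono) auto
    then show "d j * ?s j \<le> \<bar>d j\<bar> * (q * \<mu> * l j)"
      by (metis abs_le_D1 abs_mult)
  qed
  also have "\<dots> = q * \<mu> * (\<Sum>j<p. l j * \<bar>d j\<bar>)"
    by (simp add: sum_distrib_left algebra_simps)
  finally have 1: "emp_mean n ?n \<le> q * \<mu> * (\<Sum>j<p. l j * \<bar>d j\<bar>)" .
  have "\<bar>emp_mean n ?r\<bar>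
     \<le> emp_norm2 n (\<lambda>i. reg i - logistic (dotp p (z i) \<theta>0)) * pred_norm d"
    unfolding pred_norm_def by (rule emp_mean_Cauchy_Schwarz)
  also have "\<dots> \<le> R * sqrt (real s) * \<mu> * pred_norm d"
    using approx by (intro mult_right_mono) auto
  finally have 2: "emp_mean n ?r
      \<le> R * sqrt (real s) * \<mu> * pred_norm d" by linarith
  have "emp_mean n (\<lambda>i. (logistic (dotp p (z i) \<theta>0) - y i) * dotp p (z i) d) =
     - 1 * emp_mean n ?n
     - emp_mean n ?r"
    unfolding emp_mean_scale[symmetric] emp_mean_diff[symmetric]
    by (rule emp_mean_cong) (simp add: algebra_simps)
  then show ?thesis using 1 2 by linarith
qed

text \<open>The curvature of the loss is quadratic only for small prediction errors. Convexity allows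
  a deviation with too large a prediction norm to be shrunk to one of critical norm,
  where the quadratic lower bound is contradicted.\<close>

lemma localisation:
  assumes P: "P d"
    and scale: "\<And>t d. 0 \<le> t \<Longrightarrow> t \<le> 1 \<Longrightarrow> P d \<Longrightarrow> P (\<lambda>j. t * d j)"
    and basic: "\<And>d. P d \<Longrightarrow> breg \<theta>0 d \<le> D * sqrt (real s) * \<mu> * pred_norm d + D' * real s * \<mu>\<^sup>2"
    and cone: "\<And>d. P d \<Longrightarrow> norm_l1 p d \<le> A * sqrt (real s) * pred_norm d"
    and nonneg: "0 \<le> D" "0 \<le> D'"
    and \<rho>: "\<rho> = (D + D' + 1) / (w / (2 * exp 1))"
    and small: "B * A * \<rho> * real s * \<mu> \<le> 1" and B: "0 \<le> B"
  shows "pred_norm d \<le> \<rho> * sqrt (real s) * \<mu>"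
proof (rule ccontr)
  assume neg: "\<not> ?thesis"
  define w' where "w' = w / (2 * exp 1)"
  have w': "0 < w'" "w' \<le> 1" using w w_le by (auto simp: w'_def)
  have sp: "0 < sqrt (real s)" using s by simp
  have "\<rho> = (D + D' + 1) / w'" by (simp add: \<rho> w'_def)
  then have \<rho>1: "1 \<le> \<rho>" "w' * \<rho> = D + D' + 1"
    using w' nonneg by simp_all
  define \<epsilon> where "\<epsilon> = \<rho> * sqrt (real s) * \<mu>"
  have \<epsilon>: "0 < \<epsilon>" using \<rho>1 sp \<mu> by (simp add: \<epsilon>_def)
  have "\<epsilon> < pred_norm d" using neg by (simp add: \<epsilon>_def)
  define t where "t = \<epsilon> / pred_norm d"
  have t: "0 \<le> t" "t \<le> 1" "t * pred_norm d = \<epsilon>"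
    using \<open>\<epsilon> < pred_norm d\<close> \<epsilon> by (auto simp: t_def)
  define d' where "d' = (\<lambda>j. t * d j)"
  have P': "P d'" unfolding d'_def by (rule scale[OF t(1,2) P])
  have N: "pred_norm d' = \<epsilon>" using t by (simp add: d'_def pred_norm_scale)
  \<comment> \<open>At the critical norm the cone bound and \<open>small\<close> keep every
    prediction within 1, where \<open>breg_ge\<close> applies.\<close>
  have "w' * (pred_norm d')\<^sup>2 \<le> breg \<theta>0 d'"
    unfolding w'_def
  proof (rule breg_ge[OF curvature])
    fix i assume i: "i < n"
    have "\<bar>dotp p (z i) d'\<bar> \<le> B * norm_l1 p d'"
      using bound[OF i] by (rule dotp_le_norm_l1)
    also have "\<dots> \<le> B * (A * sqrt (real s) * \<epsilon>)"
      using cone[OF P'] N B by (intro mult_left_mono) auto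
    also have "\<dots> = B * A * \<rho> * (sqrt (real s) * sqrt (real s)) * \<mu>"
      unfolding \<epsilon>_def by (simp only: ac_simps)
    also have "\<dots> \<le> 1" using small by simp
    finally show "\<bar>dotp p (z i) d'\<bar> \<le> 1" .
  qed simp
  also have "\<dots> \<le> D * sqrt (real s) * \<mu> * \<epsilon> + D' * real s * \<mu>\<^sup>2" using basic[OF P'] N by simp
  finally have "w' * \<epsilon>\<^sup>2 \<le> D * sqrt (real s) * \<mu> * \<epsilon> + D' * real s * \<mu>\<^sup>2" unfolding N .
  moreover have "w' * \<epsilon>\<^sup>2 = (w' * \<rho>) * \<rho> * (real s * \<mu>\<^sup>2)"
    by (simp add: \<epsilon>_def power_mult_distrib power2_eq_square)
  moreover have "D * sqrt (real s) * \<mu> * \<epsilon> = D * \<rho> * (sqrt (real s) * sqrt (real s) * \<mu>\<^sup>2)"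
    unfolding \<epsilon>_def power2_eq_square by (simp only: ac_simps)
  \<comment> \<open>After division by \<open>s * \<mu>\<^sup>2\<close> the two bounds read
    \<open>(D + D' + 1) * \<rho> \<le> D * \<rho> + D'\<close>, which is impossible for
    \<open>\<rho> \<ge> 1\<close>; this explains the numerator of \<open>\<rho>\<close>.\<close>
  ultimately have "(D + D' + 1) * \<rho> * (real s * \<mu>\<^sup>2) \<le> (D * \<rho> + D') * (real s * \<mu>\<^sup>2)"
    unfolding \<rho>1(2) by (simp add: distrib_right)
  then have "(D + D' + 1) * \<rho> \<le> D * \<rho> + D'"
    using s \<mu> by (simp add: mult_le_cancel_right)
  then have "(D' + 1) * \<rho> \<le> D'" by (simp add: algebra_simps)
  moreover have "(D' + 1) * 1 \<le> (D' + 1) * \<rho>" using \<rho>1 nonneg by (intro mult_left_mono) auto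
  ultimately have "(D' + 1) * 1 \<le> D'" by (rule order_trans[rotated])
  then show False by simp
qed

end


text \<open>Kept apart from the sample, so that the constants below are the same for all
  \<open>n\<close>, \<open>P\<close>, \<open>u\<close> and all rounds. \<open>q\<close> is the share
  of the penalty that the score may use up; \<open>lo\<close> and \<open>hi\<close> bound the
  loadings.\<close>

locale lasso_constants =
  fixes q lo hi R \<kappa>1 \<kappa>2 w :: real
  assumes q: "0 \<le> q" "q < 1" and lo: "0 < lo" "lo \<le> hi" and R0: "0 \<le> R"
    and \<kappa>0: "0 < \<kappa>1" "0 < \<kappa>2" and w0: "0 < w"
begin

text \<open>\<open>ratio\<close> and \<open>slope\<close> come from dividing the basic inequality by
  \<open>(1 - q) * lo * \<mu>\<close>; \<open>factor\<close> and \<open>cone\<close> are what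
  \<open>restricted_eigenvalue\<close> makes of them.\<close>

definition ratio :: real where "ratio = (1 + q) * hi / ((1 - q) * lo)"
definition slope :: real where "slope = R / ((1 - q) * lo)"
definition factor :: real where "factor = 2 / \<kappa>1 * (1 + \<kappa>2 * slope)"
definition cone :: real where "cone = (1 + ratio) * factor + slope"
text \<open>The \<open>\<rho>\<close> of \<open>localisation\<close> with
  \<open>D = (1 + q) * hi * factor + R\<close> and \<open>D' = 0\<close>.\<close>

definition rate :: real where "rate = ((1 + q) * hi * factor + R + 1) / (w / (2 * exp 1))"
text \<open>Support size over \<open>s\<close>: the squared ratio of the size of the residual
  correlations to the gap \<open>(1 - q) * lo\<close> left by the first order conditions.\<close>

definition support_factor :: real where "support_factor = (\<kappa>2 * (rate + R) / ((1 - q) * lo))\<^sup>2"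
definition post_cone :: real where "post_cone = sqrt (support_factor + 1) / \<kappa>1"
text \<open>Again the \<open>\<rho>\<close> of \<open>localisation\<close>, now with
  \<open>D' = hi * cone * rate\<close>, the excess loss over the truth that the Lasso fit may have,
  in units of \<open>s * \<mu>\<^sup>2\<close>.\<close>

definition post_rate :: real where
  "post_rate = ((q * hi * post_cone + R) + hi * cone * rate + 1) / (w / (2 * exp 1))"

lemma constants_nonneg:
  "0 \<le> ratio" "0 \<le> slope" "0 \<le> factor" "0 \<le> cone" "0 \<le> rate" "0 \<le> support_factor" "0 \<le> post_cone" "0 \<le> post_rate"
proof -
  have hi: "0 \<le> hi" and d: "0 < (1 - q) * lo" using lo q by auto
  show r: "0 \<le> ratio" "0 \<le> slope" using hi q R0 d by (auto simp: ratio_def slope_def)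
  then show f: "0 \<le> factor" using \<kappa>0 by (simp add: factor_def)
  then show c: "0 \<le> cone" using r by (simp add: cone_def)
  show rt: "0 \<le> rate" using f hi q R0 w0 by (simp add: rate_def)
  show sz: "0 \<le> support_factor" by (simp add: support_factor_def)
  then show pc: "0 \<le> post_cone" using \<kappa>0 by (simp add: post_cone_def)
  show "0 \<le> post_rate" using pc hi q R0 w0 c rt by (simp add: post_rate_def)
qed

end

text \<open>The score is bounded in terms of \<open>lb\<close>, which stays fixed while the loadings
  \<open>l\<close> of \<open>lasso_round\<close> change. The first condition on \<open>M\<close> is
  the cone requirement of \<open>restricted_eigenvalue\<close>; the second rules out supports of
  \<open>M * s\<close> elements or more and leaves room for the Post-Lasso error, which also lives
  on the support of the truth.\<close>

locale lasso_setting = logit_truth n p y z \<theta>0 reg \<mu> w R B \<kappa>1 \<kappa>2 s m + lasso_constants q lo hi R \<kappa>1 \<kappa>2 w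
  for n p y z \<theta>0 reg \<mu> w R B \<kappa>1 \<kappa>2 s m q lo hi +
  fixes lb :: "nat \<Rightarrow> real" and M :: nat
  assumes score_lb: "\<And>j. j < p \<Longrightarrow> \<bar>emp_mean n (\<lambda>i. z i j * (y i - reg i))\<bar> \<le> q * \<mu> * lb j"
    and lb: "\<And>j. j < p \<Longrightarrow> lo \<le> lb j"
    and M: "\<kappa>2 * ratio \<le> \<kappa>1 / 2 * sqrt (real M)" "support_factor + 1 < real M"
    and m: "s + M * s \<le> m" and B: "0 \<le> B"
    and small: "B * cone * rate * real s * \<mu> \<le> 1" "B * post_cone * post_rate * real s * \<mu> \<le> 1"

locale lasso_round = lasso_setting +
  fixes l :: "nat \<Rightarrow> real"
  assumes loadings_lb: "\<And>j. j < p \<Longrightarrow> lb j \<le> l j \<and> l j \<le> hi"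
begin

lemma loadings: "j < p \<Longrightarrow> lo \<le> l j \<and> l j \<le> hi"
  using lb loadings_lb order_trans by blast

lemma score: "j < p \<Longrightarrow> \<bar>emp_mean n (\<lambda>i. z i j * (y i - reg i))\<bar> \<le> q * \<mu> * l j"
proof -
  assume j: "j < p"
  then have "q * \<mu> * lb j \<le> q * \<mu> * l j"
    using q \<mu> loadings_lb by (intro mult_left_mono) auto
  then show ?thesis using score_lb[OF j] by linarith
qed

lemma l_nonneg: "j < p \<Longrightarrow> 0 \<le> l j"
  using loadings lo by force

lemma weighted_bounds:
  assumes "J \<subseteq> {..<p}"
  shows "lo * (\<Sum>j\<in>J. \<bar>d j\<bar>) \<le> (\<Sum>j\<in>J. l j * \<bar>d j\<bar>)" "(\<Sum>j\<in>J. l j * \<bar>d j\<bar>) \<le> hi * (\<Sum>j\<in>J. \<bar>d j\<bar>)"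
  unfolding sum_distrib_left using loadings assms by (auto intro!: sum_mono mult_right_mono)

text \<open>Off the support of \<open>\<theta>0\<close> the error is the estimate itself and pays in
  full; on the support the triangle inequality loses at most its weighted size.\<close>

lemma penalty_difference:
  "norm_l1 p (\<lambda>j. l j * \<theta>0 j) - norm_l1 p (\<lambda>j. l j * (\<theta>0 j + d j)) \<le> (\<Sum>j\<in>supp p \<theta>0. l j * \<bar>d j\<bar>)
     - (\<Sum>j\<in>{..<p} - supp p \<theta>0. l j * \<bar>d j\<bar>)"
proof -
  have split: "(\<Sum>j<p. g j) = (\<Sum>j\<in>{..<p} - supp p \<theta>0. g j) + (\<Sum>j\<in>supp p \<theta>0. g j)" for g :: "nat \<Rightarrow> real"
    by (intro sum.subset_diff supp_subset) auto
  have "(\<Sum>j\<in>{..<p} - supp p \<theta>0. l j * \<bar>\<theta>0 j\<bar>) = 0"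
    by (intro sum.neutral) (auto simp: supp_def)
  moreover have "(\<Sum>j\<in>{..<p} - supp p \<theta>0. l j * \<bar>\<theta>0 j + d j\<bar>) = (\<Sum>j\<in>{..<p} - supp p \<theta>0. l j * \<bar>d j\<bar>)"
    by (intro sum.cong) (auto simp: supp_def)
  moreover have "(\<Sum>j\<in>supp p \<theta>0. l j * \<bar>\<theta>0 j\<bar>) - (\<Sum>j\<in>supp p \<theta>0. l j * \<bar>\<theta>0 j + d j\<bar>) \<le>
      (\<Sum>j\<in>supp p \<theta>0. l j * \<bar>d j\<bar>)"
    unfolding sum_subtractf[symmetric] right_diff_distrib[symmetric]
    using l_nonneg by (intro sum_mono mult_left_mono) (auto simp: supp_def)
  moreover have "norm_l1 p (\<lambda>j. l j * v j) = (\<Sum>j<p. l j * \<bar>v j\<bar>)" for v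
    by (intro sum_abs_weighted l_nonneg)
  ultimately show ?thesis unfolding split by simp
qed

text \<open>What the rates use of minimality. Shrinking towards the truth preserves it, as
  \<open>localisation\<close> requires, and every point of the sublevel set of
  \<open>\<theta>0\<close> satisfies it, which yields existence as well.\<close>

definition descent :: "(nat \<Rightarrow> real) \<Rightarrow> bool" where
  "descent d \<longleftrightarrow> crit l \<mu> (\<lambda>j. \<theta>0 j + d j) \<le> crit l \<mu> \<theta>0"

lemma descent_scale:
  assumes "0 \<le> t" "t \<le> 1" "descent d"
  shows "descent (\<lambda>j. t * d j)"
proof -
  have "crit l \<mu> (\<lambda>j. \<theta>0 j + t * d j) \<le> (1 - t) * crit l \<mu> \<theta>0 + t * crit l \<mu> (\<lambda>j. \<theta>0 j + d j)"
    using assms \<mu> by (intro crit_convex) auto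
  also have "\<dots> \<le> (1 - t) * crit l \<mu> \<theta>0 + t * crit l \<mu> \<theta>0"
    using assms by (intro add_left_mono mult_left_mono) (auto simp: descent_def)
  finally show ?thesis by (simp add: descent_def algebra_simps)
qed

text \<open>The noise consumes a share \<open>q\<close> of the penalty: \<open>1 - q\<close> remains
  off the support, up to \<open>1 + q\<close> is charged on it.\<close>

lemma basic_inequality:
  assumes "descent d"
  shows "breg \<theta>0 d + (1 - q) * \<mu> * (\<Sum>j\<in>{..<p} - supp p \<theta>0. l j * \<bar>d j\<bar>)
     \<le> (1 + q) * \<mu> * (\<Sum>j\<in>supp p \<theta>0. l j * \<bar>d j\<bar>) + R * sqrt (real s) * \<mu> * pred_norm d"
proof -
  define in_T where "in_T = (\<Sum>j\<in>supp p \<theta>0. l j * \<bar>d j\<bar>)"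
  define out_T where "out_T = (\<Sum>j\<in>{..<p} - supp p \<theta>0. l j * \<bar>d j\<bar>)"
  have split: "(\<Sum>j<p. l j * \<bar>d j\<bar>) = out_T + in_T"
    unfolding in_T_def out_T_def by (intro sum.subset_diff supp_subset) auto
  have "loss (\<lambda>j. \<theta>0 j + d j) - loss \<theta>0 \<le>
      \<mu> * (norm_l1 p (\<lambda>j. l j * \<theta>0 j) - norm_l1 p (\<lambda>j. l j * (\<theta>0 j + d j)))"
    using assms unfolding descent_def crit_def by (simp add: algebra_simps)
  also have "\<dots> \<le> \<mu> * (in_T - out_T)"
    unfolding in_T_def out_T_def using \<mu> by (intro mult_left_mono penalty_difference) auto
  finally have "loss (\<lambda>j. \<theta>0 j + d j) - loss \<theta>0 \<le> \<mu> * (in_T - out_T)" .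
  then have "breg \<theta>0 d \<le> \<mu> * (in_T - out_T) + q * \<mu> * (out_T + in_T) + R * sqrt (real s) * \<mu> * pred_norm d"
    using linear_term_ge[OF score, of d] unfolding loss_expand split by linarith
  then show ?thesis by (simp add: in_T_def[symmetric] out_T_def[symmetric] algebra_simps)
qed

lemma descent_cone:
  assumes "descent d"
  shows "(\<Sum>j\<in>{..<p} - supp p \<theta>0. \<bar>d j\<bar>) \<le> ratio * (\<Sum>j\<in>supp p \<theta>0. \<bar>d j\<bar>) + slope * sqrt (real s) * pred_norm d"
proof -
  define in_T where "in_T = (\<Sum>j\<in>supp p \<theta>0. \<bar>d j\<bar>)"
  define out_T where "out_T = (\<Sum>j\<in>{..<p} - supp p \<theta>0. \<bar>d j\<bar>)"
  have "(1 - q) * \<mu> * (lo * out_T) \<le> (1 - q) * \<mu> * (\<Sum>j\<in>{..<p} - supp p \<theta>0. l j * \<bar>d j\<bar>)"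
    unfolding out_T_def using q \<mu> by (intro mult_left_mono weighted_bounds) auto
  also have "\<dots> \<le> (1 + q) * \<mu> * (\<Sum>j\<in>supp p \<theta>0. l j * \<bar>d j\<bar>) + R * sqrt (real s) * \<mu> * pred_norm d"
    using basic_inequality[OF assms] breg_nonneg[of \<theta>0 d] by linarith
  also have "\<dots> \<le> (1 + q) * \<mu> * (hi * in_T) + R * sqrt (real s) * \<mu> * pred_norm d"
    unfolding in_T_def using q \<mu> by (intro add_right_mono mult_left_mono weighted_bounds supp_subset) auto
  finally have "\<mu> * ((1 - q) * lo * out_T) \<le> \<mu> * ((1 + q) * hi * in_T + R * sqrt (real s) * pred_norm d)"
    by (simp add: algebra_simps)
  then have "(1 - q) * lo * out_T \<le> (1 + q) * hi * in_T + R * sqrt (real s) * pred_norm d"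
    using \<mu> by simp
  moreover have "0 < (1 - q) * lo" using q lo by simp
  ultimately have "out_T \<le> ((1 + q) * hi * in_T + R * sqrt (real s) * pred_norm d) / ((1 - q) * lo)"
    by (simp add: pos_le_divide_eq mult.commute)
  then show ?thesis
    by (simp add: ratio_def slope_def in_T_def[symmetric] out_T_def[symmetric] add_divide_distrib)
qed

lemma M_pos: "1 \<le> M"
  using M(2) constants_nonneg(6) by linarith

lemma eigenvalue_bounds:
  assumes "descent d"
  shows "(\<Sum>j\<in>supp p \<theta>0. \<bar>d j\<bar>) \<le> sqrt (real s) * (factor * pred_norm d)"
    and "norm_l1 p d \<le> cone * sqrt (real s) * pred_norm d"
proof -
  have low: "\<kappa>1 * norm_l2 p v \<le> pred_norm v" if "norm_l0 p v \<le> s + M * s" for v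
    using that m by (intro lower) simp
  have up: "pred_norm v \<le> \<kappa>2 * norm_l2 p v" if "norm_l0 p v \<le> s + M * s" for v
    using that m by (intro upper) simp
  have T: "card (supp p \<theta>0) \<le> s" using sparse by (simp add: norm_l0_def)
  note re = restricted_eigenvalue[of "supp p \<theta>0" s M \<kappa>1 \<kappa>2 d ratio slope,
      OF supp_subset T s M_pos \<kappa> low up descent_cone[OF assms] constants_nonneg(1) M(1) constants_nonneg(2)]
  show "(\<Sum>j\<in>supp p \<theta>0. \<bar>d j\<bar>) \<le> sqrt (real s) * (factor * pred_norm d)"
    using re(1) by (simp only: factor_def)
  show "norm_l1 p d \<le> cone * sqrt (real s) * pred_norm d"
    using re(2) by (simp only: factor_def cone_def)
qed

lemma descent_l1: "descent d \<Longrightarrow> norm_l1 p d \<le> cone * sqrt (real s) * pred_norm d"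
  by (rule eigenvalue_bounds(2))

lemma descent_breg:
  assumes "descent d"
  shows "breg \<theta>0 d \<le> ((1 + q) * hi * factor + R) * sqrt (real s) * \<mu> * pred_norm d"
proof -
  let ?T = "\<Sum>j\<in>supp p \<theta>0. l j * \<bar>d j\<bar>"
  have "0 \<le> (1 - q) * \<mu> * (\<Sum>j\<in>{..<p} - supp p \<theta>0. l j * \<bar>d j\<bar>)"
    using q \<mu> l_nonneg by (intro mult_nonneg_nonneg sum_nonneg) auto
  then have "breg \<theta>0 d \<le> (1 + q) * \<mu> * ?T + R * sqrt (real s) * \<mu> * pred_norm d"
    using basic_inequality[OF assms] by linarith
  also have "\<dots> \<le> (1 + q) * \<mu> * (hi * (sqrt (real s) * (factor * pred_norm d))) + R * sqrt (real s) * \<mu> * pred_norm d"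
  proof (intro add_right_mono mult_left_mono)
    have "?T \<le> hi * (\<Sum>j\<in>supp p \<theta>0. \<bar>d j\<bar>)"
      by (intro weighted_bounds supp_subset)
    also have "\<dots> \<le> hi * (sqrt (real s) * (factor * pred_norm d))"
      using eigenvalue_bounds(1)[OF assms] lo by (intro mult_left_mono) auto
    finally show "?T \<le> hi * (sqrt (real s) * (factor * pred_norm d))" .
  qed (use q \<mu> in auto)
  finally show ?thesis by (simp add: algebra_simps)
qed

lemma descent_rate:
  assumes "descent d"
  shows "pred_norm d \<le> rate * sqrt (real s) * \<mu>"
  using small(1) q lo R0 constants_nonneg(3) descent_breg descent_l1 B
  by (intro localisation[where P = descent and D = "(1 + q) * hi * factor + R" and D' = 0 and A = cone]
      assms descent_scale) (auto simp: rate_def)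

lemma descent_l1_rate:
  assumes "descent d"
  shows "norm_l1 p d \<le> cone * rate * real s * \<mu>"
proof -
  have "norm_l1 p d \<le> cone * sqrt (real s) * (rate * sqrt (real s) * \<mu>)"
    using descent_l1[OF assms] descent_rate[OF assms] constants_nonneg(4)
    by (meson mult_left_mono mult_nonneg_nonneg order_trans real_sqrt_ge_zero of_nat_0_le_iff)
  also have "\<dots> = cone * rate * (sqrt (real s) * sqrt (real s)) * \<mu>" by (simp only: ac_simps)
  finally show ?thesis by simp
qed

end


section \<open>First order conditions, existence, sparsity and Post-Lasso\<close>

lemma (in logit_sample) DERIV_loss:
  "((\<lambda>t. loss (\<lambda>i. v i + t * d i)) has_real_derivative
     emp_mean n (\<lambda>i. (logistic (dotp p (z i) v) - y i) * dotp p (z i) d)) (at 0)"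
proof -
  have "((\<lambda>t. softplus (a + t * b) - c * (a + t * b)) has_real_derivative (logistic a - c) * b) (at 0)" for a b c
  proof -
    have "((\<lambda>t. softplus (a + t * b)) has_real_derivative logistic (a + 0 * b) * b) (at 0)"
      by (rule DERIV_chain2[OF DERIV_softplus]) (auto intro!: derivative_eq_intros)
    then show ?thesis by (auto intro!: derivative_eq_intros simp: algebra_simps)
  qed
  then have "((\<lambda>t. emp_mean n (\<lambda>i. softplus (dotp p (z i) v + t * dotp p (z i) d)
      - y i * (dotp p (z i) v + t * dotp p (z i) d))) has_real_derivative
     emp_mean n (\<lambda>i. (logistic (dotp p (z i) v) - y i) * dotp p (z i) d)) (at 0)"
    unfolding emp_mean_def by (intro DERIV_cdivide DERIV_sum) blast
  then show ?thesis by (simp add: loss_eq dotp_add dotp_scale)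
qed

context lasso_round
begin

lemma descent_of_lasso:
  assumes "h \<in> lasso_set n p (\<mu> * real n) l y z"
  shows "crit l \<mu> h \<le> crit l \<mu> v" "descent (\<lambda>j. h j - \<theta>0 j)"
proof -
  show *: "crit l \<mu> h \<le> crit l \<mu> v" for v
    using assms n_pos by (auto simp: lasso_set_def is_arg_min_def crit_def loss_def not_less)
  show "descent (\<lambda>j. h j - \<theta>0 j)"
    using *[of \<theta>0] by (simp add: descent_def)
qed

lemma abs_le_norm_l1: "j < p \<Longrightarrow> \<bar>v j\<bar> \<le> norm_l1 p v"
  unfolding norm_l1_def by (rule member_le_sum) auto

text \<open>Competitors no worse than \<open>\<theta>0\<close> lie in an l1 ball around it by
  \<open>descent_l1_rate\<close>, so the sublevel set is bounded even when the loss alone has no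
  minimiser.\<close>

lemma lasso_exists: "lasso_set n p (\<mu> * real n) l y z \<noteq> {}"
proof -
  have "\<exists>v. is_arg_min (crit l \<mu>) (\<lambda>v. supp p v \<subseteq> UNIV) v"
  proof (rule exists_arg_min_bounded_level[where ?v0.0 = \<theta>0 and
        b = "cone * rate * real s * \<mu> + norm_l1 p \<theta>0"])
    show "crit l \<mu> v = crit l \<mu> v'" if "\<And>j. j < p \<Longrightarrow> v j = v' j" for v v'
      using loss_cong[of v v'] that by (simp add: crit_def norm_l1_def)
  next
    fix v j assume "crit l \<mu> v \<le> crit l \<mu> \<theta>0" and j: "j < p"
    then have "descent (\<lambda>j. v j - \<theta>0 j)" by (simp add: descent_def)
    from descent_l1_rate[OF this] abs_le_norm_l1[OF j, of "\<lambda>j. v j - \<theta>0 j"] abs_le_norm_l1[OF j, of \<theta>0]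
    show "\<bar>v j\<bar> \<le> cone * rate * real s * \<mu> + norm_l1 p \<theta>0" by linarith
  qed (auto intro: continuous_on_crit)
  then obtain v where v: "is_arg_min (crit l \<mu>) (\<lambda>_. True) v" by auto
  then have "v \<in> lasso_set n p (\<mu> * real n) l y z"
    using n_pos by (simp add: lasso_set_def crit_def loss_def cong del: if_weak_cong) (simp add: crit_def[abs_def] loss_def)
  then show ?thesis by blast
qed

text \<open>First order condition: on the support of the Lasso estimator the score equals the penalty
  slope, while at the truth it is smaller by the factor \<open>q\<close>.\<close>

lemma lasso_score:
  assumes h: "h \<in> lasso_set n p (\<mu> * real n) l y z" and j: "j \<in> supp p h"
  shows "\<bar>emp_mean n (\<lambda>i. z i j * (logistic (dotp p (z i) h) - y i))\<bar> = \<mu> * l j"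
proof -
  have jp: "j < p" "h j \<noteq> 0" using j by (auto simp: supp_def)
  define e where "e = (\<lambda>i::nat. if i = j then 1 else 0 :: real)"
  have dot_e: "dotp p x e = x j" for x
  proof -
    have "dotp p x e = (\<Sum>i<p. if i = j then x i else 0)"
      unfolding dotp_def e_def by (intro sum.cong) auto
    then show ?thesis using jp by simp
  qed
  define g where "g = emp_mean n (\<lambda>i. z i j * (logistic (dotp p (z i) h) - y i))"
  \<comment> \<open>Replacing the absolute values by their linear pieces at \<open>h\<close> makes
    the criterion differentiable along \<open>e\<close>; the two agree while
    \<open>\<bar>t\<bar> < \<bar>h j\<bar>\<close>, since no coordinate changes sign there.\<close>
  define \<phi> where "\<phi> = (\<lambda>t. loss (\<lambda>i. h i + t * e i) + \<mu> * (\<Sum>i<p. l i * (sgn (h i) * (h i + t * e i))))"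
  have D1: "((\<lambda>t. loss (\<lambda>i. h i + t * e i)) has_real_derivative g) (at 0)"
    using DERIV_loss[of h e] unfolding dot_e g_def by (simp add: mult.commute)
  have sum_e: "(\<Sum>i<p. l i * (sgn (h i) * e i)) = l j * sgn (h j)"
  proof -
    have "(\<Sum>i<p. l i * (sgn (h i) * e i)) = (\<Sum>i<p. if i = j then l i * sgn (h i) else 0)"
      unfolding e_def by (intro sum.cong) auto
    then show ?thesis using jp by simp
  qed
  have "((\<lambda>t. \<Sum>i<p. l i * (sgn (h i) * (h i + t * e i))) has_real_derivative (\<Sum>i<p. l i * (sgn (h i) * e i))) (at 0)"
    by (intro DERIV_sum) (auto intro!: derivative_eq_intros)
  then have D2: "(\<phi> has_real_derivative g + \<mu> * (l j * sgn (h j))) (at 0)"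
    unfolding \<phi>_def sum_e by (intro DERIV_add D1 DERIV_cmult)
  have "g + \<mu> * (l j * sgn (h j)) = 0"
  proof (rule DERIV_local_min[OF D2])
    show "0 < \<bar>h j\<bar>" using jp by simp
    show "\<forall>t. \<bar>0 - t\<bar> < \<bar>h j\<bar> \<longrightarrow> \<phi> 0 \<le> \<phi> t"
    proof (intro allI impI)
      fix t assume t: "\<bar>0 - t\<bar> < \<bar>h j\<bar>"
      have abs: "\<bar>h i + u * e i\<bar> = sgn (h i) * (h i + u * e i)" if "\<bar>u\<bar> < \<bar>h j\<bar>" for u i
        using that by (auto simp: e_def sgn_if abs_if split: if_splits)
      have eq: "crit l \<mu> (\<lambda>i. h i + u * e i) = \<phi> u" if "\<bar>u\<bar> < \<bar>h j\<bar>" for u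
      proof -
        have "norm_l1 p (\<lambda>i. l i * (h i + u * e i)) = (\<Sum>i<p. l i * \<bar>h i + u * e i\<bar>)"
          by (intro sum_abs_weighted l_nonneg)
        then show ?thesis unfolding crit_def \<phi>_def abs[OF that] by simp
      qed
      have "crit l \<mu> (\<lambda>i. h i + 0 * e i) \<le> crit l \<mu> (\<lambda>i. h i + t * e i)"
        using descent_of_lasso(1)[OF h] by simp
      then show "\<phi> 0 \<le> \<phi> t" using eq[of t] eq[of 0] t jp by simp
    qed
  qed
  then have "g = - (\<mu> * (l j * sgn (h j)))" by linarith
  then have "\<bar>g\<bar> = \<mu> * l j" using jp l_nonneg \<mu> by (simp add: abs_mult sgn_if)
  then show ?thesis by (simp add: g_def)
qed

text \<open>On the support the score at \<open>h\<close> has size \<open>\<mu> * l j\<close>, at the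
  truth at most the share \<open>q\<close> of it; the gap is a correlation of regressor
  \<open>j\<close> with \<open>e\<close>, the change in fitted probabilities up to approximation
  error. The upper eigenvalue and the rate bound the sum of squares of these correlations, so there
  are few of them. The eigenvalue bound reaches only \<open>m\<close> coordinates at once, hence the
  subset \<open>D\<close>.\<close>

lemma lasso_subset_sparse:
  assumes h: "h \<in> lasso_set n p (\<mu> * real n) l y z" and D: "D \<subseteq> supp p h" "card D \<le> m"
  shows "real (card D) \<le> support_factor * real s"
proof -
  define e where "e = (\<lambda>i. logistic (dotp p (z i) h) - reg i)"
  define g where "g = (\<lambda>j. emp_mean n (\<lambda>i. z i j * e i))"
  have Dp: "D \<subseteq> {..<p}" "finite D" using D supp_subset finite_subset[OF D(1)] by auto
  have d: "0 < (1 - q) * lo" using q lo by simp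
  have g_ge: "(1 - q) * lo * \<mu> \<le> \<bar>g j\<bar>" if "j \<in> D" for j
  proof -
    have jp: "j < p" and js: "j \<in> supp p h" using that D Dp by auto
    have "emp_mean n (\<lambda>i. z i j * (logistic (dotp p (z i) h) - y i)) =
        g j - emp_mean n (\<lambda>i. z i j * (y i - reg i))"
      unfolding g_def e_def emp_mean_diff[symmetric] by (simp add: algebra_simps)
    then have "\<mu> * l j \<le> \<bar>g j\<bar> + q * \<mu> * l j"
      using lasso_score[OF h js] score[OF jp] by linarith
    then have "(1 - q) * \<mu> * l j \<le> \<bar>g j\<bar>" by (simp add: algebra_simps)
    moreover have "(1 - q) * \<mu> * lo \<le> (1 - q) * \<mu> * l j"
      using q \<mu> loadings[OF jp] by (intro mult_left_mono) auto
    ultimately show ?thesis by (simp add: algebra_simps)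
  qed
  have e_norm: "emp_norm2 n e \<le> (rate + R) * sqrt (real s) * \<mu>"
  proof -
    let ?d = "\<lambda>i. logistic (dotp p (z i) h) - logistic (dotp p (z i) \<theta>0)" and ?r = "\<lambda>i. reg i - logistic (dotp p (z i) \<theta>0)"
    have "emp_norm2 n e \<le> emp_norm2 n ?d
        + emp_norm2 n (\<lambda>i. - 1 * ?r i)"
      using emp_norm2_triangle[of n ?d
          "\<lambda>i. - 1 * ?r i"] by (simp add: e_def)
    also have "\<dots> = emp_norm2 n ?d
        + emp_norm2 n ?r"
      unfolding emp_norm2_scale by simp
    also have "emp_norm2 n ?d \<le> pred_norm (\<lambda>j. h j - \<theta>0 j)"
      unfolding pred_norm_def by (intro emp_norm2_mono) (simp add: dotp_diff logistic_lipschitz)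
    also have "\<dots> \<le> rate * sqrt (real s) * \<mu>" by (rule descent_rate[OF descent_of_lasso(2)[OF h]])
    finally show ?thesis using approx by (simp add: algebra_simps)
  qed
  define G where "G = sqrt (\<Sum>j\<in>D. (g j)\<^sup>2)"
  have G0: "0 \<le> G" by (simp add: G_def sum_nonneg)
  have G2: "G\<^sup>2 = (\<Sum>j\<in>D. (g j)\<^sup>2)" by (simp add: G_def sum_nonneg)
  \<comment> \<open>Duality: testing \<open>e\<close> against the vector of its own correlations
    gives their sum of squares.\<close>
  have "G\<^sup>2 = emp_mean n (\<lambda>i. e i * dotp p (z i) (restr D g))"
  proof -
    have "e i * dotp p (z i) (restr D g) = (\<Sum>j\<in>D. g j * (z i j * e i))" for i
    proof -
      have "dotp p (z i) (restr D g) = (\<Sum>j\<in>D. z i j * g j)"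
        unfolding dotp_def using Dp by (intro sum.mono_neutral_cong_right) (auto simp: restr_def)
      then show ?thesis by (simp add: sum_distrib_left algebra_simps)
    qed
    then have "emp_mean n (\<lambda>i. e i * dotp p (z i) (restr D g)) = (\<Sum>j\<in>D. g j * g j)"
      by (simp add: emp_mean_sum emp_mean_scale g_def)
    then show ?thesis unfolding G2 by (simp add: power2_eq_square)
  qed
  also have "\<dots> \<le> emp_norm2 n e * pred_norm (restr D g)"
    unfolding pred_norm_def by (rule abs_le_D1[OF emp_mean_Cauchy_Schwarz])
  also have "\<dots> \<le> emp_norm2 n e * (\<kappa>2 * G)"
  proof (rule mult_left_mono)
    have "pred_norm (restr D g) \<le> \<kappa>2 * norm_l2 p (restr D g)"
      using norm_l0_restr[OF Dp(2), of p g] D(2) by (intro upper) simp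
    then show "pred_norm (restr D g) \<le> \<kappa>2 * G" by (simp add: norm_l2_restr[OF Dp(1)] G_def)
  qed simp
  finally have "G * G \<le> (emp_norm2 n e * \<kappa>2) * G" by (simp add: power2_eq_square algebra_simps)
  then have "G \<le> emp_norm2 n e * \<kappa>2"
    using G0 \<kappa> by (cases "G = 0") (auto simp: mult_le_cancel_right)
  also have "\<dots> \<le> (rate + R) * sqrt (real s) * \<mu> * \<kappa>2"
    using e_norm \<kappa> by (intro mult_right_mono) auto
  finally have "G\<^sup>2 \<le> ((rate + R) * sqrt (real s) * \<mu> * \<kappa>2)\<^sup>2"
    using G0 by (rule power_mono)
  also have "\<dots> = (\<kappa>2 * (rate + R))\<^sup>2 * real s * \<mu>\<^sup>2"
    by (simp add: power_mult_distrib)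
  finally have "(\<Sum>j\<in>D. (g j)\<^sup>2) \<le> (\<kappa>2 * (rate + R))\<^sup>2 * real s * \<mu>\<^sup>2" unfolding G2 .
  moreover have "real (card D) * ((1 - q) * lo * \<mu>)\<^sup>2 \<le> (\<Sum>j\<in>D. (g j)\<^sup>2)"
  proof (rule sum_bounded_below)
    fix j assume "j \<in> D"
    then have "((1 - q) * lo * \<mu>)\<^sup>2 \<le> \<bar>g j\<bar>\<^sup>2" using g_ge d \<mu> by (intro power_mono) auto
    then show "((1 - q) * lo * \<mu>)\<^sup>2 \<le> (g j)\<^sup>2" by simp
  qed
  ultimately have "\<mu>\<^sup>2 * (real (card D) * ((1 - q) * lo)\<^sup>2) \<le> \<mu>\<^sup>2 * ((\<kappa>2 * (rate + R))\<^sup>2 * real s)"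
    unfolding power_mult_distrib[of "(1 - q) * lo" \<mu>] by (simp only: ac_simps)
  then have "real (card D) * ((1 - q) * lo)\<^sup>2 \<le> (\<kappa>2 * (rate + R))\<^sup>2 * real s"
    using \<mu> by simp
  moreover have "0 < ((1 - q) * lo)\<^sup>2" using d by (intro zero_less_power)
  ultimately have "real (card D) \<le> (\<kappa>2 * (rate + R))\<^sup>2 * real s / ((1 - q) * lo)\<^sup>2"
    by (simp only: pos_le_divide_eq)
  then show ?thesis by (simp add: support_factor_def power_divide)
qed

text \<open>Self-improvement: a support of more than \<open>m\<close> elements would contain
  \<open>m \<ge> M * s\<close> of them, and \<open>lasso_subset_sparse\<close> would force
  \<open>M \<le> support_factor\<close>.\<close>

lemma lasso_sparse:
  assumes h: "h \<in> lasso_set n p (\<mu> * real n) l y z"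
  shows "real (norm_l0 p h) \<le> support_factor * real s"
proof (cases "card (supp p h) \<le> m")
  case True
  then show ?thesis using lasso_subset_sparse[OF h order_refl] by (simp add: norm_l0_def)
next
  case False
  then obtain D where D: "D \<subseteq> supp p h" "card D = m"
    by (metis linear obtain_subset_with_card_n)
  have "real (M * s) \<le> support_factor * real s"
    using lasso_subset_sparse[OF h D(1)] D(2) m by (simp del: of_nat_mult)
  then have "real M \<le> support_factor" using s by simp
  then show ?thesis using M(2) by simp
qed

text \<open>Post-Lasso need not do better than \<open>\<theta>0\<close>, whose support may be
  missed; it is no worse than the Lasso, whose excess loss is of order
  \<open>s * \<mu>\<^sup>2\<close>. The support condition takes over the role of the cone.\<close>

definition post_descent :: "nat set \<Rightarrow> (nat \<Rightarrow> real) \<Rightarrow> bool" where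
  "post_descent S d \<longleftrightarrow> supp p d \<subseteq> S \<union> supp p \<theta>0 \<and>
     loss (\<lambda>j. \<theta>0 j + d j) \<le> loss \<theta>0 + hi * cone * rate * real s * \<mu>\<^sup>2"

lemma post_descent_scale:
  assumes "0 \<le> t" "t \<le> 1" "post_descent S d"
  shows "post_descent S (\<lambda>j. t * d j)"
proof -
  have "loss (\<lambda>j. \<theta>0 j + t * d j) \<le> (1 - t) * loss \<theta>0 + t * loss (\<lambda>j. \<theta>0 j + d j)"
    using assms by (intro loss_convex)
  also have "\<dots> \<le> (1 - t) * loss \<theta>0 + t * (loss \<theta>0 + hi * cone * rate * real s * \<mu>\<^sup>2)"
    using assms by (intro add_left_mono mult_left_mono) (auto simp: post_descent_def)
  also have "\<dots> = loss \<theta>0 + t * (hi * cone * rate * real s * \<mu>\<^sup>2)" by (simp add: algebra_simps)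
  also have "\<dots> \<le> loss \<theta>0 + 1 * (hi * cone * rate * real s * \<mu>\<^sup>2)"
    using assms constants_nonneg lo \<mu> by (intro add_left_mono mult_right_mono) auto
  finally show ?thesis using assms(3) by (auto simp: post_descent_def supp_def)
qed

text \<open>Such errors have at most \<open>(support_factor + 1) * s\<close> nonzero entries, within
  the range of the lower eigenvalue bound, and Cauchy-Schwarz compares l1 with l2.\<close>

lemma post_l1:
  assumes S: "finite S" "real (card S) \<le> support_factor * real s" and d: "supp p d \<subseteq> S \<union> supp p \<theta>0"
  shows "norm_l1 p d \<le> post_cone * sqrt (real s) * pred_norm d"
proof -
  have "card (supp p d) \<le> card S + card (supp p \<theta>0)"
    using card_mono[OF _ d] card_Un_le[of S "supp p \<theta>0"] S by fastforce
  then have c: "real (card (supp p d)) \<le> (support_factor + 1) * real s"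
    using S(2) sparse unfolding norm_l0_def by (simp add: algebra_simps)
  also have "\<dots> \<le> real M * real s" using M(2) by (intro mult_right_mono) auto
  finally have "norm_l0 p d \<le> m" using m unfolding norm_l0_def of_nat_mult[symmetric] of_nat_le_iff by simp
  then have l2: "norm_l2 p d \<le> pred_norm d / \<kappa>1"
    using lower[of d] \<kappa> by (simp add: field_simps)
  have "norm_l1 p d = (\<Sum>j\<in>supp p d. \<bar>d j\<bar>)"
    unfolding norm_l1_def by (intro sum.mono_neutral_right) (auto simp: supp_def)
  also have "\<dots> \<le> sqrt (real (card (supp p d))) * sqrt (\<Sum>j\<in>supp p d. (d j)\<^sup>2)"
    by (rule sum_abs_le_sqrt_card)
  also have "(\<Sum>j\<in>supp p d. (d j)\<^sup>2) = (\<Sum>j<p. (d j)\<^sup>2)"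
    by (intro sum.mono_neutral_left) (auto simp: supp_def)
  also have "sqrt (real (card (supp p d))) * sqrt (\<Sum>j<p. (d j)\<^sup>2) \<le> sqrt ((support_factor + 1) * real s) * (pred_norm d / \<kappa>1)"
    using c l2 constants_nonneg by (intro mult_mono) (auto simp: norm_l2_def sum_nonneg)
  also have "\<dots> = post_cone * sqrt (real s) * pred_norm d"
    by (simp add: post_cone_def real_sqrt_mult)
  finally show ?thesis .
qed

lemma post_rate_bound:
  assumes S: "finite S" "real (card S) \<le> support_factor * real s" and d: "post_descent S d"
  shows "pred_norm d \<le> post_rate * sqrt (real s) * \<mu>"
proof (rule localisation[where P = "post_descent S" and D = "q * hi * post_cone + R"
      and D' = "hi * cone * rate" and A = post_cone])
  show "0 \<le> q * hi * post_cone + R" "0 \<le> hi * cone * rate"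
    using q lo R0 constants_nonneg by auto
  show "post_descent S (\<lambda>j. t * d j)" if "0 \<le> t" "t \<le> 1" "post_descent S d" for t d
    using that by (rule post_descent_scale)
  show l1: "norm_l1 p d \<le> post_cone * sqrt (real s) * pred_norm d" if "post_descent S d" for d
    using that S by (intro post_l1) (auto simp: post_descent_def)
  show "breg \<theta>0 d \<le> (q * hi * post_cone + R) * sqrt (real s) * \<mu> * pred_norm d + hi * cone * rate * real s * \<mu>\<^sup>2"
    if d: "post_descent S d" for d
  proof -
    have "q * \<mu> * (\<Sum>j<p. l j * \<bar>d j\<bar>) \<le> q * \<mu> * (hi * norm_l1 p d)"
      unfolding norm_l1_def using q \<mu> by (intro mult_left_mono weighted_bounds) auto
    also have "\<dots> \<le> q * \<mu> * (hi * (post_cone * sqrt (real s) * pred_norm d))"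
      using l1[OF d] q \<mu> lo by (intro mult_left_mono) auto
    finally have 1: "q * \<mu> * (\<Sum>j<p. l j * \<bar>d j\<bar>) \<le> q * \<mu> * (hi * (post_cone * sqrt (real s) * pred_norm d))" .
    have "breg \<theta>0 d \<le> hi * cone * rate * real s * \<mu>\<^sup>2 + q * \<mu> * (\<Sum>j<p. l j * \<bar>d j\<bar>) + R * sqrt (real s) * \<mu> * pred_norm d"
      using d linear_term_ge[OF score, of d] unfolding loss_expand post_descent_def by linarith
    then show ?thesis using 1 by (simp add: algebra_simps)
  qed
qed (use d small B in \<open>auto simp: post_rate_def\<close>)

lemma post_l1_rate:
  assumes S: "finite S" "real (card S) \<le> support_factor * real s" and d: "post_descent S d"
  shows "norm_l1 p d \<le> post_cone * post_rate * real s * \<mu>"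
proof -
  have "norm_l1 p d \<le> post_cone * sqrt (real s) * pred_norm d"
    using S d by (intro post_l1) (auto simp: post_descent_def)
  also have "\<dots> \<le> post_cone * sqrt (real s) * (post_rate * sqrt (real s) * \<mu>)"
    using post_rate_bound[OF assms] constants_nonneg by (intro mult_left_mono) auto
  also have "\<dots> = post_cone * post_rate * (sqrt (real s) * sqrt (real s)) * \<mu>" by (simp only: ac_simps)
  finally show ?thesis by simp
qed

text \<open>Optimality of \<open>h\<close> bounds its excess loss by the drop in penalty, at most
  \<open>\<mu> * hi\<close> times its l1 error.\<close>

lemma post_descent_of_loss_le:
  assumes h: "h \<in> lasso_set n p (\<mu> * real n) l y z"
    and v: "supp p v \<subseteq> supp p h" "loss v \<le> loss h"
  shows "post_descent (supp p h) (\<lambda>j. v j - \<theta>0 j)"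
proof -
  let ?d = "\<lambda>j. h j - \<theta>0 j"
  have "loss h \<le> loss \<theta>0 + \<mu> * (norm_l1 p (\<lambda>j. l j * \<theta>0 j) - norm_l1 p (\<lambda>j. l j * (\<theta>0 j + ?d j)))"
    using descent_of_lasso(1)[OF h, of \<theta>0] by (simp add: crit_def algebra_simps)
  also have "\<dots> \<le> loss \<theta>0 + \<mu> * (hi * norm_l1 p ?d)"
  proof -
    have "norm_l1 p (\<lambda>j. l j * \<theta>0 j) - norm_l1 p (\<lambda>j. l j * (\<theta>0 j + ?d j)) \<le> (\<Sum>j\<in>supp p \<theta>0. l j * \<bar>?d j\<bar>)
        - (\<Sum>j\<in>{..<p} - supp p \<theta>0. l j * \<bar>?d j\<bar>)"
      by (rule penalty_difference)
    also have "\<dots> \<le> (\<Sum>j\<in>supp p \<theta>0. l j * \<bar>?d j\<bar>)"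
      using sum_nonneg[of "{..<p} - supp p \<theta>0" "\<lambda>j. l j * \<bar>?d j\<bar>"] l_nonneg by simp
    also have "\<dots> \<le> (\<Sum>j<p. l j * \<bar>?d j\<bar>)"
      using l_nonneg supp_subset by (intro sum_mono2) auto
    also have "\<dots> \<le> hi * norm_l1 p ?d"
      unfolding norm_l1_def by (rule weighted_bounds) simp
    finally show ?thesis using \<mu> by simp
  qed
  also have "\<dots> \<le> loss \<theta>0 + \<mu> * (hi * (cone * rate * real s * \<mu>))"
    using \<mu> lo descent_l1_rate[OF descent_of_lasso(2)[OF h]]
    by (intro add_left_mono mult_left_mono) auto
  finally have "loss v \<le> loss \<theta>0 + hi * cone * rate * real s * \<mu>\<^sup>2"
    using v(2) by (simp add: power2_eq_square algebra_simps)
  moreover have "supp p (\<lambda>j. v j - \<theta>0 j) \<subseteq> supp p h \<union> supp p \<theta>0"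
    using v(1) by (auto simp: supp_def)
  ultimately show ?thesis by (simp add: post_descent_def)
qed

text \<open>Were the data separated on the selected support, the sublevel set of \<open>h\<close>
  would be unbounded; the l1 bound for all competitors supported there excludes this.\<close>

lemma post_exists:
  assumes h: "h \<in> lasso_set n p (\<mu> * real n) l y z"
  shows "post_lasso_set n p y z h \<noteq> {}"
proof -
  have card: "real (card (supp p h)) \<le> support_factor * real s"
    using lasso_sparse[OF h] by (simp add: norm_l0_def)
  have "\<exists>v. is_arg_min loss (\<lambda>v. supp p v \<subseteq> supp p h) v"
  proof (rule exists_arg_min_bounded_level[where ?v0.0 = h and
        b = "post_cone * post_rate * real s * \<mu> + norm_l1 p \<theta>0"])
    fix v j assume v: "supp p v \<subseteq> supp p h" "loss v \<le> loss h" and j: "j < p"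
    from post_l1_rate[OF finite_supp card post_descent_of_loss_le[OF h v]]
      abs_le_norm_l1[OF j, of "\<lambda>j. v j - \<theta>0 j"] abs_le_norm_l1[OF j, of \<theta>0]
    show "\<bar>v j\<bar> \<le> post_cone * post_rate * real s * \<mu> + norm_l1 p \<theta>0" by linarith
  qed (auto intro: continuous_on_loss loss_cong)
  then show ?thesis by (simp add: post_lasso_set_def loss_def[abs_def])
qed

lemma round_bounds:
  assumes h: "selects (lasso_set n p (\<mu> * real n) l y z) h" and t: "selects (post_lasso_set n p y z h) t"
  shows "pred_norm (\<lambda>j. h j - \<theta>0 j) \<le> rate * sqrt (real s) * \<mu>"
    and "norm_l1 p (\<lambda>j. h j - \<theta>0 j) \<le> cone * rate * real s * \<mu>"
    and "real (norm_l0 p h) \<le> support_factor * real s"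
    and "pred_norm (\<lambda>j. t j - \<theta>0 j) \<le> post_rate * sqrt (real s) * \<mu>"
    and "norm_l1 p (\<lambda>j. t j - \<theta>0 j) \<le> post_cone * post_rate * real s * \<mu>"
proof -
  have h': "h \<in> lasso_set n p (\<mu> * real n) l y z"
    using h lasso_exists by (simp add: selects_def)
  then have "t \<in> post_lasso_set n p y z h" using t post_exists by (simp add: selects_def)
  then have t': "supp p t \<subseteq> supp p h" "loss t \<le> loss h"
    by (auto simp: post_lasso_set_def is_arg_min_def loss_def not_less)
  note d = descent_of_lasso(2)[OF h'] and pd = post_descent_of_loss_le[OF h' t']
  show "pred_norm (\<lambda>j. h j - \<theta>0 j) \<le> rate * sqrt (real s) * \<mu>" by (rule descent_rate[OF d])
  show "norm_l1 p (\<lambda>j. h j - \<theta>0 j) \<le> cone * rate * real s * \<mu>" by (rule descent_l1_rate[OF d])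
  show sp: "real (norm_l0 p h) \<le> support_factor * real s" by (rule lasso_sparse[OF h'])
  show "pred_norm (\<lambda>j. t j - \<theta>0 j) \<le> post_rate * sqrt (real s) * \<mu>"
    by (rule post_rate_bound[OF finite_supp sp[unfolded norm_l0_def] pd])
  show "norm_l1 p (\<lambda>j. t j - \<theta>0 j) \<le> post_cone * post_rate * real s * \<mu>"
    by (rule post_l1_rate[OF finite_supp sp[unfolded norm_l0_def] pd])
qed

end


section \<open>Updating the loadings from round to round\<close>

context lasso_setting
begin

text \<open>Minkowski for the empirical norm: the two loadings differ by at most \<open>B\<close>
  times the distance of fitted to true probabilities, which is the Post-Lasso rate plus the
  approximation error.\<close>

lemma updated_loading_close:
  assumes t: "pred_norm (\<lambda>j. t j - \<theta>0 j) \<le> post_rate * sqrt (real s) * \<mu>" and j: "j < p"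
  shows "\<bar>updated_loading n p y z t j - sqrt (emp_mean n (\<lambda>i. (z i j)\<^sup>2 * (y i - reg i)\<^sup>2))\<bar>
    \<le> B * (post_rate + R) * sqrt (real s) * \<mu>"
proof -
  let ?e = "\<lambda>i. logistic (dotp p (z i) t) - logistic (dotp p (z i) \<theta>0)"
  let ?r = "\<lambda>i. reg i - logistic (dotp p (z i) \<theta>0)"
  have 1: "updated_loading n p y z t j = emp_norm2 n (\<lambda>i. z i j * (y i - logistic (dotp p (z i) t)))"
    by (simp add: updated_loading_def emp_norm2_def power_mult_distrib)
  have 2: "sqrt (emp_mean n (\<lambda>i. (z i j)\<^sup>2 * (y i - reg i)\<^sup>2)) = emp_norm2 n (\<lambda>i. z i j * (y i - reg i))"
    by (simp add: emp_norm2_def power_mult_distrib)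
  have "\<bar>emp_norm2 n (\<lambda>i. z i j * (y i - logistic (dotp p (z i) t))) - emp_norm2 n (\<lambda>i. z i j * (y i - reg i))\<bar>
      \<le> emp_norm2 n (\<lambda>i. z i j * (y i - logistic (dotp p (z i) t)) - z i j * (y i - reg i))"
    by (rule emp_norm2_diff_le)
  also have "\<dots> \<le> emp_norm2 n (\<lambda>i. B * (?r i + - 1 * ?e i))"
  proof (rule emp_norm2_mono)
    fix i assume i: "i < n"
    have "z i j * (y i - logistic (dotp p (z i) t)) - z i j * (y i - reg i) = z i j * (?r i + - 1 * ?e i)"
      by (simp add: algebra_simps)
    moreover have "\<bar>z i j\<bar> * \<bar>?r i + - 1 * ?e i\<bar> \<le> \<bar>B\<bar> * \<bar>?r i + - 1 * ?e i\<bar>"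
      using bound[OF i j] by (intro mult_right_mono) auto
    ultimately show "\<bar>z i j * (y i - logistic (dotp p (z i) t)) - z i j * (y i - reg i)\<bar> \<le> \<bar>B * (?r i + - 1 * ?e i)\<bar>"
      by (simp only: abs_mult)
  qed
  also have "\<dots> = B * emp_norm2 n (\<lambda>i. ?r i + - 1 * ?e i)" using B unfolding emp_norm2_scale by simp
  also have "\<dots> \<le> B * (R * sqrt (real s) * \<mu> + post_rate * sqrt (real s) * \<mu>)"
  proof (rule mult_left_mono[OF _ B])
    have "emp_norm2 n (\<lambda>i. ?r i + - 1 * ?e i) \<le> emp_norm2 n ?r + emp_norm2 n ?e"
      using emp_norm2_triangle[of n ?r "\<lambda>i. - 1 * ?e i"] unfolding emp_norm2_scale by simp
    moreover have "emp_norm2 n ?e \<le> pred_norm (\<lambda>j. t j - \<theta>0 j)"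
      unfolding pred_norm_def by (intro emp_norm2_mono) (simp add: dotp_diff logistic_lipschitz)
    ultimately show "emp_norm2 n (\<lambda>i. ?r i + - 1 * ?e i) \<le> R * sqrt (real s) * \<mu> + post_rate * sqrt (real s) * \<mu>"
      using approx t by linarith
  qed
  finally show ?thesis
    unfolding 1 2 by (simp add: algebra_simps)
qed

text \<open>The ideal loading keeps a margin \<open>\<tau>\<close> from both bounds, and the update
  misses it by at most \<open>\<tau>\<close>, so the loadings stay admissible by induction over the
  rounds. As \<open>lb\<close> and \<open>hi\<close> never change, the rates are those of a single
  round.\<close>

theorem algorithm_bounds:
  assumes initial: "\<And>j. j < p \<Longrightarrow> lb j \<le> initial_loading n z j \<and> initial_loading n z j \<le> hi"
    and ideal: "\<And>j. j < p \<Longrightarrow> lb j + \<tau> \<le> sqrt (emp_mean n (\<lambda>i. (z i j)\<^sup>2 * (y i - reg i)\<^sup>2)) \<and>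
      sqrt (emp_mean n (\<lambda>i. (z i j)\<^sup>2 * (y i - reg i)\<^sup>2)) + \<tau> \<le> hi"
    and \<tau>: "B * (post_rate + R) * sqrt (real s) * \<mu> \<le> \<tau>"
    and out: "algorithm_output n p (\<mu> * real n) K y z h t"
  shows "pred_norm (\<lambda>j. h j - \<theta>0 j) \<le> rate * sqrt (real s) * \<mu>"
    and "norm_l1 p (\<lambda>j. h j - \<theta>0 j) \<le> cone * rate * real s * \<mu>"
    and "real (norm_l0 p h) \<le> support_factor * real s"
    and "pred_norm (\<lambda>j. t j - \<theta>0 j) \<le> post_rate * sqrt (real s) * \<mu>"
    and "norm_l1 p (\<lambda>j. t j - \<theta>0 j) \<le> post_cone * post_rate * real s * \<mu>"
proof -
  obtain l hs ts where l0: "\<And>j. j < p \<Longrightarrow> l 0 j = initial_loading n z j"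
    and hs: "\<And>k. k \<le> K + 1 \<Longrightarrow> selects (lasso_set n p (\<mu> * real n) (l k) y z) (hs k)"
    and ts: "\<And>k. k \<le> K + 1 \<Longrightarrow> selects (post_lasso_set n p y z (hs k)) (ts k)"
    and step: "\<And>k j. k \<le> K + 1 \<Longrightarrow> j < p \<Longrightarrow> l (k + 1) j = updated_loading n p y z (ts k) j"
    and fin: "h = hs (K + 1)" "t = ts (K + 1)"
    using out unfolding algorithm_output_def by blast
  \<comment> \<open>Round \<open>k\<close> is used only through its Post-Lasso rate, which validates
    the loadings of round \<open>k + 1\<close>.\<close>
  have round: "lasso_round n p y z \<theta>0 reg \<mu> w R B \<kappa>1 \<kappa>2 s m q lo hi lb M (l k)" if "k \<le> K + 1" for k
    using that
  proof (induction k)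
    case 0
    show ?case by unfold_locales (use l0 initial in auto)
  next
    case (Suc k)
    then interpret lasso_round n p y z \<theta>0 reg \<mu> w R B \<kappa>1 \<kappa>2 s m q lo hi lb M "l k" by simp
    have k: "k \<le> K + 1" using Suc.prems by simp
    show ?case
    proof unfold_locales
      fix j assume j: "j < p"
      have "\<bar>updated_loading n p y z (ts k) j - sqrt (emp_mean n (\<lambda>i. (z i j)\<^sup>2 * (y i - reg i)\<^sup>2))\<bar> \<le> \<tau>"
        using updated_loading_close[OF round_bounds(4)[OF hs[OF k] ts[OF k]] j] \<tau> by linarith
      then show "lb j \<le> l (Suc k) j \<and> l (Suc k) j \<le> hi"
        using step[OF k j] ideal[OF j] unfolding abs_le_iff by (simp add: algebra_simps)
    qed
  qed
  interpret lasso_round n p y z \<theta>0 reg \<mu> w R B \<kappa>1 \<kappa>2 s m q lo hi lb M "l (K + 1)"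
    by (rule round) simp
  note bounds = round_bounds[OF hs[OF order_refl] ts[OF order_refl], folded fin]
  show "pred_norm (\<lambda>j. h j - \<theta>0 j) \<le> rate * sqrt (real s) * \<mu>" by (rule bounds)
  show "norm_l1 p (\<lambda>j. h j - \<theta>0 j) \<le> cone * rate * real s * \<mu>" by (rule bounds)
  show "real (norm_l0 p h) \<le> support_factor * real s" by (rule bounds)
  show "pred_norm (\<lambda>j. t j - \<theta>0 j) \<le> post_rate * sqrt (real s) * \<mu>" by (rule bounds)
  show "norm_l1 p (\<lambda>j. t j - \<theta>0 j) \<le> post_cone * post_rate * real s * \<mu>" by (rule bounds)
qed

end


section \<open>Normal quantiles and Chernoff bounds\<close>

lemma std_normal_tail:
  "1 - std_normal_cdf x = measure std_normal_distribution {x<..}"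
proof -
  interpret N: real_distribution std_normal_distribution by (rule real_dist_normal_dist)
  have "{x<..} = space std_normal_distribution - {..x}" by auto
  then show ?thesis
    unfolding std_normal_cdf_def cdf_def by (subst N.prob_compl[symmetric]) auto
qed

lemma measure_std_normal:
  assumes [measurable]: "A \<in> sets borel"
  shows "measure std_normal_distribution A = (\<integral>x. std_normal_density x * indicator A x \<partial>lborel)"
    and "integrable lborel (\<lambda>x. std_normal_density x * indicator A x)"
proof -
  show i: "integrable lborel (\<lambda>x. std_normal_density x * indicator A x)"
    by (intro integrable_real_mult_indicator) auto
  have "emeasure std_normal_distribution A = (\<integral>\<^sup>+x. ennreal (std_normal_density x * indicator A x) \<partial>lborel)"
    by (subst emeasure_density) (auto intro!: nn_integral_cong simp: ennreal_mult' ennreal_indicator)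
  also have "\<dots> = ennreal (\<integral>x. std_normal_density x * indicator A x \<partial>lborel)"
    using i by (intro nn_integral_eq_integral) auto
  finally show "measure std_normal_distribution A = (\<integral>x. std_normal_density x * indicator A x \<partial>lborel)"
    unfolding measure_def by (simp add: integral_nonneg_AE)
qed

text \<open>For \<open>t > x\<close> the density at \<open>t\<close> is at most
  \<open>exp (- x\<^sup>2 / 2)\<close> times the density recentred at \<open>x\<close>, because
  \<open>x * (t - x) \<ge> 0\<close>.\<close>

lemma std_normal_tail_le:
  assumes "0 \<le> x"
  shows "1 - std_normal_cdf x \<le> exp (- x\<^sup>2 / 2)"
proof -
  have "1 - std_normal_cdf x = (\<integral>t. std_normal_density t * indicator {x<..} t \<partial>lborel)"
    unfolding std_normal_tail by (rule measure_std_normal) simp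
  also have "\<dots> \<le> (\<integral>t. exp (- x\<^sup>2 / 2) * normal_density x 1 t \<partial>lborel)"
  proof (rule integral_mono)
    show "integrable lborel (\<lambda>t. std_normal_density t * indicator {x<..} t)"
      by (rule measure_std_normal) simp
    show "integrable lborel (\<lambda>t. exp (- x\<^sup>2 / 2) * normal_density x 1 t)" by simp
    show "std_normal_density t * indicator {x<..} t \<le> exp (- x\<^sup>2 / 2) * normal_density x 1 t" for t
    proof (cases "x < t")
      case True
      have "0 \<le> x * (t - x)" using True assms by simp
      then have "- t\<^sup>2 / 2 \<le> - x\<^sup>2 / 2 + - (t - x)\<^sup>2 / 2"
        by (simp add: power2_eq_square field_simps)
      then have "exp (- t\<^sup>2 / 2) \<le> exp (- x\<^sup>2 / 2) * exp (- (t - x)\<^sup>2 / 2)"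
        by (simp flip: exp_add)
      then have "1 / sqrt (2 * pi) * exp (- t\<^sup>2 / 2) \<le> 1 / sqrt (2 * pi) * (exp (- x\<^sup>2 / 2) * exp (- (t - x)\<^sup>2 / 2))"
        by (intro mult_left_mono) auto
      then show ?thesis using True by (simp add: normal_density_def algebra_simps)
    qed simp
  qed
  also have "\<dots> = exp (- x\<^sup>2 / 2)" by simp
  finally show ?thesis .
qed

text \<open>The mass between \<open>x\<close> and \<open>x + 1\<close> alone. Compared with Mills'
  ratio this loses a factor exponential in \<open>x\<close>, which the slack in
  \<open>chernoff_exponent\<close> absorbs.\<close>

lemma std_normal_tail_ge:
  assumes "0 \<le> x"
  shows "std_normal_density (x + 1) \<le> 1 - std_normal_cdf x"
proof -
  have "std_normal_density (x + 1) = (\<integral>t. std_normal_density (x + 1) * indicator {x<..x + 1} t \<partial>lborel)"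
    by simp
  also have "\<dots> \<le> (\<integral>t. std_normal_density t * indicator {x<..} t \<partial>lborel)"
  proof (rule integral_mono)
    show "std_normal_density (x + 1) * indicator {x<..x + 1} t \<le> std_normal_density t * indicator {x<..} t" for t
    proof (cases "x < t \<and> t \<le> x + 1")
      case True
      then have "t\<^sup>2 \<le> (x + 1)\<^sup>2" using assms by (intro power_mono) auto
      then show ?thesis using True by (simp add: normal_density_def divide_right_mono)
    qed (auto simp: indicator_def)
  qed (use measure_std_normal(2) in auto)
  also have "\<dots> = 1 - std_normal_cdf x"
    unfolding std_normal_tail by (rule measure_std_normal(1)[symmetric]) simp
  finally show ?thesis .
qed

text \<open>\<open>inv\<close> is a choice function, so \<open>q\<close> must first be seen to lie
  in the range: the absence of atoms gives continuity, the limits at both ends give intermediate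
  values.\<close>

lemma std_normal_cdf_inv:
  assumes "0 < q" "q < 1"
  shows "std_normal_cdf (inv std_normal_cdf q) = q"
proof -
  interpret N: real_distribution std_normal_distribution by (rule real_dist_normal_dist)
  have cont: "isCont std_normal_cdf x" for x
  proof -
    have "measure std_normal_distribution {x} = (\<integral>t. std_normal_density t * indicator {x} t \<partial>lborel)"
      by (rule measure_std_normal) simp
    also have "\<dots> = 0"
      using AE_lborel_singleton[of x] by (intro integral_eq_zero_AE) (auto elim!: eventually_mono)
    finally show ?thesis unfolding std_normal_cdf_def by (subst N.isCont_cdf) simp
  qed
  have "\<forall>\<^sub>F x in at_top. q < std_normal_cdf x"
    using order_tendstoD(1)[OF N.cdf_lim_at_top_prob assms(2)] by (simp add: std_normal_cdf_def)
  then obtain b where b: "\<forall>x\<ge>b. q < std_normal_cdf x" by (auto simp: eventually_at_top_linorder)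
  have "\<forall>\<^sub>F x in at_bot. std_normal_cdf x < q"
    using order_tendstoD(2)[OF N.cdf_lim_at_bot assms(1)] by (simp add: std_normal_cdf_def)
  then obtain a where a: "\<forall>x\<le>a. std_normal_cdf x < q" by (auto simp: eventually_at_bot_linorder)
  have "\<exists>x. min a b \<le> x \<and> x \<le> b \<and> std_normal_cdf x = q"
    by (rule IVT) (use a b cont in \<open>auto simp: less_imp_le\<close>)
  then have "q \<in> range std_normal_cdf" by auto
  then show ?thesis by (rule f_inv_into_f)
qed

text \<open>The threshold on \<open>q\<close> forces a nonnegative quantile, since the upper tail at
  0 is at least the density at 1; the two tail bounds are then inverted.\<close>

lemma normal_quantile_bounds:
  fixes q :: real
  assumes q: "0 < q" "q < std_normal_density 1"
  defines "x \<equiv> inv std_normal_cdf (1 - q)"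
  shows "0 \<le> x" "x\<^sup>2 \<le> 2 * ln (1 / q)" "exp (- (x + 1)\<^sup>2 / 2) \<le> sqrt (2 * pi) * q"
proof -
  interpret N: real_distribution std_normal_distribution by (rule real_dist_normal_dist)
  have "std_normal_density 1 < 1"
  proof -
    have "1 < sqrt (2 * pi)" using pi_gt3 by simp
    moreover have "exp (- 1 / 2) < (1::real)" by simp
    ultimately have "exp (- 1 / 2) < sqrt (2 * pi)" by (rule less_trans[rotated])
    then have "exp (- 1 / 2) / sqrt (2 * pi) < 1" using pi_gt_zero by (subst divide_less_eq_1_pos) auto
    then show ?thesis by (simp add: normal_density_def)
  qed
  then have "std_normal_cdf x = 1 - q"
    unfolding x_def using q by (intro std_normal_cdf_inv) auto
  then have tail: "1 - std_normal_cdf x = q" by simp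
  show x0: "0 \<le> x"
  proof (rule ccontr)
    assume "\<not> 0 \<le> x"
    then have "std_normal_cdf x \<le> std_normal_cdf 0"
      unfolding std_normal_cdf_def by (intro N.cdf_nondecreasing) auto
    then show False using std_normal_tail_ge[of 0] tail q by simp
  qed
  have "q \<le> exp (- x\<^sup>2 / 2)" using std_normal_tail_le[OF x0] tail by simp
  then have "ln q \<le> ln (exp (- x\<^sup>2 / 2))" using q(1) by (subst ln_le_cancel_iff) auto
  then show "x\<^sup>2 \<le> 2 * ln (1 / q)" using q by (simp add: ln_div)
  have "1 / sqrt (2 * pi) * exp (- (x + 1)\<^sup>2 / 2) \<le> q"
    using std_normal_tail_ge[OF x0] tail by (simp add: normal_density_def)
  then show "exp (- (x + 1)\<^sup>2 / 2) \<le> sqrt (2 * pi) * q"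
    by (simp add: field_simps)
qed


section \<open>Exponential moments and Chernoff bounds\<close>

lemma exp_le_quadratic: "exp u \<le> 1 + u + u\<^sup>2 / 2 * exp \<bar>u\<bar>" for u :: real
proof -
  obtain t where t: "\<bar>t\<bar> \<le> \<bar>u\<bar>" "exp u = (\<Sum>m<2. (u ^ m) / fact m) + (exp t / fact 2) * u ^ 2"
    using Maclaurin_exp_le[of u 2] by blast
  have "exp t \<le> exp \<bar>u\<bar>" using t(1) by simp
  then have "exp t * u\<^sup>2 \<le> exp \<bar>u\<bar> * u\<^sup>2" by (rule mult_right_mono) simp
  then show ?thesis using t(2) by (simp add: numeral_2_eq_2 algebra_simps)
qed

lemma prob_space_iid_sample:
  "prob_space P \<Longrightarrow> prob_space (iid_sample n P)"
  unfolding iid_sample_def by (rule prob_space_PiM)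

text \<open>Second order bound on the exponential whose remainder costs \<open>exp (a * b)\<close>;
  the mean is zero, so only the variance term is left. Keeping \<open>exp (a * b)\<close> explicit
  allows an exponent close to the Gaussian one when \<open>a * b\<close> is small.\<close>

lemma (in prob_space) mgf_le:
  fixes g :: "'a \<Rightarrow> real" and a b v :: real
  assumes [measurable]: "g \<in> borel_measurable M" and b: "AE x in M. \<bar>g x\<bar> \<le> b"
    and mean: "(\<integral>x. g x \<partial>M) = 0" and v: "(\<integral>x. (g x)\<^sup>2 \<partial>M) \<le> v" and a: "0 \<le> a"
  shows "integrable M (\<lambda>x. exp (a * g x))" "(\<integral>x. exp (a * g x) \<partial>M) \<le> exp (a\<^sup>2 / 2 * exp (a * b) * v)"
proof -
  have ig: "integrable M g"
    by (rule integrable_const_bound[where B = b]) (use b in auto)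
  have ig2: "integrable M (\<lambda>x. (g x)\<^sup>2)"
    by (rule integrable_const_bound[where B = "b\<^sup>2"])
      (use b in \<open>auto elim!: eventually_mono simp: abs_le_square_iff[symmetric]\<close>)
  show ie: "integrable M (\<lambda>x. exp (a * g x))"
  proof (rule integrable_const_bound[where B = "exp (a * b)"])
    show "AE x in M. norm (exp (a * g x)) \<le> exp (a * b)"
      using b by eventually_elim (use a in \<open>auto intro!: mult_left_mono\<close>)
  qed simp
  have "(\<integral>x. exp (a * g x) \<partial>M) \<le> (\<integral>x. 1 + a * g x + a\<^sup>2 / 2 * exp (a * b) * (g x)\<^sup>2 \<partial>M)"
  proof (rule integral_mono_AE[OF ie])
    show "integrable M (\<lambda>x. 1 + a * g x + a\<^sup>2 / 2 * exp (a * b) * (g x)\<^sup>2)"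
      using ig ig2 by simp
    show "AE x in M. exp (a * g x) \<le> 1 + a * g x + a\<^sup>2 / 2 * exp (a * b) * (g x)\<^sup>2"
      using b
    proof eventually_elim
      case (elim x)
      then have "exp \<bar>a * g x\<bar> \<le> exp (a * b)" using a by (auto simp: abs_mult intro!: mult_left_mono)
      then have "(a * g x)\<^sup>2 / 2 * exp \<bar>a * g x\<bar> \<le> (a * g x)\<^sup>2 / 2 * exp (a * b)"
        by (rule mult_left_mono) simp
      then show ?case using exp_le_quadratic[of "a * g x"] by (simp add: power_mult_distrib algebra_simps)
    qed
  qed
  also have "\<dots> = 1 + a\<^sup>2 / 2 * exp (a * b) * (\<integral>x. (g x)\<^sup>2 \<partial>M)"
    using ig ig2 mean prob_space by simp
  also have "\<dots> \<le> 1 + a\<^sup>2 / 2 * exp (a * b) * v"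
    using v by (intro add_left_mono mult_left_mono) auto
  also have "\<dots> \<le> exp (a\<^sup>2 / 2 * exp (a * b) * v)" by (rule exp_ge_add_one_self)
  finally show "(\<integral>x. exp (a * g x) \<partial>M) \<le> exp (a\<^sup>2 / 2 * exp (a * b) * v)" .
qed

lemma (in prob_space) chernoff_upper:
  fixes g :: "'a \<Rightarrow> real" and a b v :: real
  assumes [measurable]: "g \<in> borel_measurable M" and b: "AE x in M. \<bar>g x\<bar> \<le> b"
    and mean: "(\<integral>x. g x \<partial>M) = 0" and v: "(\<integral>x. (g x)\<^sup>2 \<partial>M) \<le> v" and a: "0 \<le> a" and n: "0 < n"
  shows "measure (iid_sample n M) {\<omega> \<in> space (iid_sample n M). \<tau> \<le> emp_mean n (\<lambda>i. g (\<omega> i))}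
    \<le> exp (- (real n * (a * \<tau> - a\<^sup>2 / 2 * exp (a * b) * v)))"
proof -
  let ?S = "iid_sample n M"
  let ?A = "{\<omega> \<in> space ?S. \<tau> \<le> emp_mean n (\<lambda>i. g (\<omega> i))}"
  let ?B = "{\<omega> \<in> space ?S. exp (real n * (a * \<tau>)) \<le> (\<Prod>i<n. exp (a * g (\<omega> i)))}"
  interpret S: product_sigma_finite "\<lambda>_::nat. M" by standard
  note mgf = mgf_le[OF assms(1-5)]
  have int: "integrable (?S) (\<lambda>\<omega>. \<Prod>i<n. exp (a * g (\<omega> i)))"
    unfolding iid_sample_def by (intro S.product_integrable_prod mgf) simp
  have "measure (?S) ?A
    \<le> measure (?S) ?B"
  proof (rule finite_measure.finite_measure_mono)
    show "finite_measure (?S)"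
      using prob_space_iid_sample prob_space_axioms prob_space.finite_measure by blast
    show "?B \<in> sets (?S)"
      unfolding iid_sample_def by measurable
    show "?A \<subseteq>
        ?B"
    proof safe
      fix \<omega> assume "\<tau> \<le> emp_mean n (\<lambda>i. g (\<omega> i))"
      then have "real n * \<tau> \<le> (\<Sum>i<n. g (\<omega> i))" using n by (simp add: emp_mean_def field_simps)
      then have "a * (real n * \<tau>) \<le> a * (\<Sum>i<n. g (\<omega> i))" using a by (rule mult_left_mono)
      then show "exp (real n * (a * \<tau>)) \<le> (\<Prod>i<n. exp (a * g (\<omega> i)))"
        by (simp add: exp_sum[symmetric] sum_distrib_left algebra_simps)
    qed
  qed
  also have "\<dots> \<le> (\<integral>\<omega>. (\<Prod>i<n. exp (a * g (\<omega> i))) \<partial>?S) / exp (real n * (a * \<tau>))"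
    by (rule integral_Markov_inequality_measure[OF int sets.empty_sets]) (auto intro!: prod_nonneg)
  also have "(\<integral>\<omega>. (\<Prod>i<n. exp (a * g (\<omega> i))) \<partial>?S) = (\<integral>x. exp (a * g x) \<partial>M) ^ n"
    unfolding iid_sample_def by (subst S.product_integral_prod) (auto intro: mgf)
  also have "\<dots> \<le> exp (a\<^sup>2 / 2 * exp (a * b) * v) ^ n"
    using mgf(2) by (intro power_mono integral_nonneg_AE) auto
  also have "\<dots> / exp (real n * (a * \<tau>)) = exp (- (real n * (a * \<tau> - a\<^sup>2 / 2 * exp (a * b) * v)))"
    by (simp add: exp_of_nat_mult[symmetric] exp_diff[symmetric] algebra_simps)
  finally show ?thesis by (simp add: divide_right_mono)
qed

lemma (in prob_space) chernoff:
  fixes g :: "'a \<Rightarrow> real" and a b v :: real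
  assumes [measurable]: "g \<in> borel_measurable M" and b: "AE x in M. \<bar>g x\<bar> \<le> b"
    and mean: "(\<integral>x. g x \<partial>M) = 0" and v: "(\<integral>x. (g x)\<^sup>2 \<partial>M) \<le> v" and a: "0 \<le> a" and n: "0 < n"
  shows "{\<omega> \<in> space (iid_sample n M). \<tau> \<le> \<bar>emp_mean n (\<lambda>i. g (\<omega> i))\<bar>} \<in> sets (iid_sample n M)"
    and "measure (iid_sample n M) {\<omega> \<in> space (iid_sample n M). \<tau> \<le> \<bar>emp_mean n (\<lambda>i. g (\<omega> i))\<bar>}
    \<le> 2 * exp (- (real n * (a * \<tau> - a\<^sup>2 / 2 * exp (a * b) * v)))"
proof -
  let ?S = "iid_sample n M" and ?e = "exp (- (real n * (a * \<tau> - a\<^sup>2 / 2 * exp (a * b) * v)))"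
  let ?D = "{\<omega> \<in> space ?S. \<tau> \<le> \<bar>emp_mean n (\<lambda>i. g (\<omega> i))\<bar>}"
  let ?A = "\<lambda>g::'a \<Rightarrow> real. {\<omega> \<in> space (?S). \<tau> \<le> emp_mean n (\<lambda>i. g (\<omega> i))}"
  have meas: "?A h \<in> sets (?S)" if [measurable]: "h \<in> borel_measurable M" for h
    unfolding iid_sample_def emp_mean_def by measurable
  have neg: "emp_mean n (\<lambda>i. - g (\<omega> i)) = - emp_mean n (\<lambda>i. g (\<omega> i))" for \<omega>
    by (simp add: emp_mean_def sum_negf)
  have eq: "?D = ?A g \<union> ?A (\<lambda>x. - g x)"
    unfolding neg by (auto simp: abs_if)
  have m: "?A g \<in> sets (?S)" "?A (\<lambda>x. - g x) \<in> sets (?S)"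
    by (intro meas; measurable)+
  show "?D \<in> sets (?S)"
    unfolding eq using m by (rule sets.Un)
  interpret N: prob_space "?S" by (intro prob_space_iid_sample prob_space_axioms)
  have "measure (?S) (?A g \<union> ?A (\<lambda>x. - g x)) \<le>
      measure (?S) (?A g) + measure (?S) (?A (\<lambda>x. - g x))"
    using m by (rule measure_Un_le)
  also have "\<dots> \<le> ?e + ?e"
    using assms by (intro add_mono chernoff_upper) auto
  finally show "measure (?S) ?D
    \<le> 2 * ?e"
    unfolding eq by simp
qed


section \<open>Regular samples\<close>

lemma image_admissible_suslin_measurable:
  assumes "image_admissible_suslin U M N V" "u \<in> U"
  shows "V u \<in> measurable M N"
proof -
  obtain S :: "real measure" and T where ST: "T ` space S = U"
    and V: "(\<lambda>(y, w). V (T y) w) \<in> measurable (S \<Otimes>\<^sub>M M) N"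
    using assms(1) unfolding image_admissible_suslin_def by blast
  obtain y where y: "y \<in> space S" "T y = u" using ST assms(2) by blast
  have "(\<lambda>w. (case (y, w) of (y, w) \<Rightarrow> V (T y) w)) \<in> measurable M N"
    using y(1) by (intro measurable_compose[OF measurable_Pair1' V])
  then show ?thesis using y(2) by simp
qed

section \<open>Moments of the noise\<close>

context assumption_G
begin

lemma sample_facts:
  assumes n: "n \<ge> n\<^sub>0" and P: "P \<in> \<P> n"
  shows "prob_space P" "space P = space W" "sets P = sets W"
    and "j < p n \<Longrightarrow> (\<lambda>w. f n (X w) j) \<in> borel_measurable P"
    and "u \<in> U \<Longrightarrow> Y u \<in> borel_measurable P"
    and "u \<in> U \<Longrightarrow> \<zeta> n P u \<in> borel_measurable P"
proof -
  show 1: "prob_space P" "sets P = sets W" using law[OF n P] by auto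
  then show "space P = space W" by (metis sets_eq_imp_space_eq)
  have conv: "measurable P N = measurable W N" for N :: "real measure"
    using 1(2) by (intro measurable_cong_sets) auto
  show "(\<lambda>w. f n (X w) j) \<in> borel_measurable P" if "j < p n"
    unfolding conv using f_measurable[OF n that] X_measurable by (rule measurable_compose[rotated])
  show "Y u \<in> borel_measurable P" if "u \<in> U"
    using measurable_compose[OF image_admissible_suslin_measurable[OF data_suslin that] measurable_fst]
    unfolding conv by simp
  show "\<zeta> n P u \<in> borel_measurable P" if "u \<in> U"
    using measurable_compose[OF image_admissible_suslin_measurable[OF noise_suslin[OF n P] that] measurable_fst]
    unfolding conv by simp
qed

text \<open>The conditional variance of a binary outcome with mean \<open>m\<close> is \<open>m (1 - m)\<close>.\<close>

lemma noise_moments: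
  assumes n: "n \<ge> n\<^sub>0" and P: "P \<in> \<P> n" and u: "u \<in> U" and j: "j < p n"
  shows "AE w in P. \<bar>f n (X w) j * \<zeta> n P u w\<bar> \<le> K n"
    and "(\<integral>w. f n (X w) j * \<zeta> n P u w \<partial>P) = 0"
    and "cl * (1 - cl) * c \<le> (\<integral>w. (f n (X w) j)\<^sup>2 * (\<zeta> n P u w)\<^sup>2 \<partial>P)"
    and "(\<integral>w. (f n (X w) j)\<^sup>2 * (\<zeta> n P u w)\<^sup>2 \<partial>P) \<le> (\<integral>w. (f n (X w) j)\<^sup>2 \<partial>P) / 4"
proof -
  let ?v = "\<integral>w. (f n (X w) j)\<^sup>2 * (\<zeta> n P u w)\<^sup>2 \<partial>P"
  interpret prob_space P by (rule sample_facts[OF n P])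
  note [measurable] = sample_facts(4)[OF n P j] sample_facts(5,6)[OF n P u]
  have spP: "space P = space W" by (rule sample_facts[OF n P])
  define F where "F = vimage_algebra (space P) X XS"
  define g where "g = (\<lambda>w. f n (X w) j)"
  define h where "h = real_cond_exp P F (Y u)"
  have Xm: "X \<in> measurable P XS" using X_measurable sample_facts(3)[OF n P] measurable_cong_sets by blast
  have sub: "subalgebra P F"
    unfolding F_def subalgebra_def using measurable_sets[OF Xm] sets_vimage_algebra2[of X "space P" XS] measurable_space[OF Xm]
    by auto
  interpret finite_measure_subalgebra P F by standard (rule sub)
  have gF: "g \<in> borel_measurable F"
    unfolding g_def F_def using f_measurable[OF n j] measurable_space[OF Xm]
    by (intro measurable_compose[OF measurable_vimage_algebra1]) auto
  have gP[measurable]: "g \<in> borel_measurable P" using gF sub measurable_from_subalg by blast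
  have hF: "h \<in> borel_measurable F" unfolding h_def by simp
  have hP[measurable]: "h \<in> borel_measurable P" using hF sub measurable_from_subalg by blast
  have reg_h: "AE w in P. \<zeta> n P u w = Y u w - h w"
    using model[OF n P u] unfolding h_def F_def \<zeta>_def reg_def by eventually_elim simp
  have h01: "AE w in P. cl \<le> h w \<and> h w \<le> 1 - cl"
    using model[OF n P u] non_degenerate[OF n P] unfolding h_def F_def reg_def
    by eventually_elim (use u in auto)
  have Y01: "AE w in P. Y u w \<in> {0, 1}"
    by (rule AE_I2) (use binary[OF u] spP in auto)
  have gK: "AE w in P. \<bar>g w\<bar> \<le> K n"
    using bounded[OF n P] unfolding g_def by eventually_elim (use j in auto)
  have z1: "AE w in P. \<bar>\<zeta> n P u w\<bar> \<le> 1"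
    using reg_h h01 Y01 by eventually_elim (use constants in auto)
  show "AE w in P. \<bar>f n (X w) j * \<zeta> n P u w\<bar> \<le> K n"
    using gK z1 unfolding g_def
  proof eventually_elim
    case (elim w)
    have "\<bar>f n (X w) j\<bar> * \<bar>\<zeta> n P u w\<bar> \<le> K n * 1" using elim by (intro mult_mono) auto
    then show ?case by (simp add: abs_mult)
  qed
  have int: "integrable P k" if [measurable]: "k \<in> borel_measurable P" and "AE w in P. \<bar>k w\<bar> \<le> b" for k :: "'w \<Rightarrow> real" and b
    by (rule integrable_const_bound[where B = b]) (use that in auto)
  have K0: "0 \<le> K n"
  proof -
    have "AE w in P. 0 \<le> K n" using gK by eventually_elim linarith
    then show ?thesis by (simp add: AE_const)
  qed
  have igY: "integrable P (\<lambda>w. g w * Y u w)"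
  proof (rule int)
    show "AE w in P. \<bar>g w * Y u w\<bar> \<le> K n" using gK Y01 by eventually_elim (use K0 in auto)
  qed simp
  have igh: "integrable P (\<lambda>w. g w * h w)" and E1: "(\<integral>w. g w * h w \<partial>P) = (\<integral>w. g w * Y u w \<partial>P)"
    using real_cond_exp_intg[OF igY gF] unfolding h_def by auto
  have "(\<integral>w. f n (X w) j * \<zeta> n P u w \<partial>P) = (\<integral>w. g w * Y u w - g w * h w \<partial>P)"
  proof (rule integral_cong_AE)
    show "AE w in P. f n (X w) j * \<zeta> n P u w = g w * Y u w - g w * h w"
      using reg_h by eventually_elim (simp add: g_def right_diff_distrib)
  qed simp_all
  also have "\<dots> = 0" using igY igh E1 by simp
  finally show "(\<integral>w. f n (X w) j * \<zeta> n P u w \<partial>P) = 0" .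
  have sq: "\<bar>(g w)\<^sup>2 * k\<bar> \<le> (K n)\<^sup>2" if "\<bar>g w\<bar> \<le> K n" "\<bar>k\<bar> \<le> 1" for w k
  proof -
    have "(g w)\<^sup>2 \<le> (K n)\<^sup>2" using that(1) K0 by (simp add: abs_le_square_iff[symmetric])
    then have "(g w)\<^sup>2 * \<bar>k\<bar> \<le> (K n)\<^sup>2 * 1" using that(2) by (intro mult_mono) auto
    then show ?thesis by (simp add: abs_mult)
  qed
  have h1: "AE w in P. \<bar>1 - 2 * h w\<bar> \<le> 1 \<and> \<bar>h w\<bar> \<le> 1"
    using h01 by eventually_elim (use constants in auto)
  \<comment> \<open>Since the outcome is 0 or 1,
    \<open>(Y - h)\<^sup>2 = (1 - 2 * h) * Y + h\<^sup>2\<close> is linear in \<open>Y\<close>;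
    replacing \<open>Y\<close> by \<open>h\<close> against the \<open>F\<close>-measurable weight
    turns it into \<open>h * (1 - h)\<close>.\<close>
  have i1: "integrable P (\<lambda>w. (g w)\<^sup>2 * (1 - 2 * h w) * Y u w)"
  proof (rule int)
    show "AE w in P. \<bar>(g w)\<^sup>2 * (1 - 2 * h w) * Y u w\<bar> \<le> (K n)\<^sup>2"
      using gK Y01 h1 by eventually_elim (use sq in auto)
  qed simp
  have i2: "integrable P (\<lambda>w. (g w)\<^sup>2 * (1 - 2 * h w) * h w)"
    and E2: "(\<integral>w. (g w)\<^sup>2 * (1 - 2 * h w) * h w \<partial>P) = (\<integral>w. (g w)\<^sup>2 * (1 - 2 * h w) * Y u w \<partial>P)"
    using real_cond_exp_intg[OF i1] gF hF unfolding h_def by auto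
  have i3: "integrable P (\<lambda>w. (g w)\<^sup>2 * (h w)\<^sup>2)"
  proof (rule int)
    show "AE w in P. \<bar>(g w)\<^sup>2 * (h w)\<^sup>2\<bar> \<le> (K n)\<^sup>2"
      using gK h1 by eventually_elim (intro sq, auto simp: abs_square_le_1)
  qed simp
  have i4: "integrable P (\<lambda>w. (g w)\<^sup>2)"
  proof (rule int)
    show "AE w in P. \<bar>(g w)\<^sup>2\<bar> \<le> (K n)\<^sup>2" using gK by eventually_elim (use sq[of _ 1] in auto)
  qed simp
  have "?v = (\<integral>w. (g w)\<^sup>2 * (1 - 2 * h w) * Y u w + (g w)\<^sup>2 * (h w)\<^sup>2 \<partial>P)"
  proof (rule integral_cong_AE)
    show "AE w in P. (f n (X w) j)\<^sup>2 * (\<zeta> n P u w)\<^sup>2 = (g w)\<^sup>2 * (1 - 2 * h w) * Y u w + (g w)\<^sup>2 * (h w)\<^sup>2"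
      using reg_h Y01
    proof eventually_elim
      case (elim w)
      have "Y u w * Y u w = Y u w" using elim(2) by auto
      then have "(Y u w - h w)\<^sup>2 = (1 - 2 * h w) * Y u w + (h w)\<^sup>2"
        by (simp add: power2_eq_square algebra_simps)
      then show ?case unfolding elim(1) g_def by (simp add: distrib_left mult.assoc)
    qed
  qed simp_all
  also have "\<dots> = (\<integral>w. (g w)\<^sup>2 * (1 - 2 * h w) * h w + (g w)\<^sup>2 * (h w)\<^sup>2 \<partial>P)"
    using i1 i2 i3 E2 by simp
  also have "\<dots> = (\<integral>w. (g w)\<^sup>2 * (h w * (1 - h w)) \<partial>P)"
    by (rule Bochner_Integration.integral_cong) (auto simp: power2_eq_square algebra_simps)
  finally have E: "?v = (\<integral>w. (g w)\<^sup>2 * (h w * (1 - h w)) \<partial>P)" .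
  have i5: "integrable P (\<lambda>w. (g w)\<^sup>2 * (h w * (1 - h w)))"
    using Bochner_Integration.integrable_add[OF i2 i3] by (simp add: power2_eq_square algebra_simps)
  show "?v \<le> (\<integral>w. (f n (X w) j)\<^sup>2 \<partial>P) / 4"
  proof -
    have "(\<integral>w. (g w)\<^sup>2 * (h w * (1 - h w)) \<partial>P) \<le> (\<integral>w. (g w)\<^sup>2 * (1 / 4) \<partial>P)"
      using i5 i4 mult_one_minus_le by (intro integral_mono mult_left_mono) auto
    then show ?thesis unfolding E by (simp add: g_def)
  qed
  have "(\<integral>w. (g w)\<^sup>2 * (cl * (1 - cl)) \<partial>P) \<le> (\<integral>w. (g w)\<^sup>2 * (h w * (1 - h w)) \<partial>P)"
  proof (rule integral_mono_AE)
    show "AE w in P. (g w)\<^sup>2 * (cl * (1 - cl)) \<le> (g w)\<^sup>2 * (h w * (1 - h w))"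
      using h01
    proof eventually_elim
      case (elim w)
      have "0 \<le> (h w - cl) * (1 - cl - h w)" using elim by simp
      then have "cl * (1 - cl) \<le> h w * (1 - h w)" by (simp add: algebra_simps)
      then show ?case by (rule mult_left_mono) simp
    qed
  qed (use i4 i5 in auto)
  moreover have "cl * (1 - cl) * c \<le> cl * (1 - cl) * (\<integral>w. (g w)\<^sup>2 \<partial>P)"
    using second_moments[OF n P j] constants unfolding g_def by (intro mult_left_mono) auto
  moreover have "(\<integral>w. (g w)\<^sup>2 * (cl * (1 - cl)) \<partial>P) = cl * (1 - cl) * (\<integral>w. (g w)\<^sup>2 \<partial>P)"
    by (simp add: mult.commute)
  ultimately show "cl * (1 - cl) * c \<le> ?v"
    unfolding E by linarith
qed

text \<open>A bounded variable with second moment at least \<open>c\<close> has a bound of at least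
  \<open>sqrt c\<close>; this allows division by \<open>K n\<close> later.\<close>

lemma K_lower:
  assumes n: "n \<ge> n\<^sub>0" and P: "P \<in> \<P> n" and p: "0 < p n"
  shows "0 \<le> K n" "c \<le> (K n)\<^sup>2" "j < p n \<Longrightarrow> AE w in P. (f n (X w) j)\<^sup>2 \<le> (K n)\<^sup>2"
proof -
  interpret prob_space P by (rule sample_facts[OF n P])
  have "AE w in P. 0 \<le> K n"
    using bounded[OF n P] by eventually_elim (use p abs_ge_zero order_trans in blast)
  then show K0: "0 \<le> K n" by (simp add: AE_const)
  show b: "AE w in P. (f n (X w) j)\<^sup>2 \<le> (K n)\<^sup>2" if "j < p n" for j
    using bounded[OF n P] by eventually_elim (use that K0 in \<open>auto simp: abs_le_square_iff[symmetric]\<close>)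
  note [measurable] = sample_facts(4)[OF n P p]
  have "integrable P (\<lambda>w. (f n (X w) 0)\<^sup>2)"
    by (rule integrable_const_bound[where B = "(K n)\<^sup>2"]) (use b[OF p] in auto)
  then have "(\<integral>w. (f n (X w) 0)\<^sup>2 \<partial>P) \<le> (\<integral>w. (K n)\<^sup>2 \<partial>P)"
    using b[OF p] by (intro integral_mono_AE) auto
  then show "c \<le> (K n)\<^sup>2" using second_moments[OF n P p] prob_space by simp
qed

end


section \<open>Calculus of inner probabilities\<close>

lemma with_prob_ge_mono:
  assumes "with_prob_ge M q Q" "q' \<le> q" "\<And>\<omega>. \<omega> \<in> space M \<Longrightarrow> Q \<omega> \<Longrightarrow> Q' \<omega>"
  shows "with_prob_ge M q' Q'"
proof -
  obtain A where A: "A \<in> sets M" "q \<le> measure M A" "\<forall>\<omega>\<in>A. Q \<omega>"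
    using assms(1) unfolding with_prob_ge_def by blast
  have "\<forall>\<omega>\<in>A. Q' \<omega>" using A(3) sets.sets_into_space[OF A(1)] assms(3) by blast
  then show ?thesis unfolding with_prob_ge_def using A(1,2) assms(2) by (intro bexI[of _ A]) auto
qed

context prob_space
begin

lemma with_prob_ge_conj:
  assumes "with_prob_ge M (1 - a) Q" "with_prob_ge M (1 - b) R"
  shows "with_prob_ge M (1 - (a + b)) (\<lambda>\<omega>. Q \<omega> \<and> R \<omega>)"
proof -
  obtain A B where A: "A \<in> events" "1 - a \<le> prob A" "\<forall>\<omega>\<in>A. Q \<omega>"
    and B: "B \<in> events" "1 - b \<le> prob B" "\<forall>\<omega>\<in>B. R \<omega>"
    using assms unfolding with_prob_ge_def by blast
  have "prob (A \<union> B) = prob A + prob B - prob (A \<inter> B)"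
    using A B by (simp add: measure_Un3 fmeasurable_eq_sets)
  moreover have "prob (A \<union> B) \<le> 1" by simp
  ultimately have "1 - (a + b) \<le> prob (A \<inter> B)" using A B by linarith
  then show ?thesis unfolding with_prob_ge_def using A B by (intro bexI[of _ "A \<inter> B"]) auto
qed

lemma with_prob_ge_AE:
  assumes "AE \<omega> in M. Q \<omega>"
  shows "with_prob_ge M (1 - 0) Q"
proof -
  obtain N where N: "{\<omega> \<in> space M. \<not> Q \<omega>} \<subseteq> N" "N \<in> null_sets M"
    using assms unfolding eventually_ae_filter by auto
  then have "prob (space M - N) = 1"
    using prob_compl[of N] null_setsD2[of N] measure_eq_0_null_sets[of N] by simp
  then show ?thesis unfolding with_prob_ge_def using N by (intro bexI[of _ "space M - N"]) auto
qed

lemma with_prob_ge_not: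
  assumes "{\<omega> \<in> space M. Q \<omega>} \<in> events" "prob {\<omega> \<in> space M. Q \<omega>} \<le> b"
  shows "with_prob_ge M (1 - b) (\<lambda>\<omega>. \<not> Q \<omega>)"
  unfolding with_prob_ge_def using assms prob_compl[OF assms(1)]
  by (intro bexI[of _ "space M - {\<omega> \<in> space M. Q \<omega>}"]) auto

lemma with_prob_ge_ball:
  assumes "finite I" "\<And>i. i \<in> I \<Longrightarrow> with_prob_ge M (1 - b) (Q i)"
  shows "with_prob_ge M (1 - real (card I) * b) (\<lambda>\<omega>. \<forall>i\<in>I. Q i \<omega>)"
  using assms
proof (induction I rule: finite_induct)
  case empty
  show ?case using with_prob_ge_AE[of "\<lambda>_. True"] by simp
next
  case (insert i I)
  have "with_prob_ge M (1 - (b + real (card I) * b)) (\<lambda>\<omega>. Q i \<omega> \<and> (\<forall>i\<in>I. Q i \<omega>))"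
    using insert by (intro with_prob_ge_conj) auto
  then show ?case using insert by (simp add: algebra_simps)
qed

end

lemma AE_iid_sample:
  assumes "prob_space P" "AE w in P. Q w"
  shows "AE \<omega> in iid_sample n P. \<forall>i<n. Q (\<omega> i)"
proof -
  have "AE \<omega> in iid_sample n P. \<forall>i\<in>{..<n}. Q (\<omega> i)"
    unfolding iid_sample_def using assms
    by (intro AE_finite_allI AE_PiM_component) auto
  then show ?thesis by eventually_elim auto
qed

text \<open>At \<open>u = chernoff_slack c1\<close> the value \<open>2 - exp u = (1 + 1 / c1\<^sup>2) / 2\<close> makes the exponent of the Chernoff
  bound exceed \<open>x\<^sup>2 / 2\<close> by a fixed factor larger than one.\<close>

definition chernoff_slack :: "real \<Rightarrow> real" where
  "chernoff_slack c1 = ln (3 / 2 - 1 / (2 * c1\<^sup>2))"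

lemma chernoff_slack_pos:
  assumes "1 < c1"
  shows "0 < chernoff_slack c1"
proof -
  have "1 < c1\<^sup>2" using assms by (simp add: one_less_power)
  then have "1 / (2 * c1\<^sup>2) < 1 / (2 * 1)" by (intro divide_strict_left_mono) auto
  then show ?thesis unfolding chernoff_slack_def by (intro ln_gt_zero) linarith
qed

text \<open>The cost of passing from the Chernoff exponent back to the normal tail:
  \<open>sqrt (2 * pi)\<close> is the normalisation of the density, \<open>1 / 2\<close> and
  \<open>1 / (c1\<^sup>2 - 1)\<close> remain from completing the square in
  \<open>chernoff_exponent\<close>.\<close>

definition tail_const :: "real \<Rightarrow> real" where
  "tail_const c1 = sqrt (2 * pi) * exp (1 / 2 + 1 / (c1\<^sup>2 - 1))"

text \<open>The exponent is at least \<open>(1 + \<eta>) * x\<^sup>2 / 2\<close> with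
  \<open>2 * \<eta> = c1\<^sup>2 - 1\<close>, while the bound on the normal tail has
  \<open>(x + 1)\<^sup>2 / 2\<close>. The difference \<open>x + 1 / 2\<close> is covered by
  \<open>\<eta> * x\<^sup>2 / 2\<close> up to a constant.\<close>

lemma chernoff_exponent:
  assumes c1: "1 < c1" and u: "u \<le> chernoff_slack c1"
    and x: "exp (- (x + 1)\<^sup>2 / 2) \<le> sqrt (2 * pi) * \<beta>"
  shows "exp (- (c1\<^sup>2 * x\<^sup>2 * (1 - exp u / 2))) \<le> tail_const c1 * \<beta>"
proof -
  define \<eta> where "\<eta> = (c1\<^sup>2 - 1) / 2"
  have c12: "1 < c1\<^sup>2" using c1 by (simp add: one_less_power)
  then have \<eta>: "0 < \<eta>" by (simp add: \<eta>_def)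
  have "1 / (2 * c1\<^sup>2) < 1 / (2 * 1)" using c12 by (intro divide_strict_left_mono) auto
  then have pos: "0 < 3 / 2 - 1 / (2 * c1\<^sup>2)" by linarith
  have "exp u \<le> exp (chernoff_slack c1)" using u by simp
  also have "\<dots> = 3 / 2 - 1 / (2 * c1\<^sup>2)" unfolding chernoff_slack_def using pos by (rule exp_ln)
  finally have "c1\<^sup>2 * (1 - exp u / 2) \<ge> c1\<^sup>2 * (1 - (3 / 2 - 1 / (2 * c1\<^sup>2)) / 2)"
    by (intro mult_left_mono) auto
  also have "c1\<^sup>2 * (1 - (3 / 2 - 1 / (2 * c1\<^sup>2)) / 2) = (1 + \<eta>) / 2"
    using c1 by (simp add: \<eta>_def field_simps)
  finally have "(1 + \<eta>) / 2 * x\<^sup>2 \<le> c1\<^sup>2 * (1 - exp u / 2) * x\<^sup>2"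
    by (rule mult_right_mono) simp
  then have 1: "(1 + \<eta>) / 2 * x\<^sup>2 \<le> c1\<^sup>2 * x\<^sup>2 * (1 - exp u / 2)"
    by (simp only: ac_simps)
  have 2: "x - \<eta> / 2 * x\<^sup>2 \<le> 1 / (2 * \<eta>)"
  proof -
    have "0 \<le> (\<eta> * x - 1)\<^sup>2 / (2 * \<eta>)" using \<eta> by simp
    also have "(\<eta> * x - 1)\<^sup>2 / (2 * \<eta>) = \<eta> / 2 * x\<^sup>2 - x + 1 / (2 * \<eta>)"
      using \<eta> by (simp add: power2_eq_square field_simps)
    finally show ?thesis by linarith
  qed
  have 3: "(1 + \<eta>) / 2 * x\<^sup>2 = x\<^sup>2 / 2 + \<eta> / 2 * x\<^sup>2" by (simp add: field_simps)
  have \<eta>2: "2 * \<eta> = c1\<^sup>2 - 1" by (simp add: \<eta>_def)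
  have sq: "(x + 1)\<^sup>2 = x\<^sup>2 + 2 * x + 1" by (simp add: power2_eq_square algebra_simps)
  have lin: "- A \<le> - (Q + 2 * x + 1) / 2 + (1 / 2 + b)" if "T \<le> A" "x - H \<le> b" "T = Q / 2 + H" for A b H Q T :: real
    using that by argo
  have "- (c1\<^sup>2 * x\<^sup>2 * (1 - exp u / 2)) \<le> - (x + 1)\<^sup>2 / 2 + (1 / 2 + 1 / (c1\<^sup>2 - 1))"
    unfolding sq by (rule lin[OF 1 2[unfolded \<eta>2] 3])
  then have "exp (- (c1\<^sup>2 * x\<^sup>2 * (1 - exp u / 2))) \<le> exp (- (x + 1)\<^sup>2 / 2) * exp (1 / 2 + 1 / (c1\<^sup>2 - 1))"
    by (simp flip: exp_add)
  also have "\<dots> \<le> sqrt (2 * pi) * \<beta> * exp (1 / 2 + 1 / (c1\<^sup>2 - 1))"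
    using x by (intro mult_right_mono) auto
  finally show ?thesis unfolding tail_const_def by (simp only: ac_simps)
qed

section \<open>Concentration of the score and of the second moments\<close>

context assumption_G
begin

definition sd :: "nat \<Rightarrow> 'w measure \<Rightarrow> (nat \<Rightarrow> real) \<Rightarrow> nat \<Rightarrow> real" where
  "sd n P u j = sqrt (\<integral>w. (f n (X w) j)\<^sup>2 * (\<zeta> n P u w)\<^sup>2 \<partial>P)"

definition sd_min :: real where "sd_min = sqrt (cl * (1 - cl) * c)"

definition log_pn :: "nat \<Rightarrow> real" where "log_pn n = ln (max (real (p n)) (real n))"

lemma sd_min_pos: "0 < sd_min"
  using constants by (simp add: sd_min_def)

lemma sd_bounds:
  assumes "n \<ge> n\<^sub>0" "P \<in> \<P> n" "u \<in> U" "j < p n"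
  shows "sd_min \<le> sd n P u j" "(sd n P u j)\<^sup>2 = (\<integral>w. (f n (X w) j)\<^sup>2 * (\<zeta> n P u w)\<^sup>2 \<partial>P)"
    "(sd n P u j)\<^sup>2 \<le> (\<integral>w. (f n (X w) j)\<^sup>2 \<partial>P) / 4"
proof -
  note m = noise_moments[OF assms]
  show "sd_min \<le> sd n P u j" using m(3) by (simp add: sd_min_def sd_def)
  show *: "(sd n P u j)\<^sup>2 = (\<integral>w. (f n (X w) j)\<^sup>2 * (\<zeta> n P u w)\<^sup>2 \<partial>P)"
    unfolding sd_def by (intro real_sqrt_pow2 integral_nonneg_AE) auto
  show "(sd n P u j)\<^sup>2 \<le> (\<integral>w. (f n (X w) j)\<^sup>2 \<partial>P) / 4" unfolding * by (rule m(4))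
qed

lemma noise_tail:
  assumes n: "n \<ge> n\<^sub>0" and P: "P \<in> \<P> n" and u: "u \<in> U" and j: "j < p n"
    and c1: "1 < c1" and x: "0 \<le> x" "exp (- (x + 1)\<^sup>2 / 2) \<le> sqrt (2 * pi) * \<beta>"
    and small: "c1 * x * K n / (sd_min * sqrt (real n)) \<le> chernoff_slack c1"
  shows "with_prob_ge (iid_sample n P) (1 - 2 * tail_const c1 * \<beta>)
    (\<lambda>\<omega>. \<bar>emp_mean n (\<lambda>i. f n (X (\<omega> i)) j * \<zeta> n P u (\<omega> i))\<bar> \<le> c1 * x * sd n P u j / sqrt (real n))"
proof -
  interpret prob_space P by (rule sample_facts[OF n P])
  interpret S: prob_space "iid_sample n P" by (intro prob_space_iid_sample prob_space_axioms)
  note [measurable] = sample_facts(4)[OF n P j] sample_facts(6)[OF n P u]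
  note m = noise_moments[OF n P u j] and sd = sd_bounds[OF n P u j]
  have n_pos: "0 < n" using n n0 by simp
  have \<sigma>: "0 < sd n P u j" using sd(1) sd_min_pos by linarith
  define \<sigma> where "\<sigma> = sd n P u j"
  have \<sigma>: "0 < \<sigma>" "sd_min \<le> \<sigma>" using sd(1) sd_min_pos by (auto simp: \<sigma>_def)
  have K0: "0 \<le> K n" using K_lower(1)[OF n P] j by simp
  \<comment> \<open>The tilt \<open>\<tau> / \<sigma>\<^sup>2\<close>, optimal for a Gaussian;
    \<open>a * K n\<close> is then the small quantity that \<open>chernoff_slack\<close>
    limits.\<close>
  define a where "a = c1 * x / (\<sigma> * sqrt (real n))"
  define \<tau> where "\<tau> = c1 * x * \<sigma> / sqrt (real n)"
  have a0: "0 \<le> a" using c1 x \<sigma> by (simp add: a_def)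
  have "a * K n = c1 * x * K n / (\<sigma> * sqrt (real n))" by (simp add: a_def)
  also have "\<dots> \<le> c1 * x * K n / (sd_min * sqrt (real n))"
    using \<sigma> sd_min_pos n_pos K0 c1 x by (intro divide_left_mono mult_right_mono mult_pos_pos) auto
  finally have aK: "a * K n \<le> chernoff_slack c1" using small by linarith
  have \<sigma>2: "(\<integral>w. (f n (X w) j * \<zeta> n P u w)\<^sup>2 \<partial>P) \<le> \<sigma>\<^sup>2"
    using sd(2) by (simp add: \<sigma>_def power_mult_distrib)
  note ch = chernoff[OF _ m(1,2) \<sigma>2 a0 n_pos, of \<tau>]
  have expo: "real n * (a * \<tau> - a\<^sup>2 / 2 * exp (a * K n) * \<sigma>\<^sup>2) = c1\<^sup>2 * x\<^sup>2 * (1 - exp (a * K n) / 2)"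
  proof -
    have 1: "real n * (a * \<tau>) = c1\<^sup>2 * x\<^sup>2"
      using \<sigma> n_pos by (simp add: a_def \<tau>_def power2_eq_square)
    have "real n * a\<^sup>2 * \<sigma>\<^sup>2 = c1\<^sup>2 * x\<^sup>2"
      using \<sigma> n_pos by (simp add: a_def power_divide power_mult_distrib)
    then have "real n * (a\<^sup>2 / 2 * exp (a * K n) * \<sigma>\<^sup>2) = c1\<^sup>2 * x\<^sup>2 * (exp (a * K n) / 2)"
      by (simp add: field_simps)
    then show ?thesis using 1 by (simp add: right_diff_distrib)
  qed
  let ?A = "{\<omega> \<in> space (iid_sample n P). \<tau> \<le> \<bar>emp_mean n (\<lambda>i. f n (X (\<omega> i)) j * \<zeta> n P u (\<omega> i))\<bar>}"
  have "with_prob_ge (iid_sample n P) (1 - 2 * tail_const c1 * \<beta>)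
    (\<lambda>\<omega>. \<not> \<tau> \<le> \<bar>emp_mean n (\<lambda>i. f n (X (\<omega> i)) j * \<zeta> n P u (\<omega> i))\<bar>)"
  proof (rule S.with_prob_ge_not)
    show "?A \<in> S.events"
      by (rule ch(1)) simp
    have "S.prob ?A
      \<le> 2 * exp (- (real n * (a * \<tau> - a\<^sup>2 / 2 * exp (a * K n) * \<sigma>\<^sup>2)))"
      by (rule ch(2)) simp
    also have "\<dots> \<le> 2 * (tail_const c1 * \<beta>)"
      unfolding expo using chernoff_exponent[OF c1 aK x(2)] by simp
    finally show "S.prob ?A
      \<le> 2 * tail_const c1 * \<beta>" by simp
  qed
  then show ?thesis
    by (rule with_prob_ge_mono) (auto simp: \<tau>_def \<sigma>_def)
qed

text \<open>The exponent \<open>2 * log_pn n\<close> is chosen so that a union bound over the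
  \<open>p n\<close> coordinates still leaves a failure probability of order
  \<open>1 / n\<close>.\<close>

lemma second_moment_tail:
  assumes n: "n \<ge> n\<^sub>0" and P: "P \<in> \<P> n" and j: "j < p n" and \<epsilon>: "0 < \<epsilon>"
    and \<delta>: "4 * \<delta> n \<le> min 1 (\<epsilon> / (C * exp 1)) * \<epsilon>" and L: "1 \<le> log_pn n"
  shows "with_prob_ge (iid_sample n P) (1 - 2 * exp (- 2 * log_pn n))
    (\<lambda>\<omega>. \<bar>emp_mean n (\<lambda>i. (f n (X (\<omega> i)) j)\<^sup>2) - (\<integral>w. (f n (X w) j)\<^sup>2 \<partial>P)\<bar> \<le> \<epsilon>)"
proof -
  interpret prob_space P by (rule sample_facts[OF n P])
  interpret S: prob_space "iid_sample n P" by (intro prob_space_iid_sample prob_space_axioms)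
  note [measurable] = sample_facts(4)[OF n P j]
  have n_pos: "0 < n" using n n0 by simp
  have p0: "0 < p n" using j by simp
  note K = K_lower[OF n P p0]
  have K2: "0 < (K n)\<^sup>2" using K(2) constants by linarith
  define g where "g = (\<lambda>w. (f n (X w) j)\<^sup>2 - (\<integral>w. (f n (X w) j)\<^sup>2 \<partial>P))"
  let ?f = "\<lambda>w. (f n (X w) j)\<^sup>2" and ?m = "\<integral>w. (f n (X w) j)\<^sup>2 \<partial>P"
  have i2: "integrable P (\<lambda>w. ?f w)"
    by (rule integrable_const_bound[where B = "(K n)\<^sup>2"]) (use K(3)[OF j] in auto)
  have "?m \<le> (\<integral>w. (K n)\<^sup>2 \<partial>P)" using i2 K(3)[OF j] by (intro integral_mono_AE) auto
  then have m: "0 \<le> ?m" "?m \<le> (K n)\<^sup>2" "?m \<le> C"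
    using prob_space second_moments[OF n P j] by (auto intro: integral_nonneg_AE)
  have gm[measurable]: "g \<in> borel_measurable P" unfolding g_def by measurable
  have gb: "AE w in P. \<bar>g w\<bar> \<le> (K n)\<^sup>2"
    using K(3)[OF j]
  proof eventually_elim
    case (elim w)
    have "0 \<le> ?f w" by simp
    then show ?case using elim m unfolding g_def by linarith
  qed
  have g0: "(\<integral>w. g w \<partial>P) = 0" using i2 prob_space by (simp add: g_def)
  have g2: "(\<integral>w. (g w)\<^sup>2 \<partial>P) \<le> (K n)\<^sup>2 * C"
  proof -
    have i4: "integrable P (\<lambda>w. ?f w * ?f w)"
    proof (rule integrable_const_bound[where B = "(K n)\<^sup>2 * (K n)\<^sup>2"])
      show "AE w in P. norm (?f w * ?f w) \<le> (K n)\<^sup>2 * (K n)\<^sup>2"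
        using K(3)[OF j] by eventually_elim (simp only: real_norm_def abs_mult abs_power2, intro mult_mono, auto)
    qed simp
    have "(\<integral>w. (g w)\<^sup>2 \<partial>P) = (\<integral>w. ?f w * ?f w - 2 * ?m * ?f w + ?m\<^sup>2 \<partial>P)"
      unfolding g_def by (rule Bochner_Integration.integral_cong) (auto simp: power2_eq_square algebra_simps)
    also have "\<dots> = (\<integral>w. ?f w * ?f w \<partial>P) - 2 * ?m * ?m + ?m\<^sup>2"
      using i4 i2 prob_space by simp
    also have "\<dots> \<le> (\<integral>w. ?f w * ?f w \<partial>P)"
      using m by (simp add: power2_eq_square)
    also have "\<dots> \<le> (\<integral>w. (K n)\<^sup>2 * ?f w \<partial>P)"
    proof (rule integral_mono_AE[OF i4])
      show "AE w in P. ?f w * ?f w \<le> (K n)\<^sup>2 * ?f w"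
        using K(3)[OF j] by eventually_elim (intro mult_right_mono, auto)
    qed (use i2 in auto)
    also have "\<dots> \<le> (K n)\<^sup>2 * C" using m by (simp add: mult_left_mono)
    finally show ?thesis .
  qed
  \<comment> \<open>A tilt of \<open>a0 / (K n)\<^sup>2\<close> keeps \<open>exp (a * b)\<close> at
    most \<open>exp 1\<close>, and \<open>a0 * (C * exp 1) \<le> \<epsilon>\<close> keeps the
    quadratic term below half of the linear one. The growth condition makes what is left at least
    \<open>2 * log_pn n\<close>.\<close>
  define a0 where "a0 = min 1 (\<epsilon> / (C * exp 1))"
  have a0: "0 < a0" "a0 \<le> 1" "a0 * (C * exp 1) \<le> \<epsilon>"
  proof -
    have Ce: "0 < C * exp 1" using constants by simp
    show "0 < a0" "a0 \<le> 1" using \<epsilon> Ce by (auto simp: a0_def)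
    have "a0 \<le> \<epsilon> / (C * exp 1)" by (simp add: a0_def)
    then show "a0 * (C * exp 1) \<le> \<epsilon>" using Ce by (simp only: pos_le_divide_eq)
  qed
  define a where "a = a0 / (K n)\<^sup>2"
  have a: "0 \<le> a" "a * (K n)\<^sup>2 = a0" using a0 K2 by (auto simp: a_def)
  note ch = chernoff[OF gm gb g0 g2 a(1) n_pos, of \<epsilon>]
  have "2 * log_pn n \<le> real n * (a * \<epsilon> - a\<^sup>2 / 2 * exp (a * (K n)\<^sup>2) * ((K n)\<^sup>2 * C))"
  proof -
    have "exp a0 * C * a0 \<le> exp 1 * C * a0"
      using a0 constants by (intro mult_right_mono) auto
    also have "\<dots> \<le> \<epsilon>" using a0(3) by (simp add: algebra_simps)
    finally have "a0 * (exp a0 * C * a0) \<le> a0 * \<epsilon>" using a0 by (intro mult_left_mono) auto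
    then have 1: "a0 * \<epsilon> / 2 \<le> a0 * \<epsilon> - a0\<^sup>2 / 2 * exp a0 * C" by (simp add: power2_eq_square algebra_simps)
    have "(K n)\<^sup>2 * (1::real) * (log_pn n)\<^sup>2 \<le> (K n)\<^sup>2 * (real (s n))\<^sup>2 * (log_pn n)\<^sup>2"
      using s_pos[OF n] by (intro mult_right_mono mult_left_mono) auto
    also have "\<dots> \<le> \<delta> n * real n" using growth[OF n] by (simp add: log_pn_def)
    finally have "(log_pn n)\<^sup>2 \<le> \<delta> n * real n / (K n)\<^sup>2" using K2 by (simp add: pos_le_divide_eq mult.commute)
    moreover have "log_pn n * 1 \<le> (log_pn n)\<^sup>2" using L unfolding power2_eq_square by (intro mult_left_mono) auto
    ultimately have "2 * log_pn n \<le> 2 * (\<delta> n * real n / (K n)\<^sup>2)" by linarith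
    also have "\<dots> = 4 * \<delta> n / 2 * (real n / (K n)\<^sup>2)" by simp
    also have "\<dots> \<le> a0 * \<epsilon> / 2 * (real n / (K n)\<^sup>2)"
      using \<delta> K2 unfolding a0_def[symmetric] by (intro mult_right_mono divide_right_mono) auto
    also have "\<dots> \<le> (a0 * \<epsilon> - a0\<^sup>2 / 2 * exp a0 * C) * (real n / (K n)\<^sup>2)"
      using 1 K2 by (intro mult_right_mono) auto
    also have "\<dots> = real n * (a * \<epsilon> - a\<^sup>2 / 2 * exp (a * (K n)\<^sup>2) * ((K n)\<^sup>2 * C))"
      unfolding a(2) using K2 by (simp add: a_def field_simps power2_eq_square)
    finally show ?thesis .
  qed
  then have "S.prob {\<omega> \<in> space (iid_sample n P). \<epsilon> \<le> \<bar>emp_mean n (\<lambda>i. g (\<omega> i))\<bar>} \<le> 2 * exp (- 2 * log_pn n)"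
    by (intro order_trans[OF ch(2)]) simp
  from S.with_prob_ge_not[OF ch(1) this] show ?thesis
  proof (rule with_prob_ge_mono)
    fix \<omega> assume "\<not> \<epsilon> \<le> \<bar>emp_mean n (\<lambda>i. g (\<omega> i))\<bar>"
    moreover have "emp_mean n (\<lambda>i. g (\<omega> i)) = emp_mean n (\<lambda>i. (f n (X (\<omega> i)) j)\<^sup>2) - ?m"
      unfolding g_def emp_mean_diff using n_pos by (simp add: emp_mean_def)
    ultimately show "\<bar>emp_mean n (\<lambda>i. (f n (X (\<omega> i)) j)\<^sup>2) - ?m\<bar> \<le> \<epsilon>" by simp
  qed simp
qed

text \<open>The infimum over covers is attained as \<open>enat\<close> is well-ordered, so the
  entropy bound at radius \<open>1 / n\<close> yields an actual net.\<close>

lemma net_exists: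
  assumes n: "1 \<le> n"
  obtains F where "finite F" "F \<subseteq> U" "\<And>u. u \<in> U \<Longrightarrow> \<exists>v\<in>F. dU u v \<le> 1 / real n"
    "real (card F) \<le> real n ^ du"
proof -
  define \<N> where "\<N> = {F. finite F \<and> F \<subseteq> U \<and> (\<forall>u\<in>U. \<exists>v\<in>F. dU u v \<le> 1 / real n)}"
  have cov: "covering_number (1 / real n) U dU = (INF F\<in>\<N>. enat (card F))"
    by (simp add: covering_number_def \<N>_def)
  have ent: "covering_number (1 / real n) U dU \<noteq> \<infinity>"
    "ln (real (the_enat (covering_number (1 / real n) U dU))) \<le> max (real du * ln (1 / (1 / real n))) 0"
    using entropy[of "1 / real n"] n by auto
  have "(\<lambda>F. enat (card F)) ` \<N> \<noteq> {}"
    using ent(1) unfolding cov by (auto simp: top_enat_def)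
  then have "(INF F\<in>\<N>. enat (card F)) \<in> (\<lambda>F. enat (card F)) ` \<N>"
    unfolding Inf_enat_def by (auto intro: LeastI)
  then obtain F where F: "F \<in> \<N>" "covering_number (1 / real n) U dU = enat (card F)"
    unfolding cov by auto
  have "real (card F) \<le> real n ^ du"
  \<comment> \<open>An empty net is treated apart: comparing logarithms requires a positive
    cardinality.\<close>
  proof (cases "card F = 0")
    case False
    have "ln (real (card F)) \<le> real du * ln (real n)"
      using ent(2) n F(2) by (simp add: max_absorb1)
    also have "\<dots> = ln (real n ^ du)" using n by (simp add: ln_realpow)
    finally show ?thesis using False n by (subst (asm) ln_le_cancel_iff) auto
  qed simp
  then show thesis using F(1) by (intro that[of F]) (auto simp: \<N>_def)
qed

end


text \<open>Each restriction on \<open>\<gamma>\<close> has its use. The upper ones give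
  \<open>\<beta> \<le> exp (- L) / 2\<close>, so the quantile is at least of order
  \<open>sqrt L\<close> and the penalty dominates the approximation error. The lower one bounds
  \<open>1 / \<beta>\<close> by a power of \<open>p \<or> n\<close>, so the quantile, hence the
  rate, is at most of order \<open>sqrt L\<close>.\<close>

lemma penalty_quantile:
  fixes n p du :: nat and \<gamma> :: real
  assumes n: "1 \<le> n" and p: "1 \<le> p"
    and \<gamma>: "1 / real n \<le> \<gamma>" "\<gamma> \<le> 1 / ln (real n)" "\<gamma> \<le> real p * real n powr (real du - 1)"
    and large: "4 \<le> ln (real n)" "1 / real n < std_normal_density 1"
  defines "\<beta> \<equiv> \<gamma> / (2 * real p * real n ^ du)" and "L \<equiv> ln (max (real p) (real n))"
  defines "x \<equiv> inv std_normal_cdf (1 - \<beta>)"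
  shows "0 < \<beta>" "exp (- (x + 1)\<^sup>2 / 2) \<le> sqrt (2 * pi) * \<beta>" "sqrt L / 2 \<le> x" "1 \<le> x"
    "x \<le> sqrt (2 * real du + 6) * sqrt L"
proof -
  define E where "E = max (real p) (real n)"
  have E: "1 \<le> E" "real p \<le> E" "real n \<le> E" using n by (auto simp: E_def)
  have L: "exp L = E" "4 \<le> L"
  proof -
    show "exp L = E" using E by (simp add: L_def E_def[symmetric])
    have "ln (real n) \<le> ln E" using E n by (subst ln_le_cancel_iff) auto
    then show "4 \<le> L" using large by (simp add: L_def E_def)
  qed
  have pn: "0 < 2 * real p * real n ^ du" using n p by simp
  have n1: "1 \<le> real n ^ du" using n by (simp add: one_le_power)
  have "0 < 1 / real n" using n by simp
  then have \<gamma>0: "0 < \<gamma>" using \<gamma>(1) by (rule less_le_trans)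
  show \<beta>0: "0 < \<beta>" using \<gamma>0 pn by (simp add: \<beta>_def)
  have \<beta>n: "\<beta> \<le> 1 / (2 * real n)"
  proof -
    have "real n powr (real du - 1) = real n ^ du / real n"
      using n by (simp add: powr_diff powr_realpow)
    then have "\<gamma> \<le> (1 / (2 * real n)) * (2 * real p * real n ^ du)" using \<gamma>(3) by simp
    then show ?thesis using pn unfolding \<beta>_def by (simp only: pos_divide_le_eq)
  qed
  have \<beta>p: "\<beta> \<le> 1 / (2 * real p)"
  proof -
    have "1 / ln (real n) \<le> 1 / 1" using large by (intro divide_left_mono) auto
    then have "\<gamma> \<le> 1" using \<gamma>(2) by linarith
    also have "\<dots> \<le> real n ^ du" by (rule n1)
    also have "\<dots> = (1 / (2 * real p)) * (2 * real p * real n ^ du)" using p by simp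
    finally show ?thesis using pn unfolding \<beta>_def by (simp only: pos_divide_le_eq)
  qed
  have \<beta>E: "\<beta> \<le> exp (- L) / 2"
    using \<beta>n \<beta>p unfolding exp_minus L(1) E_def by (auto simp: max_def inverse_eq_divide)
  have "\<beta> < std_normal_density 1"
  proof -
    have "1 / (2 * real n) \<le> 1 / real n" using n by (intro divide_left_mono) auto
    then show ?thesis using \<beta>n large(2) by linarith
  qed
  note qb = normal_quantile_bounds[OF \<beta>0 this, folded x_def]
  show 2: "exp (- (x + 1)\<^sup>2 / 2) \<le> sqrt (2 * pi) * \<beta>" by (rule qb)
  have pi_e: "sqrt (2 * pi) / 2 \<le> exp 1"
  proof -
    have "sqrt (2 * pi) \<le> sqrt (4\<^sup>2)" using pi_less_4 by (intro real_sqrt_le_mono) simp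
    then have "sqrt (2 * pi) / 2 \<le> 2" by simp
    also have "2 \<le> exp (1::real)" using exp_ge_add_one_self[of 1] by simp
    finally show ?thesis .
  qed
  have "exp (- (x + 1)\<^sup>2 / 2) \<le> sqrt (2 * pi) * (exp (- L) / 2)"
    using 2 \<beta>E by (meson mult_left_mono order_trans real_sqrt_ge_zero pi_ge_zero mult_nonneg_nonneg zero_le_numeral)
  also have "\<dots> = sqrt (2 * pi) / 2 * exp (- L)" by simp
  also have "\<dots> \<le> exp 1 * exp (- L)" using pi_e by (intro mult_right_mono) auto
  also have "\<dots> = exp (1 - L)" by (simp flip: exp_add)
  finally have "- (x + 1)\<^sup>2 / 2 \<le> 1 - L" by simp
  then have "L \<le> (x + 1)\<^sup>2" using L(2) by argo
  then have "sqrt L \<le> x + 1" using qb(1) by (simp add: real_le_lsqrt)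
  moreover have sL: "2 \<le> sqrt L" using L(2) by (simp add: real_le_rsqrt)
  ultimately show "sqrt L / 2 \<le> x" by argo
  then show "1 \<le> x" using sL by argo
  have "1 / \<beta> \<le> 2 * E ^ (du + 2)"
  proof -
    have "1 / \<beta> = 2 * real p * real n ^ du / \<gamma>" by (simp add: \<beta>_def)
    also have "\<dots> \<le> 2 * real p * real n ^ du / (1 / real n)"
      using \<gamma>(1) \<gamma>0 n pn by (intro divide_left_mono) auto
    also have "\<dots> = 2 * (real p * (real n ^ du * real n))" by simp
    also have "\<dots> \<le> 2 * (E * (E ^ du * E))"
      using E by (intro mult_left_mono mult_mono power_mono) auto
    finally show ?thesis by (simp add: power_add power2_eq_square algebra_simps)
  qed
  then have "ln (1 / \<beta>) \<le> ln (2 * E ^ (du + 2))"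
    using \<beta>0 E by (subst ln_le_cancel_iff) auto
  also have "\<dots> = ln 2 + real (du + 2) * L"
    using E by (simp add: ln_mult ln_realpow L_def E_def[symmetric] distrib_right)
  also have "\<dots> \<le> (real du + 3) * L"
    using ln_2_less_1 L(2) by (simp add: algebra_simps)
  finally have "x\<^sup>2 \<le> (2 * real du + 6) * L" using qb(2) by (simp add: algebra_simps)
  then have "x \<le> sqrt ((2 * real du + 6) * L)" by (rule real_le_rsqrt)
  then show "x \<le> sqrt (2 * real du + 6) * sqrt L" by (simp only: real_sqrt_mult)
qed

section \<open>The event on which the deterministic bounds apply\<close>

context assumption_G
begin

text \<open>Membership in the sample space over \<open>W\<close> belongs to the event because the
  estimators are specified for such samples; it is the same space for all laws
  \<open>P\<close>.\<close>

definition sample_regular :: "nat \<Rightarrow> 'w measure \<Rightarrow> (nat \<Rightarrow> 'w) \<Rightarrow> bool" where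
  "sample_regular n P \<omega> \<longleftrightarrow> \<omega> \<in> space (iid_sample n W) \<and>
    (\<forall>i<n. (\<forall>u\<in>U. cl \<le> reg n P u (X (\<omega> i)) \<and> reg n P u (X (\<omega> i)) \<le> 1 - cl \<and> \<bar>r n P u (X (\<omega> i))\<bar> \<le> \<delta> n) \<and>
      (\<forall>j<p n. \<bar>f n (X (\<omega> i)) j\<bar> \<le> K n))"

definition empirical_regular :: "nat \<Rightarrow> 'w measure \<Rightarrow> (nat \<Rightarrow> 'w) \<Rightarrow> bool" where
  "empirical_regular n P \<omega> \<longleftrightarrow>
    (\<forall>u\<in>U. emp_mean n (\<lambda>i. (r n P u (X (\<omega> i)))\<^sup>2) \<le> C * real (s n) * log_pn n / real n) \<and>
    (\<forall>u\<in>U. \<forall>j<p n. \<bar>emp_mean n (\<lambda>i. (f n (X (\<omega> i)) j)\<^sup>2 * (\<zeta> n P u (\<omega> i))\<^sup>2) - (sd n P u j)\<^sup>2\<bar> \<le> \<delta> n) \<and>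
    (\<forall>u\<in>U. \<forall>v\<in>U. dU u v \<le> 1 / real n \<longrightarrow> (\<forall>j<p n.
       sqrt (emp_mean n (\<lambda>i. (f n (X (\<omega> i)) j)\<^sup>2 * (\<zeta> n P u (\<omega> i) - \<zeta> n P v (\<omega> i))\<^sup>2)) \<le> \<delta> n)) \<and>
    (\<forall>u\<in>U. \<forall>v\<in>U. dU u v \<le> 1 / real n \<longrightarrow> (\<forall>j<p n.
       \<bar>emp_mean n (\<lambda>i. f n (X (\<omega> i)) j * (\<zeta> n P u (\<omega> i) - \<zeta> n P v (\<omega> i)))\<bar> \<le> \<delta> n * real n powr (- 1 / 2)))"

definition eigen_regular :: "nat \<Rightarrow> (nat \<Rightarrow> 'w) \<Rightarrow> bool" where
  "eigen_regular n \<omega> \<longleftrightarrow>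
    (\<forall>v. real (norm_l0 (p n) v) \<le> real (s n) * ln (real n) \<and> norm_l2 (p n) v = 1 \<longrightarrow>
      \<kappa>1 \<le> emp_norm2 n (\<lambda>i. dotp (p n) (f n (X (\<omega> i))) v) \<and>
      emp_norm2 n (\<lambda>i. dotp (p n) (f n (X (\<omega> i))) v) \<le> \<kappa>2)"

definition moments_regular :: "nat \<Rightarrow> 'w measure \<Rightarrow> real \<Rightarrow> (nat \<Rightarrow> 'w) \<Rightarrow> bool" where
  "moments_regular n P \<epsilon> \<omega> \<longleftrightarrow> (\<forall>j<p n.
    \<bar>emp_mean n (\<lambda>i. (f n (X (\<omega> i)) j)\<^sup>2) - (\<integral>w. (f n (X w) j)\<^sup>2 \<partial>P)\<bar> \<le> \<epsilon>)"

text \<open>The nearby point \<open>v\<close> is left existential: the net enters the proof that the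
  event is likely, but not the event.\<close>

definition noise_regular :: "nat \<Rightarrow> 'w measure \<Rightarrow> real \<Rightarrow> (nat \<Rightarrow> 'w) \<Rightarrow> bool" where
  "noise_regular n P b \<omega> \<longleftrightarrow> (\<forall>u\<in>U. \<exists>v\<in>U. dU u v \<le> 1 / real n \<and> (\<forall>j<p n.
    \<bar>emp_mean n (\<lambda>i. f n (X (\<omega> i)) j * \<zeta> n P v (\<omega> i))\<bar> \<le> b * sd n P v j / sqrt (real n)))"

text \<open>The error terms: \<open>\<Delta> n\<close> for each of the two assumed events,
  \<open>2 / n\<close> for the second moments, and for the score at most \<open>n ^ du * p n\<close>
  applications of \<open>noise_tail\<close>, which cost \<open>tail_const c1 / ln n\<close> by the
  condition on \<open>\<beta>\<close>. The almost sure bounds cost nothing.\<close>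

lemma regular_whp:
  assumes n: "n \<ge> n\<^sub>0" and P: "P \<in> \<P> n" and p: "1 \<le> p n"
    and c1: "1 < c1" and x: "0 \<le> x" "exp (- (x + 1)\<^sup>2 / 2) \<le> sqrt (2 * pi) * \<beta>"
    and \<beta>: "0 \<le> \<beta>" "2 * real (p n) * real n ^ du * \<beta> \<le> 1 / ln (real n)"
    and small: "c1 * x * K n / (sd_min * sqrt (real n)) \<le> chernoff_slack c1"
    and \<epsilon>: "0 < \<epsilon>" and \<delta>: "4 * \<delta> n \<le> min 1 (\<epsilon> / (C * exp 1)) * \<epsilon>" and L: "1 \<le> log_pn n"
  shows "with_prob_ge (iid_sample n P) (1 - (2 * \<Delta> n + 2 / real n + tail_const c1 / ln (real n)))
    (\<lambda>\<omega>. sample_regular n P \<omega> \<and> empirical_regular n P \<omega> \<and> eigen_regular n \<omega> \<and>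
      moments_regular n P \<epsilon> \<omega> \<and> noise_regular n P (c1 * x) \<omega>)"
proof -
  interpret prob_space P by (rule sample_facts[OF n P])
  interpret S: prob_space "iid_sample n P" by (intro prob_space_iid_sample prob_space_axioms)
  have n1: "1 \<le> n" using n n0 by simp
  have spS: "space (iid_sample n P) = space (iid_sample n W)"
    using sample_facts(2)[OF n P] by (simp add: iid_sample_def space_PiM)
  have 1: "with_prob_ge (iid_sample n P) (1 - 0) (sample_regular n P)"
  proof (rule S.with_prob_ge_AE)
    have "AE w in P. (\<forall>u\<in>U. cl \<le> reg n P u (X w) \<and> reg n P u (X w) \<le> 1 - cl \<and> \<bar>r n P u (X w)\<bar> \<le> \<delta> n) \<and>
      (\<forall>j<p n. \<bar>f n (X w) j\<bar> \<le> K n)"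
      using non_degenerate[OF n P] approx_error[OF n P] bounded[OF n P] by eventually_elim auto
    from AE_iid_sample[OF prob_space_axioms this, of n] AE_space[of "iid_sample n P"]
    show "AE \<omega> in iid_sample n P. sample_regular n P \<omega>"
      unfolding spS by eventually_elim (auto simp: sample_regular_def)
  qed
  have 2: "with_prob_ge (iid_sample n P) (1 - \<Delta> n) (empirical_regular n P)"
    by (rule with_prob_ge_mono[OF empirical[OF n P] order_refl])
      (auto simp: empirical_regular_def log_pn_def sd_bounds(2)[OF n P])
  have 3: "with_prob_ge (iid_sample n P) (1 - \<Delta> n) (eigen_regular n)"
    by (rule with_prob_ge_mono[OF sparse_eigenvalues[OF n P] order_refl]) (simp add: eigen_regular_def)
  have 4: "with_prob_ge (iid_sample n P) (1 - 2 / real n) (moments_regular n P \<epsilon>)"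
  proof (rule with_prob_ge_mono)
    show "with_prob_ge (iid_sample n P) (1 - real (card {..<p n}) * (2 * exp (- 2 * log_pn n))) (\<lambda>\<omega>. \<forall>j\<in>{..<p n}.
        \<bar>emp_mean n (\<lambda>i. (f n (X (\<omega> i)) j)\<^sup>2) - (\<integral>w. (f n (X w) j)\<^sup>2 \<partial>P)\<bar> \<le> \<epsilon>)"
      by (intro S.with_prob_ge_ball second_moment_tail n P \<epsilon> \<delta> L) auto
    let ?m = "max (real (p n)) (real n)"
    have E: "exp (log_pn n) = ?m" using n1 by (simp add: log_pn_def)
    have pos: "0 < ?m" using n1 by simp
    have "exp (- 2 * log_pn n) = 1 / (?m * ?m)"
    proof -
      have "exp (- 2 * log_pn n) = exp (- log_pn n) * exp (- log_pn n)" by (simp flip: exp_add)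
      then show ?thesis by (simp add: exp_minus E inverse_eq_divide)
    qed
    \<comment> \<open>One factor of the maximum cancels \<open>p n\<close>, the other leaves
      \<open>1 / n\<close>.\<close>
    then have "real (p n) * (2 * exp (- 2 * log_pn n)) = 2 * (real (p n) / ?m) * (1 / ?m)"
      by simp
    also have "\<dots> \<le> 2 * 1 * (1 / real n)"
      using pos n1 by (intro mult_mono mult_left_mono divide_left_mono) auto
    finally show "1 - 2 / real n \<le> 1 - real (card {..<p n}) * (2 * exp (- 2 * log_pn n))" by simp
  qed (auto simp: moments_regular_def)
  have 5: "with_prob_ge (iid_sample n P) (1 - tail_const c1 / ln (real n)) (noise_regular n P (c1 * x))"
  proof -
    obtain F where F: "finite F" "F \<subseteq> U" "\<And>u. u \<in> U \<Longrightarrow> \<exists>v\<in>F. dU u v \<le> 1 / real n"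
      "real (card F) \<le> real n ^ du" using net_exists[OF n1] by metis
    have tc: "0 \<le> tail_const c1" by (simp add: tail_const_def)
    show ?thesis
    proof (rule with_prob_ge_mono)
      show "with_prob_ge (iid_sample n P) (1 - real (card (F \<times> {..<p n})) * (2 * tail_const c1 * \<beta>)) (\<lambda>\<omega>. \<forall>a\<in>F \<times> {..<p n}.
        (case a of (u, j) \<Rightarrow> \<bar>emp_mean n (\<lambda>i. f n (X (\<omega> i)) j * \<zeta> n P u (\<omega> i))\<bar> \<le> c1 * x * sd n P u j / sqrt (real n)))"
      proof (rule S.with_prob_ge_ball)
        fix a assume "a \<in> F \<times> {..<p n}"
        then obtain u j where a: "a = (u, j)" "u \<in> U" "j < p n" using F(2) by auto
        show "with_prob_ge (iid_sample n P) (1 - 2 * tail_const c1 * \<beta>) (\<lambda>\<omega>.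
          (case a of (u, j) \<Rightarrow> \<bar>emp_mean n (\<lambda>i. f n (X (\<omega> i)) j * \<zeta> n P u (\<omega> i))\<bar> \<le> c1 * x * sd n P u j / sqrt (real n)))"
          unfolding a(1) prod.case by (rule noise_tail[OF n P a(2,3) c1 x small])
      qed (use F in auto)
      have "real (card (F \<times> {..<p n})) * (2 * tail_const c1 * \<beta>) = real (card F) * (real (p n) * (2 * tail_const c1 * \<beta>))"
        by (simp add: card_cartesian_product)
      also have "\<dots> \<le> real n ^ du * (real (p n) * (2 * tail_const c1 * \<beta>))"
        using F(4) tc \<beta> by (intro mult_right_mono) auto
      also have "\<dots> = tail_const c1 * (2 * real (p n) * real n ^ du * \<beta>)" by (simp only: ac_simps)
      also have "\<dots> \<le> tail_const c1 * (1 / ln (real n))" using \<beta>(2) tc by (rule mult_left_mono)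
      finally show "1 - tail_const c1 / ln (real n) \<le> 1 - real (card (F \<times> {..<p n})) * (2 * tail_const c1 * \<beta>)" by simp
    next
      fix \<omega> assume *: "\<forall>a\<in>F \<times> {..<p n}. (case a of (u, j) \<Rightarrow>
        \<bar>emp_mean n (\<lambda>i. f n (X (\<omega> i)) j * \<zeta> n P u (\<omega> i))\<bar> \<le> c1 * x * sd n P u j / sqrt (real n))"
      show "noise_regular n P (c1 * x) \<omega>"
        unfolding noise_regular_def
      proof
        fix u assume "u \<in> U"
        then obtain v where v: "v \<in> F" "dU u v \<le> 1 / real n" using F(3) by blast
        then show "\<exists>v\<in>U. dU u v \<le> 1 / real n \<and> (\<forall>j<p n.
          \<bar>emp_mean n (\<lambda>i. f n (X (\<omega> i)) j * \<zeta> n P v (\<omega> i))\<bar> \<le> c1 * x * sd n P v j / sqrt (real n))"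
          using * F(2) by (intro bexI[of _ v]) auto
      qed
    qed
  qed
  from S.with_prob_ge_conj[OF 1 S.with_prob_ge_conj[OF 2 S.with_prob_ge_conj[OF 3 S.with_prob_ge_conj[OF 4 5]]]]
  show ?thesis by (rule with_prob_ge_mono) auto
qed

end


text \<open>The difference is at most \<open>sqrt a + b\<close>, so its square is at most
  \<open>\<bar>a - b\<^sup>2\<bar>\<close>; the modulus \<open>sqrt d\<close> does not depend on how
  small \<open>b\<close> is.\<close>

lemma abs_sqrt_diff_le:
  assumes "0 \<le> a" "0 \<le> b" "\<bar>a - b\<^sup>2\<bar> \<le> d"
  shows "\<bar>sqrt a - b\<bar> \<le> sqrt d"
proof -
  have "\<bar>sqrt a - b\<bar> * \<bar>sqrt a - b\<bar> \<le> \<bar>sqrt a - b\<bar> * \<bar>sqrt a + b\<bar>"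
    using real_sqrt_ge_zero[OF assms(1)] assms(2) by (intro mult_left_mono, linarith, simp)
  also have "\<dots> = \<bar>a - b\<^sup>2\<bar>"
    unfolding abs_mult[symmetric] using assms by (simp add: power2_eq_square algebra_simps)
  finally have "\<bar>sqrt a - b\<bar>\<^sup>2 \<le> d" using assms(3) by (simp add: power2_eq_square)
  then show ?thesis by (rule real_le_rsqrt)
qed

section \<open>Rates for the algorithm\<close>

locale penalised_logit = assumption_G W XS U du dU X Y \<P> p f \<theta> r s K \<delta> \<Delta> n\<^sub>0 c C cl \<kappa>1 \<kappa>2
  for W :: "'w measure" and XS :: "'x measure"
    and U du dU X Y \<P> p f \<theta> r s K \<delta> \<Delta> n\<^sub>0 c C cl \<kappa>1 \<kappa>2 +
  fixes \<gamma> :: "nat \<Rightarrow> real" and c_pen :: real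
  assumes slack: "1 < c_pen"
    and gamma: "\<And>n. n \<ge> n\<^sub>0 \<Longrightarrow> 1 / real n \<le> \<gamma> n \<and>
      \<gamma> n \<le> min (1 / ln (real n)) (real (p n) * real n powr (real du - 1))"
begin

text \<open>The slack \<open>c_pen\<close> is shared out: a factor \<open>1 + \<epsilon>\<close> for the Chernoff bound, \<open>\<epsilon>\<close> for the
  discretisation of \<open>U\<close>, a factor \<open>1 - \<epsilon>\<close> for the estimation of the loadings, and what is left
  makes \<open>noise_ratio\<close> smaller than one.\<close>

definition \<epsilon> :: real where "\<epsilon> = (c_pen - 1) / (8 + 2 * (c_pen - 1))"
definition noise_ratio :: real where "noise_ratio = (1 + 2 * \<epsilon>) / ((1 - \<epsilon>) * c_pen)"
text \<open>Initial loadings stay below \<open>sqrt C\<close>, ideal ones below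
  \<open>sqrt C / 2\<close> plus a margin, whence \<open>hi\<close>. \<open>R\<close> compares the
  approximation error \<open>sqrt (C * s * log_pn n / n)\<close> with \<open>sqrt s * \<mu>\<close>
  through \<open>sqrt (log_pn n) \<le> 2 * quant n\<close>. \<open>w\<close> is valid once
  \<open>\<bar>r\<bar> \<le> cl / 2\<close>, when the logistic values lie between
  \<open>cl / 2\<close> and \<open>1 - cl / 2\<close>.\<close>

definition lo :: real where "lo = (1 - \<epsilon>) * sd_min"
definition hi :: real where "hi = sqrt C + sd_min"
definition R :: real where "R = 2 * sqrt C / c_pen"
definition w :: real where "w = cl / 2 * (1 - cl / 2)"

lemma eps: "0 < \<epsilon>" "\<epsilon> < 1 / 2" "0 < noise_ratio" "noise_ratio < 1" "noise_ratio * c_pen * (1 - \<epsilon>) = 1 + 2 * \<epsilon>"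
proof -
  have den: "0 < 8 + 2 * (c_pen - 1)" using slack by simp
  show e: "0 < \<epsilon>" "\<epsilon> < 1 / 2" using slack den by (auto simp: \<epsilon>_def field_simps)
  \<comment> \<open>In terms of \<open>d = c_pen - 1\<close> the claim
    \<open>1 + 2 * \<epsilon> < (1 - \<epsilon>) * c_pen\<close> is
    \<open>\<epsilon> * (3 + d) < d\<close>, and
    \<open>\<epsilon> * (8 + 2 * d) = d\<close>.\<close>
  have "\<epsilon> * (8 + 2 * (c_pen - 1)) = c_pen - 1" using den by (simp add: \<epsilon>_def)
  then have "1 + 2 * \<epsilon> < (1 - \<epsilon>) * c_pen" using e slack by (simp add: algebra_simps)
  then show "noise_ratio < 1" "0 < noise_ratio" using e slack by (auto simp: noise_ratio_def)
  show "noise_ratio * c_pen * (1 - \<epsilon>) = 1 + 2 * \<epsilon>" using e slack by (simp add: noise_ratio_def)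
qed

sublocale lasso_constants noise_ratio lo hi R \<kappa>1 \<kappa>2 w
proof
  show "0 \<le> noise_ratio" "noise_ratio < 1" using eps by auto
  show "0 < lo" using eps sd_min_pos by (simp add: lo_def)
  have "lo \<le> 1 * sd_min" unfolding lo_def using eps sd_min_pos by (intro mult_right_mono) auto
  moreover have "0 \<le> sqrt C" using constants by simp
  ultimately show "lo \<le> hi" unfolding hi_def by linarith
  show "0 \<le> R" using constants slack by (simp add: R_def)
  show "0 < \<kappa>1" "0 < \<kappa>2" using constants by auto
  show "0 < w" using constants by (simp add: w_def)
qed

text \<open>Free of \<open>n\<close>, so that \<open>s + M * s\<close> drops below
  \<open>s * ln n\<close> for large \<open>n\<close>; this is why sparse eigenvalues of that order
  suffice.\<close>

definition M :: nat where "M = nat \<lceil>(2 * \<kappa>2 * ratio / \<kappa>1)\<^sup>2 + support_factor + 2\<rceil>"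

lemma M_bounds: "\<kappa>2 * ratio \<le> \<kappa>1 / 2 * sqrt (real M)" "support_factor + 1 < real M"
proof -
  have M: "(2 * \<kappa>2 * ratio / \<kappa>1)\<^sup>2 + support_factor + 2 \<le> real M" unfolding M_def by linarith
  have sq: "0 \<le> (2 * \<kappa>2 * ratio / \<kappa>1)\<^sup>2" by simp
  show "support_factor + 1 < real M" using M sq by linarith
  have "(2 * \<kappa>2 * ratio / \<kappa>1)\<^sup>2 \<le> real M" using M constants_nonneg(6) by linarith
  then have "2 * \<kappa>2 * ratio / \<kappa>1 \<le> sqrt (real M)" by (rule real_le_rsqrt)
  then show "\<kappa>2 * ratio \<le> \<kappa>1 / 2 * sqrt (real M)" using constants by (simp add: field_simps)
qed

definition \<beta> :: "nat \<Rightarrow> real" where "\<beta> n = \<gamma> n / (2 * real (p n) * real n ^ du)"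
definition quant :: "nat \<Rightarrow> real" where "quant n = inv std_normal_cdf (1 - \<beta> n)"
definition \<mu> :: "nat \<Rightarrow> real" where "\<mu> n = c_pen * quant n / sqrt (real n)"
definition quant_const :: real where "quant_const = sqrt (2 * real du + 6)"

text \<open>One threshold per requirement on \<open>\<delta> n\<close>, squared where
  \<open>sqrt (\<delta> n)\<close> is what occurs: curvature at the truth; errors in the score and
  the ideal loadings (two entries); the Chernoff tilt; second moments; predictions within 1 for
  Lasso and for Post-Lasso; updated loadings. The added 1 keeps the denominators positive.\<close>

definition \<delta>_bounds :: "real set" where
  "\<delta>_bounds = {cl / 2, (\<epsilon> * sd_min / 10)\<^sup>2, \<epsilon> * sd_min / 10,
     (chernoff_slack (1 + \<epsilon>) * sd_min / ((1 + \<epsilon>) * quant_const))\<^sup>2,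
     min 1 (\<epsilon> * c / (C * exp 1)) * (\<epsilon> * c) / 4,
     (1 / (c_pen * quant_const * (cone * rate + 1)))\<^sup>2,
     (1 / (c_pen * quant_const * (post_cone * post_rate + 1)))\<^sup>2,
     (\<epsilon> * sd_min / 2 / (c_pen * quant_const * (post_rate + R + 1)))\<^sup>2}"

definition \<delta>_max :: real where "\<delta>_max = Min \<delta>_bounds"

definition large :: "nat \<Rightarrow> bool" where
  "large n \<longleftrightarrow> n\<^sub>0 \<le> n \<and> 4 \<le> ln (real n) \<and> 1 + real M \<le> ln (real n) \<and>
     1 / real n < std_normal_density 1 \<and> \<delta> n \<le> \<delta>_max"

lemma quant_const_pos: "0 < quant_const"
  by (simp add: quant_const_def add_nonneg_pos)

lemma \<delta>_max_pos: "0 < \<delta>_max"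
proof -
  have "0 < chernoff_slack (1 + \<epsilon>)" using eps by (intro chernoff_slack_pos) simp
  moreover have "0 < cone * rate + 1" "0 < post_cone * post_rate + 1"
    using constants_nonneg by (auto intro: add_nonneg_pos)
  ultimately show ?thesis
    unfolding \<delta>_max_def \<delta>_bounds_def
    using constants eps sd_min_pos quant_const_pos slack constants_nonneg R0
    by (subst Min_gr_iff) (auto intro!: divide_pos_pos mult_pos_pos add_nonneg_pos zero_less_power)
qed

lemma large_\<delta>: "large n \<Longrightarrow> \<delta> n \<le> \<delta>_max"
  by (simp add: large_def)

lemma \<delta>_max_le:
  assumes "d \<le> \<delta>_max"
  shows "d \<le> cl / 2" "sqrt d \<le> \<epsilon> * sd_min / 10" "d \<le> \<epsilon> * sd_min / 10"
    "sqrt d \<le> chernoff_slack (1 + \<epsilon>) * sd_min / ((1 + \<epsilon>) * quant_const)"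
    "4 * d \<le> min 1 (\<epsilon> * c / (C * exp 1)) * (\<epsilon> * c)"
    "sqrt d \<le> 1 / (c_pen * quant_const * (cone * rate + 1))"
    "sqrt d \<le> 1 / (c_pen * quant_const * (post_cone * post_rate + 1))"
    "sqrt d \<le> \<epsilon> * sd_min / 2 / (c_pen * quant_const * (post_rate + R + 1))"
proof -
  have all: "d \<le> e" if "e \<in> \<delta>_bounds" for e
  proof -
    have "finite \<delta>_bounds" by (simp add: \<delta>_bounds_def)
    then have "\<delta>_max \<le> e" unfolding \<delta>_max_def using that by (rule Min_le)
    then show ?thesis using assms by (rule order_trans[rotated])
  qed
  have root: "sqrt d \<le> e" if "e\<^sup>2 \<in> \<delta>_bounds" "0 \<le> e" for e
    using that by (intro real_le_lsqrt all)
  have "0 < chernoff_slack (1 + \<epsilon>)" using eps by (intro chernoff_slack_pos) simp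
  note pos = this constants eps sd_min_pos quant_const_pos slack constants_nonneg R0
  show "d \<le> cl / 2" "d \<le> \<epsilon> * sd_min / 10"
    by (rule all, unfold \<delta>_bounds_def, blast)+
  have "d \<le> min 1 (\<epsilon> * c / (C * exp 1)) * (\<epsilon> * c) / 4"
    by (rule all, unfold \<delta>_bounds_def, blast)
  then show "4 * d \<le> min 1 (\<epsilon> * c / (C * exp 1)) * (\<epsilon> * c)" by argo
  show "sqrt d \<le> \<epsilon> * sd_min / 10"
    "sqrt d \<le> chernoff_slack (1 + \<epsilon>) * sd_min / ((1 + \<epsilon>) * quant_const)"
    "sqrt d \<le> 1 / (c_pen * quant_const * (cone * rate + 1))"
    "sqrt d \<le> 1 / (c_pen * quant_const * (post_cone * post_rate + 1))"
    by (rule root, unfold \<delta>_bounds_def, blast,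
        use pos in \<open>intro divide_nonneg_nonneg mult_nonneg_nonneg add_nonneg_nonneg, auto\<close>)+
  show "sqrt d \<le> \<epsilon> * sd_min / 2 / (c_pen * quant_const * (post_rate + R + 1))"
    by (rule root, unfold \<delta>_bounds_def, blast,
        use pos in \<open>intro divide_nonneg_nonneg mult_nonneg_nonneg add_nonneg_nonneg, auto\<close>)
qed

lemma eventually_large: "\<forall>\<^sub>F n in sequentially. large n"
proof -
  have d: "\<forall>\<^sub>F n in sequentially. \<delta> n < \<delta>_max"
    using null_sequences \<delta>_max_pos unfolding poly_slow_null_def by (intro order_tendstoD) auto
  have l: "\<forall>\<^sub>F n in sequentially. b \<le> ln (real n)" for b
    by (rule filterlim_at_top[THEN iffD1, rule_format,
        OF filterlim_compose[OF ln_at_top filterlim_real_sequentially]])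
  have "(\<lambda>n. 1 / real n) \<longlonglongrightarrow> 0" by (rule lim_1_over_n)
  then have q: "\<forall>\<^sub>F n in sequentially. 1 / real n < std_normal_density 1"
    by (rule order_tendstoD) (simp add: normal_density_pos)
  show ?thesis
    using d l[of 4] l[of "1 + real M"] q eventually_ge_at_top[of n\<^sub>0]
    by eventually_elim (simp add: large_def)
qed

text \<open>\<open>\<gamma> n\<close> is squeezed between \<open>1 / n\<close> and a multiple of
  \<open>p n\<close>.\<close>

lemma p_pos:
  assumes "n\<^sub>0 \<le> n"
  shows "1 \<le> p n"
proof (rule ccontr)
  assume "\<not> 1 \<le> p n"
  then have "p n = 0" by simp
  then have "\<gamma> n \<le> 0" using gamma[OF assms] by simp
  moreover have "0 < 1 / real n" using assms n0 by simp
  ultimately show False using gamma[OF assms] by linarith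
qed

lemma large_facts:
  assumes "large n"
  shows "n\<^sub>0 \<le> n" "1 \<le> n" "4 \<le> ln (real n)" "4 \<le> log_pn n" "0 \<le> \<delta> n"
    "0 < \<beta> n" "exp (- (quant n + 1)\<^sup>2 / 2) \<le> sqrt (2 * pi) * \<beta> n" "sqrt (log_pn n) / 2 \<le> quant n"
    "1 \<le> quant n" "quant n \<le> quant_const * sqrt (log_pn n)" "0 < \<mu> n"
    "2 * real (p n) * real n ^ du * \<beta> n \<le> 1 / ln (real n)"
proof -
  show n: "n\<^sub>0 \<le> n" and l: "4 \<le> ln (real n)" using assms by (auto simp: large_def)
  show n1: "1 \<le> n" using n n0 by simp
  note g = gamma[OF n]
  have "ln (real n) \<le> log_pn n" unfolding log_pn_def using n1 by (subst ln_le_cancel_iff) auto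
  then show "4 \<le> log_pn n" using l by linarith
  show "0 \<le> \<delta> n" using null_sequences(1) decseq_ge unfolding poly_slow_null_def by blast
  note pq = penalty_quantile[OF n1 p_pos[OF n], of "\<gamma> n" du, folded \<beta>_def quant_def log_pn_def quant_const_def]
  have h: "1 / real n \<le> \<gamma> n" "\<gamma> n \<le> 1 / ln (real n)" "\<gamma> n \<le> real (p n) * real n powr (real du - 1)"
    "4 \<le> ln (real n)" "1 / real n < std_normal_density 1"
    using g assms by (auto simp: large_def)
  show "0 < \<beta> n" "exp (- (quant n + 1)\<^sup>2 / 2) \<le> sqrt (2 * pi) * \<beta> n" "sqrt (log_pn n) / 2 \<le> quant n"
    "quant n \<le> quant_const * sqrt (log_pn n)" using pq[OF h] by auto
  show q1: "1 \<le> quant n" using pq[OF h] by auto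
  then show "0 < \<mu> n" using slack n1 by (simp add: \<mu>_def)
  show "2 * real (p n) * real n ^ du * \<beta> n \<le> 1 / ln (real n)"
    using h(2) n1 p_pos[OF n] by (simp add: \<beta>_def)
qed

text \<open>Up to constants \<open>K s \<mu>\<close> is at most the square root of \<open>K\<^sup>2 s\<^sup>2 log\<^sup>2 (p \<or> n) / n\<close>.\<close>

lemma K_s_mu_le:
  assumes l: "large n" and K0: "0 \<le> K n"
  shows "K n * real (s n) * (sqrt (log_pn n) / sqrt (real n)) \<le> sqrt (\<delta> n)"
    and "K n * (sqrt (log_pn n) / sqrt (real n)) \<le> sqrt (\<delta> n)"
    and "K n * real (s n) * \<mu> n \<le> c_pen * quant_const * sqrt (\<delta> n)"
proof -
  note F = large_facts[OF l]
  have np: "0 < real n" using F(2) by simp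
  have L1: "1 \<le> log_pn n" using F(4) by linarith
  have "log_pn n * 1 \<le> (log_pn n)\<^sup>2" using L1 unfolding power2_eq_square by (intro mult_left_mono) auto
  then have "(K n)\<^sup>2 * (real (s n))\<^sup>2 * log_pn n \<le> (K n)\<^sup>2 * (real (s n))\<^sup>2 * (log_pn n)\<^sup>2"
    by (intro mult_left_mono) auto
  also have "\<dots> \<le> \<delta> n * real n" using growth[OF F(1)] by (simp add: log_pn_def)
  finally have "(K n)\<^sup>2 * (real (s n))\<^sup>2 * log_pn n / real n \<le> \<delta> n"
    using np by (simp add: pos_divide_le_eq)
  moreover have "(K n * real (s n) * (sqrt (log_pn n) / sqrt (real n)))\<^sup>2 = (K n)\<^sup>2 * (real (s n))\<^sup>2 * log_pn n / real n"
    using L1 by (simp add: power_mult_distrib power_divide)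
  ultimately show 1: "K n * real (s n) * (sqrt (log_pn n) / sqrt (real n)) \<le> sqrt (\<delta> n)"
    by (intro real_le_rsqrt) simp
  have "K n * 1 * (sqrt (log_pn n) / sqrt (real n)) \<le> K n * real (s n) * (sqrt (log_pn n) / sqrt (real n))"
    using K0 s_pos[OF F(1)] L1 by (intro mult_right_mono mult_left_mono) auto
  then show "K n * (sqrt (log_pn n) / sqrt (real n)) \<le> sqrt (\<delta> n)" using 1 by simp
  have "\<mu> n \<le> c_pen * (quant_const * sqrt (log_pn n)) / sqrt (real n)"
    unfolding \<mu>_def using F(10) slack by (intro divide_right_mono mult_left_mono) auto
  then have "K n * real (s n) * \<mu> n \<le> K n * real (s n) * (c_pen * (quant_const * sqrt (log_pn n)) / sqrt (real n))"
    using K0 by (intro mult_left_mono) auto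
  also have "\<dots> = c_pen * quant_const * (K n * real (s n) * (sqrt (log_pn n) / sqrt (real n)))"
    by simp
  also have "\<dots> \<le> c_pen * quant_const * sqrt (\<delta> n)"
    using 1 slack quant_const_pos by (intro mult_left_mono) auto
  finally show "K n * real (s n) * \<mu> n \<le> c_pen * quant_const * sqrt (\<delta> n)" .
qed

lemma K_s_mu_small:
  assumes l: "large n" and K0: "0 \<le> K n" and a: "0 \<le> a"
    and d: "sqrt (\<delta> n) \<le> e / (c_pen * quant_const * (a + 1))"
  shows "a * (K n * real (s n) * \<mu> n) \<le> e"
proof -
  have pos: "0 < c_pen * quant_const * (a + 1)"
    using a slack quant_const_pos by (intro mult_pos_pos add_nonneg_pos) auto
  have "a * (K n * real (s n) * \<mu> n) \<le> a * (c_pen * quant_const * sqrt (\<delta> n))"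
    using a K_s_mu_le(3)[OF l K0] by (intro mult_left_mono) auto
  also have "\<dots> \<le> (a + 1) * (c_pen * quant_const * sqrt (\<delta> n))"
    using slack quant_const_pos large_facts(5)[OF l] by (intro mult_right_mono) auto
  also have "\<dots> = sqrt (\<delta> n) * (c_pen * quant_const * (a + 1))" by (simp only: ac_simps)
  also have "\<dots> \<le> e" using d pos by (simp only: pos_le_divide_eq)
  finally show ?thesis .
qed

definition regular :: "nat \<Rightarrow> 'w measure \<Rightarrow> (nat \<Rightarrow> 'w) \<Rightarrow> bool" where
  "regular n P \<omega> \<longleftrightarrow> sample_regular n P \<omega> \<and> empirical_regular n P \<omega> \<and> eigen_regular n \<omega> \<and>
      moments_regular n P (\<epsilon> * c) \<omega> \<and> noise_regular n P ((1 + \<epsilon>) * quant n) \<omega>"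

lemma with_prob_ge_regular:
  assumes l: "large n" and P: "P \<in> \<P> n"
  shows "with_prob_ge (iid_sample n P) (1 - (2 * \<Delta> n + 2 / real n + tail_const (1 + \<epsilon>) / ln (real n))) (regular n P)"
proof -
  note F = large_facts[OF l] and D = \<delta>_max_le[OF large_\<delta>[OF l]]
  have K0: "0 \<le> K n" using K_lower(1)[OF F(1) P] p_pos[OF F(1)] by simp
  have "(1 + \<epsilon>) * quant n * K n / (sd_min * sqrt (real n)) \<le>
      (1 + \<epsilon>) * (quant_const * sqrt (log_pn n)) * K n / (sd_min * sqrt (real n))"
    using F(10) eps K0 sd_min_pos by (intro divide_right_mono mult_right_mono mult_left_mono) auto
  also have "\<dots> = (1 + \<epsilon>) * quant_const / sd_min * (K n * (sqrt (log_pn n) / sqrt (real n)))" by simp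
  also have "\<dots> \<le> (1 + \<epsilon>) * quant_const / sd_min * (chernoff_slack (1 + \<epsilon>) * sd_min / ((1 + \<epsilon>) * quant_const))"
    using K_s_mu_le(2)[OF l K0] D(4) eps quant_const_pos sd_min_pos
    by (intro mult_left_mono order_trans[OF K_s_mu_le(2)[OF l K0] D(4)]) auto
  also have "\<dots> = chernoff_slack (1 + \<epsilon>)"
    using eps quant_const_pos sd_min_pos by simp
  finally have small: "(1 + \<epsilon>) * quant n * K n / (sd_min * sqrt (real n)) \<le> chernoff_slack (1 + \<epsilon>)" .
  have ec: "0 < \<epsilon> * c" using eps constants by simp
  have "with_prob_ge (iid_sample n P) (1 - (2 * \<Delta> n + 2 / real n + tail_const (1 + \<epsilon>) / ln (real n)))
    (\<lambda>\<omega>. sample_regular n P \<omega> \<and> empirical_regular n P \<omega> \<and> eigen_regular n \<omega> \<and>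
      moments_regular n P (\<epsilon> * c) \<omega> \<and> noise_regular n P ((1 + \<epsilon>) * quant n) \<omega>)"
    using F eps small ec D(5) by (intro regular_whp[OF F(1) P p_pos[OF F(1)], where \<beta> = "\<beta> n"]) auto
  then show ?thesis by (rule with_prob_ge_mono) (auto simp: regular_def)
qed

end


context assumption_G
begin

text \<open>Passing from the net point \<open>v\<close> to \<open>u\<close> costs
  \<open>\<delta> n / sqrt n\<close> in the score. The population values \<open>sd\<close> at
  \<open>u\<close> and \<open>v\<close> are compared through their empirical counterparts, where
  continuity in \<open>u\<close> is assumed: two errors \<open>sqrt (\<delta> n)\<close> and one
  \<open>\<delta> n\<close>.\<close>

lemma noise_regular_score:
  assumes \<omega>: "noise_regular n P b \<omega>" "empirical_regular n P \<omega>" and u: "u \<in> U" and j: "j < p n"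
    and b: "0 \<le> b" and d: "0 \<le> \<delta> n"
  shows "\<bar>emp_mean n (\<lambda>i. f n (X (\<omega> i)) j * \<zeta> n P u (\<omega> i))\<bar>
    \<le> (b * (sd n P u j + (2 * sqrt (\<delta> n) + \<delta> n)) + \<delta> n) / sqrt (real n)"
    and "\<bar>sqrt (emp_mean n (\<lambda>i. (f n (X (\<omega> i)) j)\<^sup>2 * (\<zeta> n P u (\<omega> i))\<^sup>2)) - sd n P u j\<bar> \<le> sqrt (\<delta> n)"
proof -
  let ?g = "\<lambda>u i. f n (X (\<omega> i)) j * \<zeta> n P u (\<omega> i)"
  let ?e = "\<lambda>u. emp_mean n (\<lambda>i. (f n (X (\<omega> i)) j)\<^sup>2 * (\<zeta> n P u (\<omega> i))\<^sup>2)"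
  have sq: "emp_norm2 n (?g u) = sqrt (?e u)" for u
    by (simp add: emp_norm2_def power_mult_distrib)
  have close: "\<bar>emp_norm2 n (?g u) - sd n P u j\<bar> \<le> sqrt (\<delta> n)" if "u \<in> U" for u
    unfolding sq
  proof (rule abs_sqrt_diff_le)
    show "0 \<le> ?e u"
      by (simp add: emp_mean_def sum_nonneg)
    show "0 \<le> sd n P u j" unfolding sd_def by (intro real_sqrt_ge_zero integral_nonneg_AE) auto
    show "\<bar>?e u - (sd n P u j)\<^sup>2\<bar> \<le> \<delta> n"
      using \<omega>(2) that j unfolding empirical_regular_def by blast
  qed
  then show "\<bar>sqrt (?e u) - sd n P u j\<bar> \<le> sqrt (\<delta> n)"
    using u by (simp only: sq)
  obtain v where v: "v \<in> U" "dU u v \<le> 1 / real n"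
    "\<bar>emp_mean n (?g v)\<bar> \<le> b * sd n P v j / sqrt (real n)"
    using \<omega>(1) u j unfolding noise_regular_def by blast
  have diff: "sqrt (emp_mean n (\<lambda>i. (f n (X (\<omega> i)) j)\<^sup>2 * (\<zeta> n P u (\<omega> i) - \<zeta> n P v (\<omega> i))\<^sup>2)) \<le> \<delta> n"
    "\<bar>emp_mean n (\<lambda>i. f n (X (\<omega> i)) j * (\<zeta> n P u (\<omega> i) - \<zeta> n P v (\<omega> i)))\<bar> \<le> \<delta> n * real n powr (- 1 / 2)"
    using \<omega>(2) u v j unfolding empirical_regular_def by blast+
  have "\<bar>emp_norm2 n (?g u) - emp_norm2 n (?g v)\<bar> \<le> emp_norm2 n (\<lambda>i. ?g u i - ?g v i)"
    by (rule emp_norm2_diff_le)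
  also have "\<dots> \<le> \<delta> n"
    using diff(1) by (simp add: emp_norm2_def power_mult_distrib flip: right_diff_distrib)
  finally have sdv: "sd n P v j \<le> sd n P u j + (2 * sqrt (\<delta> n) + \<delta> n)"
    using close[OF u] close[OF v(1)] by linarith
  have "real n powr (- 1 / 2) = 1 / sqrt (real n)"
    by (cases "n = 0") (auto simp: powr_half_sqrt powr_minus_divide)
  then have dn: "\<bar>emp_mean n (\<lambda>i. ?g u i - ?g v i)\<bar> \<le> \<delta> n / sqrt (real n)"
    using diff(2) by (simp add: right_diff_distrib)
  have "\<bar>emp_mean n (?g u)\<bar> \<le> \<bar>emp_mean n (?g v)\<bar> + \<bar>emp_mean n (\<lambda>i. ?g u i - ?g v i)\<bar>"
    unfolding emp_mean_diff by linarith
  also have "\<dots> \<le> b * sd n P v j / sqrt (real n) + \<delta> n / sqrt (real n)"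
    using v(3) dn by linarith
  also have "\<dots> \<le> b * (sd n P u j + (2 * sqrt (\<delta> n) + \<delta> n)) / sqrt (real n) + \<delta> n / sqrt (real n)"
    using sdv b by (intro add_right_mono divide_right_mono mult_left_mono) auto
  finally show "\<bar>emp_mean n (?g u)\<bar> \<le> (b * (sd n P u j + (2 * sqrt (\<delta> n) + \<delta> n)) + \<delta> n) / sqrt (real n)"
    by (simp add: add_divide_distrib)
qed

end

context penalised_logit
begin

definition loading_lb :: "nat \<Rightarrow> 'w measure \<Rightarrow> (nat \<Rightarrow> real) \<Rightarrow> nat \<Rightarrow> real" where
  "loading_lb n P u j = (1 - \<epsilon>) * sd n P u j"

lemma penalty_level_eq: "1 \<le> n \<Longrightarrow> penalty_level c_pen (\<gamma> n) du n (p n) = \<mu> n * real n"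
  by (simp add: penalty_level_def \<mu>_def quant_def \<beta>_def real_div_sqrt field_simps)

lemma regular_score:
  assumes l: "large n" and P: "P \<in> \<P> n" and \<omega>: "regular n P \<omega>" and u: "u \<in> U" and j: "j < p n"
  shows "\<bar>emp_mean n (\<lambda>i. f n (X (\<omega> i)) j * \<zeta> n P u (\<omega> i))\<bar> \<le> noise_ratio * \<mu> n * loading_lb n P u j"
proof -
  note F = large_facts[OF l] and D = \<delta>_max_le[OF large_\<delta>[OF l]]
  have sd: "sd_min \<le> sd n P u j" by (rule sd_bounds[OF F(1) P u j])
  define Q where "Q = quant n"
  have Q: "1 \<le> Q" using F(9) by (simp add: Q_def)
  have e: "0 < \<epsilon>" "\<epsilon> < 1 / 2" using eps by auto
  define t where "t = 2 * sqrt (\<delta> n) + \<delta> n"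
  have t0: "0 \<le> t" using F(5) by (simp add: t_def)
  \<comment> \<open>With \<open>1 + \<epsilon> \<le> 3 / 2\<close> and both
    \<open>sqrt (\<delta> n)\<close> and \<open>\<delta> n\<close> at most a tenth of
    \<open>\<epsilon> * sd_min\<close>, the left side is at most 0.55 times
    \<open>\<epsilon> * sd_min\<close>.\<close>
  have t_le: "(1 + \<epsilon>) * t + \<delta> n \<le> \<epsilon> * sd n P u j"
  proof -
    have "(1 + \<epsilon>) * t \<le> 3 / 2 * t" using e t0 by (intro mult_right_mono) auto
    then have "(1 + \<epsilon>) * t + \<delta> n \<le> \<epsilon> * sd_min" using D(2,3) e sd_min_pos F(5) unfolding t_def by argo
    also have "\<dots> \<le> \<epsilon> * sd n P u j" using sd e by (intro mult_left_mono) auto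
    finally show ?thesis .
  qed
  have "\<bar>emp_mean n (\<lambda>i. f n (X (\<omega> i)) j * \<zeta> n P u (\<omega> i))\<bar>
      \<le> ((1 + \<epsilon>) * Q * (sd n P u j + t) + \<delta> n) / sqrt (real n)"
    using \<omega> e Q F(5) u j unfolding t_def Q_def regular_def by (intro noise_regular_score) auto
  \<comment> \<open>\<open>Q \<ge> 1\<close> lets the discretisation error be counted in units of
    the quantile, like the penalty.\<close>
  also have "\<dots> \<le> ((1 + \<epsilon>) * Q * (sd n P u j + t) + Q * \<delta> n) / sqrt (real n)"
    using Q F(5) mult_right_mono[of 1 Q "\<delta> n"] by (intro divide_right_mono add_left_mono) auto
  also have "\<dots> = Q * ((1 + \<epsilon>) * sd n P u j + ((1 + \<epsilon>) * t + \<delta> n)) / sqrt (real n)"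
    by (simp add: algebra_simps)
  also have "\<dots> \<le> Q * ((1 + \<epsilon>) * sd n P u j + \<epsilon> * sd n P u j) / sqrt (real n)"
    using t_le Q by (intro divide_right_mono mult_left_mono add_left_mono) auto
  also have "\<dots> = (1 + 2 * \<epsilon>) * sd n P u j * Q / sqrt (real n)" by (simp add: algebra_simps)
  also have "\<dots> = noise_ratio * \<mu> n * loading_lb n P u j"
    unfolding eps(5)[symmetric] loading_lb_def \<mu>_def Q_def by simp
  finally show ?thesis .
qed

text \<open>\<open>ideal\<close> lies within \<open>sqrt (\<delta> n)\<close> of \<open>sd\<close>,
  well inside the margin. \<open>initial\<close> exceeds \<open>loading_lb\<close> because half the
  root second moment bounds \<open>sd\<close>; the factor \<open>1 - \<epsilon>\<close> pays for
  replacing that moment by its empirical version.\<close>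

lemma regular_loadings:
  assumes l: "large n" and P: "P \<in> \<P> n" and \<omega>: "regular n P \<omega>" and u: "u \<in> U" and j: "j < p n"
  defines "ideal \<equiv> sqrt (emp_mean n (\<lambda>i. (f n (X (\<omega> i)) j)\<^sup>2 * (\<zeta> n P u (\<omega> i))\<^sup>2))"
    and "initial \<equiv> initial_loading n (\<lambda>i. f n (X (\<omega> i))) j"
  shows "lo \<le> loading_lb n P u j"
    and "loading_lb n P u j + \<epsilon> * sd_min / 2 \<le> ideal" "ideal + \<epsilon> * sd_min / 2 \<le> hi"
    and "loading_lb n P u j \<le> initial" "initial \<le> hi"
proof -
  note F = large_facts[OF l] and D = \<delta>_max_le[OF large_\<delta>[OF l]]
  note sd = sd_bounds[OF F(1) P u j] and m = second_moments[OF F(1) P j]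
  have e: "0 < \<epsilon>" "\<epsilon> < 1 / 2" using eps by auto
  let ?m = "\<integral>w. (f n (X w) j)\<^sup>2 \<partial>P" and ?e = "emp_mean n (\<lambda>i. (f n (X (\<omega> i)) j)\<^sup>2)"
  have id: "\<bar>ideal - sd n P u j\<bar> \<le> sqrt (\<delta> n)"
    using \<omega> e F(5,9) u j unfolding ideal_def regular_def
    by (intro noise_regular_score(2)[where b = "(1 + \<epsilon>) * quant n"]) auto
  have esd: "\<epsilon> * sd_min \<le> \<epsilon> * sd n P u j" using sd(1) e by (intro mult_left_mono) auto
  show "lo \<le> loading_lb n P u j"
    unfolding lo_def loading_lb_def using sd(1) e by (intro mult_left_mono) auto
  have es: "0 < \<epsilon> * sd_min" using e sd_min_pos by simp
  have sdC: "sd n P u j \<le> sqrt C / 2"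
  proof -
    have "(sd n P u j)\<^sup>2 \<le> (sqrt C / 2)\<^sup>2" using sd(3) m constants by (simp add: power_divide)
    then show ?thesis by (rule power2_le_imp_le) (use constants in simp)
  qed
  have C0: "0 \<le> sqrt C" using constants by simp
  have lb: "loading_lb n P u j = sd n P u j - \<epsilon> * sd n P u j" by (simp add: loading_lb_def algebra_simps)
  show "loading_lb n P u j + \<epsilon> * sd_min / 2 \<le> ideal"
    using id D(2) esd es unfolding lb abs_le_iff by argo
  have "\<epsilon> * sd_min \<le> 1 * sd_min" using e sd_min_pos by (intro mult_right_mono) auto
  then show "ideal + \<epsilon> * sd_min / 2 \<le> hi"
    using id D(2) sdC C0 es unfolding hi_def abs_le_iff by argo
  have mom: "\<bar>?e - ?m\<bar> \<le> \<epsilon> * c"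
    using \<omega> j unfolding regular_def moments_regular_def by blast
  have ini: "initial = sqrt (?e / 4)"
    by (simp add: initial_def initial_loading_def real_sqrt_divide)
  show "loading_lb n P u j \<le> initial"
    unfolding ini
  proof (rule real_le_rsqrt)
    have "(loading_lb n P u j)\<^sup>2 = (1 - \<epsilon>)\<^sup>2 * (sd n P u j)\<^sup>2" by (simp add: loading_lb_def power_mult_distrib)
    also have "\<dots> \<le> (1 - \<epsilon>) * (?m / 4)"
    proof (rule mult_mono[OF _ sd(3)])
      show "(1 - \<epsilon>)\<^sup>2 \<le> 1 - \<epsilon>" using e by (simp add: power2_eq_square mult_left_le)
    qed (use e in auto)
    also have "\<dots> = (?m - \<epsilon> * ?m) / 4" by (simp add: algebra_simps)
    also have "\<dots> \<le> ?e / 4"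
    proof -
      have "\<epsilon> * c \<le> \<epsilon> * ?m" using m e by (intro mult_left_mono) auto
      then show ?thesis using mom by (intro divide_right_mono) (auto simp: abs_le_iff)
    qed
    finally show "(loading_lb n P u j)\<^sup>2 \<le> ?e / 4" .
  qed
  have "?e / 4 \<le> (sqrt C)\<^sup>2"
  proof -
    have "\<epsilon> * c \<le> 1 * C" using e constants m by (intro mult_mono) auto
    then have "?e \<le> 2 * C" using mom m by (auto simp: abs_le_iff)
    then show ?thesis using constants by simp
  qed
  then have "initial \<le> sqrt C" unfolding ini using C0 by (rule real_le_lsqrt[rotated 1])
  then show "initial \<le> hi" using sd_min_pos by (simp add: hi_def)
qed

text \<open>Translation of the random event into the hypotheses of the deterministic part;
  \<open>m\<close> is the integer part of \<open>s * ln n\<close>.\<close>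

lemma regular_setting:
  assumes l: "large n" and P: "P \<in> \<P> n" and \<omega>: "regular n P \<omega>" and u: "u \<in> U"
  shows "lasso_setting n (p n) (\<lambda>i. Y u (\<omega> i)) (\<lambda>i. f n (X (\<omega> i))) (\<theta> n P u) (\<lambda>i. reg n P u (X (\<omega> i)))
    (\<mu> n) w R (K n) \<kappa>1 \<kappa>2 (s n) (nat \<lfloor>real (s n) * ln (real n)\<rfloor>) noise_ratio lo hi (loading_lb n P u) M"
proof -
  note F = large_facts[OF l] and D = \<delta>_max_le[OF large_\<delta>[OF l]]
  have reg_facts: "sample_regular n P \<omega>" "empirical_regular n P \<omega>" "eigen_regular n \<omega>"
    using \<omega> by (auto simp: regular_def)
  have K0: "0 \<le> K n" using K_lower(1)[OF F(1) P] p_pos[OF F(1)] by simp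
  have mem: "\<omega> i \<in> space W" if "i < n" for i
    using reg_facts(1) that unfolding sample_regular_def iid_sample_def space_PiM by (auto simp: PiE_iff)
  interpret S: logit_sample n "p n" "\<lambda>i. Y u (\<omega> i)" "\<lambda>i. f n (X (\<omega> i))"
    by standard (use F(2) binary[OF u mem] in auto)
  have n_pos: "0 < real n" using F(2) by simp
  have noise: "Y u (\<omega> i) - reg n P u (X (\<omega> i)) = \<zeta> n P u (\<omega> i)" for i by (simp add: \<zeta>_def)
  \<comment> \<open>The assumption concerns unit vectors; others are rescaled, which leaves the
    support unchanged, and a vector of norm 0 vanishes on the coordinates that count.\<close>
  have unit: "\<kappa>1 * norm_l2 (p n) v \<le> S.pred_norm v \<and> S.pred_norm v \<le> \<kappa>2 * norm_l2 (p n) v"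
    if v: "norm_l0 (p n) v \<le> nat \<lfloor>real (s n) * ln (real n)\<rfloor>" for v
  proof (cases "norm_l2 (p n) v = 0")
    case True
    then have "(\<Sum>j<p n. (v j)\<^sup>2) = 0" by (simp add: norm_l2_def)
    then have z: "\<forall>j\<in>{..<p n}. (v j)\<^sup>2 = 0" by (subst (asm) sum_nonneg_eq_0_iff) auto
    have "S.pred_norm v = 0"
      using z by (simp add: S.pred_norm_def dotp_def emp_norm2_def emp_mean_def)
    then show ?thesis using True by simp
  next
    case False
    define a where "a = norm_l2 (p n) v"
    have a: "0 < a" using False norm_l2_nonneg[of "p n" v] by (simp add: a_def less_le)
    have supp: "supp (p n) (\<lambda>j. 1 / a * v j) = supp (p n) v" using a by (auto simp: supp_def)
    have "0 \<le> real (s n) * ln (real n)" using F(3) by simp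
    then have "real (nat \<lfloor>real (s n) * ln (real n)\<rfloor>) \<le> real (s n) * ln (real n)" by (rule of_nat_floor)
    then have "real (norm_l0 (p n) v) \<le> real (s n) * ln (real n)" using v by linarith
    then have 1: "real (norm_l0 (p n) (\<lambda>j. 1 / a * v j)) \<le> real (s n) * ln (real n)"
      by (simp only: norm_l0_def supp)
    have 2: "norm_l2 (p n) (\<lambda>j. 1 / a * v j) = 1"
      unfolding norm_l2_scale using a by (simp add: a_def)
    have "\<kappa>1 \<le> S.pred_norm (\<lambda>j. 1 / a * v j) \<and> S.pred_norm (\<lambda>j. 1 / a * v j) \<le> \<kappa>2"
      unfolding S.pred_norm_def
      using reg_facts(3)[unfolded eigen_regular_def, THEN spec, THEN mp, OF conjI[OF 1 2]] .
    then have "\<kappa>1 \<le> S.pred_norm v / a \<and> S.pred_norm v / a \<le> \<kappa>2"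
      using a unfolding S.pred_norm_scale by simp
    then show ?thesis using a by (simp add: a_def[symmetric] field_simps)
  qed
  show ?thesis
  proof unfold_locales
    show "0 < \<mu> n" by (rule F)
    show "1 \<le> s n" by (rule s_pos[OF F(1)])
    show "norm_l0 (p n) (\<theta> n P u) \<le> s n" by (rule sparsity[OF F(1) P u])
    fix i assume i: "i < n"
    define a where "a = logistic (dotp (p n) (f n (X (\<omega> i))) (\<theta> n P u))"
    have "cl \<le> a + r n P u (X (\<omega> i)) \<and> a + r n P u (X (\<omega> i)) \<le> 1 - cl \<and> \<bar>r n P u (X (\<omega> i))\<bar> \<le> \<delta> n"
      using reg_facts(1) i u unfolding sample_regular_def reg_def a_def by blast
    then have "0 \<le> a - cl / 2" "0 \<le> 1 - cl / 2 - a" using D(1) by auto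
    then have "0 \<le> (a - cl / 2) * (1 - cl / 2 - a)" by (rule mult_nonneg_nonneg)
    then have "w \<le> a * (1 - a)" by (simp add: w_def algebra_simps)
    then show "w \<le> logistic (dotp (p n) (f n (X (\<omega> i))) (\<theta> n P u)) * (1 - logistic (dotp (p n) (f n (X (\<omega> i))) (\<theta> n P u)))"
      by (simp add: a_def)
    show "\<bar>f n (X (\<omega> i)) j\<bar> \<le> K n" if "j < p n" for j
      using reg_facts(1) i that unfolding sample_regular_def by blast
  next
    let ?d = "\<lambda>i. reg n P u (X (\<omega> i)) - logistic (dotp (p n) (f n (X (\<omega> i))) (\<theta> n P u))"
    have "emp_norm2 n ?d
      = sqrt (emp_mean n (\<lambda>i. (r n P u (X (\<omega> i)))\<^sup>2))" by (simp add: reg_def emp_norm2_def)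
    also have "\<dots> \<le> sqrt (C * real (s n) * log_pn n / real n)"
      using reg_facts(2) u unfolding empirical_regular_def by (intro real_sqrt_le_mono) blast
    also have "\<dots> = sqrt C * sqrt (real (s n)) * sqrt (log_pn n) / sqrt (real n)"
      by (simp add: real_sqrt_mult real_sqrt_divide)
    also have "\<dots> \<le> sqrt C * sqrt (real (s n)) * (2 * quant n) / sqrt (real n)"
      using F(8) constants by (intro divide_right_mono mult_left_mono) auto
    also have "\<dots> = R * sqrt (real (s n)) * \<mu> n"
      using slack by (simp add: R_def \<mu>_def)
    finally show "emp_norm2 n ?d
      \<le> R * sqrt (real (s n)) * \<mu> n" .
  next
    show "\<kappa>1 * norm_l2 (p n) v \<le> S.pred_norm v" "S.pred_norm v \<le> \<kappa>2 * norm_l2 (p n) v"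
      if "norm_l0 (p n) v \<le> nat \<lfloor>real (s n) * ln (real n)\<rfloor>" for v using unit[OF that] by auto
  next
    fix j assume j: "j < p n"
    show "\<bar>emp_mean n (\<lambda>i. f n (X (\<omega> i)) j * (Y u (\<omega> i) - reg n P u (X (\<omega> i))))\<bar> \<le> noise_ratio * \<mu> n * loading_lb n P u j"
      unfolding noise by (rule regular_score[OF l P \<omega> u j])
    show "lo \<le> loading_lb n P u j" by (rule regular_loadings[OF l P \<omega> u j])
  next
    have "real (s n) * (1 + real M) \<le> real (s n) * ln (real n)"
      using l by (intro mult_left_mono) (auto simp: large_def)
    then have "real (s n + M * s n) \<le> real (s n) * ln (real n)" by (simp add: algebra_simps)
    then show "s n + M * s n \<le> nat \<lfloor>real (s n) * ln (real n)\<rfloor>" by (simp only: le_nat_floor)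
  next
    have "0 \<le> cone * rate" "0 \<le> post_cone * post_rate" using constants_nonneg by auto
    from K_s_mu_small[OF l K0 this(1) D(6)] K_s_mu_small[OF l K0 this(2) D(7)]
    show "K n * cone * rate * real (s n) * \<mu> n \<le> 1" "K n * post_cone * post_rate * real (s n) * \<mu> n \<le> 1"
      by (simp_all only: ac_simps)
  qed (use R0 constants w0 M_bounds K0 in auto)
qed

text \<open>A sum in place of a maximum, so that it bounds each constant;
  \<open>c_pen * quant_const\<close> converts \<open>\<mu> n\<close> into
  \<open>sqrt (log_pn n / n)\<close>, and the 1 makes it positive.\<close>

definition rate_const :: real where
  "rate_const = c_pen * quant_const * (rate + cone * rate + post_rate + post_cone * post_rate) + support_factor + 1"

lemma rate_const_pos: "0 < rate_const"
proof -
  have "0 \<le> c_pen * quant_const * (rate + cone * rate + post_rate + post_cone * post_rate)"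
    using constants_nonneg slack quant_const_pos by (intro mult_nonneg_nonneg add_nonneg_nonneg) auto
  then show ?thesis using constants_nonneg(6) unfolding rate_const_def by linarith
qed

lemma regular_bounds:
  assumes l: "large n" and P: "P \<in> \<P> n" and \<omega>: "regular n P \<omega>" and u: "u \<in> U"
    and alg: "algorithm_output n (p n) (penalty_level c_pen (\<gamma> n) du n (p n)) k
        (\<lambda>i. Y u (\<omega> i)) (\<lambda>i. f n (X (\<omega> i))) h t"
  defines "L \<equiv> ln (max (real (p n)) (real n))"
  shows "emp_norm2 n (\<lambda>i. dotp (p n) (f n (X (\<omega> i))) (\<lambda>j. h j - \<theta> n P u j))
      \<le> rate_const * sqrt (real (s n) * L / real n)"
    and "norm_l1 (p n) (\<lambda>j. h j - \<theta> n P u j) \<le> rate_const * sqrt ((real (s n))\<^sup>2 * L / real n)"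
    and "real (norm_l0 (p n) h) \<le> rate_const * real (s n)"
    and "emp_norm2 n (\<lambda>i. dotp (p n) (f n (X (\<omega> i))) (\<lambda>j. t j - \<theta> n P u j))
      \<le> rate_const * sqrt (real (s n) * L / real n)"
    and "norm_l1 (p n) (\<lambda>j. t j - \<theta> n P u j) \<le> rate_const * sqrt ((real (s n))\<^sup>2 * L / real n)"
proof -
  note F = large_facts[OF l] and D = \<delta>_max_le[OF large_\<delta>[OF l]]
  have K0: "0 \<le> K n" using K_lower(1)[OF F(1) P] p_pos[OF F(1)] by simp
  interpret S: lasso_setting n "p n" "\<lambda>i. Y u (\<omega> i)" "\<lambda>i. f n (X (\<omega> i))" "\<theta> n P u" "\<lambda>i. reg n P u (X (\<omega> i))"
    "\<mu> n" w R "K n" \<kappa>1 \<kappa>2 "s n" "nat \<lfloor>real (s n) * ln (real n)\<rfloor>" noise_ratio lo hi "loading_lb n P u" M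
    by (rule regular_setting[OF l P \<omega> u])
  have noise: "Y u (\<omega> i) - reg n P u (X (\<omega> i)) = \<zeta> n P u (\<omega> i)" for i by (simp add: \<zeta>_def)
  have s1: "1 \<le> real (s n)" using s_pos[OF F(1)] by simp
  have \<tau>: "K n * (post_rate + R) * sqrt (real (s n)) * \<mu> n \<le> \<epsilon> * sd_min / 2"
  proof -
    have a: "0 \<le> post_rate + R" using constants_nonneg(8) R0 by simp
    have "sqrt (real (s n)) \<le> real (s n)"
      using s1 by (intro real_le_lsqrt) (auto simp: power2_eq_square mult_le_cancel_left1)
    then have "K n * (post_rate + R) * sqrt (real (s n)) * \<mu> n \<le> K n * (post_rate + R) * real (s n) * \<mu> n"
      using K0 a F(11) by (intro mult_right_mono mult_left_mono) auto
    also have "\<dots> = (post_rate + R) * (K n * real (s n) * \<mu> n)" by (simp only: ac_simps)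
    also have "\<dots> \<le> \<epsilon> * sd_min / 2" by (rule K_s_mu_small[OF l K0 a D(8)])
    finally show ?thesis .
  qed
  note B = S.algorithm_bounds[where \<tau> = "\<epsilon> * sd_min / 2" and K = k and h = h and t = t,
      OF _ _ \<tau> alg[unfolded penalty_level_eq[OF F(2)]], unfolded noise]
  let ?ideal = "\<lambda>j. sqrt (emp_mean n (\<lambda>i. (f n (X (\<omega> i)) j)\<^sup>2 * (\<zeta> n P u (\<omega> i))\<^sup>2))"
    and ?initial = "\<lambda>j. initial_loading n (\<lambda>i. f n (X (\<omega> i))) j"
  have ld: "loading_lb n P u j \<le> ?initial j \<and> ?initial j \<le> hi"
    "loading_lb n P u j + \<epsilon> * sd_min / 2 \<le> ?ideal j \<and>
     ?ideal j + \<epsilon> * sd_min / 2 \<le> hi" if "j < p n" for j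
    using regular_loadings[OF l P \<omega> u that] by auto
  note B = B[OF ld, unfolded S.pred_norm_def]
  have \<mu>: "\<mu> n \<le> c_pen * quant_const * sqrt (L / real n)"
  proof -
    have "\<mu> n \<le> c_pen * (quant_const * sqrt (log_pn n)) / sqrt (real n)"
      unfolding \<mu>_def using F(10) slack by (intro divide_right_mono mult_left_mono) auto
    then show ?thesis by (simp add: real_sqrt_divide L_def log_pn_def)
  qed
  have c0: "0 \<le> rate" "0 \<le> cone * rate" "0 \<le> post_rate" "0 \<le> post_cone * post_rate" "0 \<le> support_factor" "0 < c_pen * quant_const"
    using constants_nonneg slack quant_const_pos by auto
  have L0: "0 \<le> L / real n" using F(4) by (simp add: L_def log_pn_def)
  \<comment> \<open>Both shapes of rate at once: \<open>b = sqrt s\<close> for the prediction norm,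
    \<open>b = s\<close> for the l1 norm.\<close>
  have final: "a * b * \<mu> n \<le> rate_const * sqrt (b\<^sup>2 * L / real n)"
    if a: "0 \<le> a" "a \<le> rate + cone * rate + post_rate + post_cone * post_rate" and b: "0 \<le> b" for a b
  proof -
    have "a * b * \<mu> n \<le> a * b * (c_pen * quant_const * sqrt (L / real n))"
      using a b \<mu> by (intro mult_left_mono) auto
    also have "\<dots> = (c_pen * quant_const * a) * (b * sqrt (L / real n))" by (simp only: ac_simps)
    also have "\<dots> \<le> rate_const * (b * sqrt (L / real n))"
    proof (rule mult_right_mono)
      have "c_pen * quant_const * a \<le> c_pen * quant_const * (rate + cone * rate + post_rate + post_cone * post_rate)"
        using a c0(6) by (intro mult_left_mono) auto
      then show "c_pen * quant_const * a \<le> rate_const" using c0(5) unfolding rate_const_def by linarith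
      show "0 \<le> b * sqrt (L / real n)" using b L0 by simp
    qed
    also have "b * sqrt (L / real n) = sqrt (b\<^sup>2 * L / real n)"
      using b by (simp add: real_sqrt_mult real_sqrt_divide)
    finally show ?thesis .
  qed
  have sq: "(sqrt (real (s n)))\<^sup>2 = real (s n)" by simp
  show "emp_norm2 n (\<lambda>i. dotp (p n) (f n (X (\<omega> i))) (\<lambda>j. h j - \<theta> n P u j)) \<le> rate_const * sqrt (real (s n) * L / real n)"
    using B(1) final[of rate "sqrt (real (s n))"] c0 unfolding sq by simp
  show "norm_l1 (p n) (\<lambda>j. h j - \<theta> n P u j) \<le> rate_const * sqrt ((real (s n))\<^sup>2 * L / real n)"
    using B(2) final[of "cone * rate" "real (s n)"] c0 by simp
  show "emp_norm2 n (\<lambda>i. dotp (p n) (f n (X (\<omega> i))) (\<lambda>j. t j - \<theta> n P u j)) \<le> rate_const * sqrt (real (s n) * L / real n)"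
    using B(4) final[of post_rate "sqrt (real (s n))"] c0 unfolding sq by simp
  show "norm_l1 (p n) (\<lambda>j. t j - \<theta> n P u j) \<le> rate_const * sqrt ((real (s n))\<^sup>2 * L / real n)"
    using B(5) final[of "post_cone * post_rate" "real (s n)"] c0 by simp
  have "support_factor \<le> rate_const"
    using c0 mult_nonneg_nonneg[of "c_pen * quant_const" "rate + cone * rate + post_rate + post_cone * post_rate"]
    unfolding rate_const_def by linarith
  then have "support_factor * real (s n) \<le> rate_const * real (s n)" by (rule mult_right_mono) simp
  then show "real (norm_l0 (p n) h) \<le> rate_const * real (s n)" using B(3) by linarith
qed

end

theorem theorem6p2:
  fixes W :: "'w measure" and XS :: "'x measure"
    and U :: "(nat \<Rightarrow> real) set" and du :: nat
    and dU :: "(nat \<Rightarrow> real) \<Rightarrow> (nat \<Rightarrow> real) \<Rightarrow> real"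
    and X :: "'w \<Rightarrow> 'x" and Y :: "(nat \<Rightarrow> real) \<Rightarrow> 'w \<Rightarrow> real"
    and \<P> :: "nat \<Rightarrow> 'w measure set"
    and p s :: "nat \<Rightarrow> nat" and f :: "nat \<Rightarrow> 'x \<Rightarrow> nat \<Rightarrow> real"
    and \<theta> :: "nat \<Rightarrow> 'w measure \<Rightarrow> (nat \<Rightarrow> real) \<Rightarrow> nat \<Rightarrow> real"
    and r :: "nat \<Rightarrow> 'w measure \<Rightarrow> (nat \<Rightarrow> real) \<Rightarrow> 'x \<Rightarrow> real"
    and K \<delta> \<Delta> \<gamma> :: "nat \<Rightarrow> real" and n\<^sub>0 K_iter :: nat
    and c C cl \<kappa>1 \<kappa>2 c_pen :: real
    and \<theta>hat \<theta>tilde :: "nat \<Rightarrow> (nat \<Rightarrow> 'w) \<Rightarrow> (nat \<Rightarrow> real) \<Rightarrow> nat \<Rightarrow> real"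
  assumes G: "assumption_G W XS U du dU X Y \<P> p f \<theta> r s K \<delta> \<Delta> n\<^sub>0 c C cl \<kappa>1 \<kappa>2"
    and slack: "1 < c_pen" and iterations: "1 \<le> K_iter"
    and gamma: "\<And>n. n \<ge> n\<^sub>0 \<Longrightarrow> 1 / real n \<le> \<gamma> n \<and>
      \<gamma> n \<le> min (1 / ln (real n)) (real (p n) * real n powr (real du - 1))"
    and estimators: "\<And>n \<omega> u. n \<ge> n\<^sub>0 \<Longrightarrow> \<omega> \<in> space (iid_sample n W) \<Longrightarrow> u \<in> U \<Longrightarrow>
      algorithm_output n (p n) (penalty_level c_pen (\<gamma> n) du n (p n)) K_iter
        (\<lambda>i. Y u (\<omega> i)) (\<lambda>i. f n (X (\<omega> i))) (\<theta>hat n \<omega> u) (\<theta>tilde n \<omega> u)"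
  shows "\<exists>Cbar :: real. 0 < Cbar \<and>
    uniformly_whp \<P> (\<lambda>n P \<omega>.
      (\<forall>u\<in>U. emp_norm2 n (\<lambda>i. dotp (p n) (f n (X (\<omega> i))) (\<lambda>j. \<theta>hat n \<omega> u j - \<theta> n P u j))
         \<le> Cbar * sqrt (real (s n) * ln (max (real (p n)) (real n)) / real n)) \<and>
      (\<forall>u\<in>U. norm_l1 (p n) (\<lambda>j. \<theta>hat n \<omega> u j - \<theta> n P u j)
         \<le> Cbar * sqrt ((real (s n))\<^sup>2 * ln (max (real (p n)) (real n)) / real n)) \<and>
      (\<forall>u\<in>U. real (norm_l0 (p n) (\<theta>hat n \<omega> u)) \<le> Cbar * real (s n))) \<and>
    uniformly_whp \<P> (\<lambda>n P \<omega>.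
      (\<forall>u\<in>U. emp_norm2 n (\<lambda>i. dotp (p n) (f n (X (\<omega> i))) (\<lambda>j. \<theta>tilde n \<omega> u j - \<theta> n P u j))
         \<le> Cbar * sqrt (real (s n) * ln (max (real (p n)) (real n)) / real n)) \<and>
      (\<forall>u\<in>U. norm_l1 (p n) (\<lambda>j. \<theta>tilde n \<omega> u j - \<theta> n P u j)
         \<le> Cbar * sqrt ((real (s n))\<^sup>2 * ln (max (real (p n)) (real n)) / real n)))"
proof -
  interpret L: penalised_logit W XS U du dU X Y \<P> p f \<theta> r s K \<delta> \<Delta> n\<^sub>0 c C cl \<kappa>1 \<kappa>2 \<gamma> c_pen
    using G slack gamma by (intro penalised_logit.intro penalised_logit_axioms.intro)
  define \<eta> where "\<eta> = (\<lambda>n. 2 * \<Delta> n + 2 / real n + tail_const (1 + L.\<epsilon>) / ln (real n))"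
  have "\<eta> \<longlonglongrightarrow> 2 * 0 + 0 + 0"
    unfolding \<eta>_def
  proof (intro tendsto_add tendsto_mult tendsto_const)
    show "\<Delta> \<longlonglongrightarrow> 0" using L.null_sequences(2) by (simp add: poly_slow_null_def)
    show "(\<lambda>n. 2 / real n) \<longlonglongrightarrow> 0" by (rule lim_const_over_n)
    show "(\<lambda>n. tail_const (1 + L.\<epsilon>) / ln (real n)) \<longlonglongrightarrow> 0"
      by (rule real_tendsto_divide_at_top[OF tendsto_const
            filterlim_compose[OF ln_at_top filterlim_real_sequentially]])
  qed
  then have \<eta>: "\<eta> \<longlonglongrightarrow> 0" by simp
  \<comment> \<open>Both conclusions are deterministic consequences of \<open>regular\<close>, so
    one sequence \<open>\<eta>\<close> and one event serve for both.\<close>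
  have whp: "uniformly_whp \<P> Q"
    if Q: "\<And>n P \<omega>. L.large n \<Longrightarrow> P \<in> \<P> n \<Longrightarrow> L.regular n P \<omega> \<Longrightarrow> Q n P \<omega>" for Q
    unfolding uniformly_whp_def
  proof (intro exI[of _ \<eta>] conjI \<eta>)
    show "\<forall>\<^sub>F n in sequentially. \<forall>P\<in>\<P> n. with_prob_ge (iid_sample n P) (1 - \<eta> n) (Q n P)"
      using L.eventually_large
    proof eventually_elim
      case (elim n)
      show ?case
      proof
        fix P assume P: "P \<in> \<P> n"
        show "with_prob_ge (iid_sample n P) (1 - \<eta> n) (Q n P)"
          using L.with_prob_ge_regular[OF elim P] unfolding \<eta>_def
          by (rule with_prob_ge_mono) (use Q[OF elim P] in auto)
      qed
    qed
  qed
  have alg: "algorithm_output n (p n) (penalty_level c_pen (\<gamma> n) du n (p n)) K_iter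
        (\<lambda>i. Y u (\<omega> i)) (\<lambda>i. f n (X (\<omega> i))) (\<theta>hat n \<omega> u) (\<theta>tilde n \<omega> u)"
    if "L.large n" "L.regular n P \<omega>" "u \<in> U" for n P \<omega> u
    using that by (intro estimators) (auto simp: L.large_def L.regular_def L.sample_regular_def)
  show ?thesis
    by (intro exI[of _ L.rate_const] conjI L.rate_const_pos whp ballI)
      (blast intro: L.regular_bounds alg)+
qed

end
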